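(* Let $M$ be a complete Riemannian manifold. Let $\mathbf{C}^{\rm geod}$ be the category whose objects are triples $(p,X,a)$ with $p\in M$, $X\in T_pM$, $a\in\mathbb{R}$, and whose morphisms are triples $(\gamma,\widetilde X,a)$ with $\gamma\in\mathcal{P}M^{bt}_c$, $\widetilde X\in T_\gamma\mathcal{P}M^{bt}_c$, $a\in\mathbb{R}$. Let $\mathbf{C}^{\rm geod}_{(2)}$ be the category whose objects are the triples $(\gamma,\widetilde X,a)$ (the morphisms of $\mathbf{C}^{\rm geod}$) and whose morphisms are the geodesic segments ${}_{[a,b]}\Gamma^{(\gamma,\widetilde X)}$ on the path space, with composition $\star$, and equip it with the partial product $\star_{\rm H}$ (the source and target maps, compositions, identities and partial product being those specified in the context). Then $\mathbf{C}^{\rm geod}_{(2)}$, with the partial product $\star_{\rm H}$, is a double category over $\mathbf{C}^{\rm geod}$.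
   Context: **Double category.** A double category $\mathcal{C}_{(2)}$ over a category $\mathcal{C}$ is a category whose objects are the arrows of $\mathcal{C}$ and on which there is a partially defined binary operation $(G,F)\mapsto G\circ_HF$ for certain pairs of morphisms $F,G\in\mathrm{Mor}(\mathcal{C}_{(2)})$ such that (with $\mathrm{s},\mathrm{t}$ the source and target maps): (i) $\mathrm{s}(G\circ_HF)=\mathrm{s}(G)\circ\mathrm{s}(F)$ and $\mathrm{t}(G\circ_HF)=\mathrm{t}(G)\circ\mathrm{t}(F)$ whenever $G\circ_HF$ is defined; (ii) the exchange law $(G'\circ G)\circ_H(F'\circ F)=(G'\circ_HF')\circ(G\circ_HF)$ holds whenever either side is defined. **Paths.** $\mathcal{P}M=C^\infty([0,1],M)$. $T_\gamma\mathcal{P}M$ is the space of smooth vector fields along $\gamma$. $\mathcal{P}M_c\subset\mathcal{P}M$ is the set of paths that are constant near the end points (for some $\delta>0$, constant on $[0,\delta)$ and on $(1-\delta,1]$). If $\gamma_2(0)=\gamma_1(1)$, then $\gamma_2\circ\gamma_1$ is the path $t\mapsto\gamma_1(2t)$ for $0\le t\le\frac12$, $t\mapsto\gamma_2(2t-1)$ for $\frac12<t\le1$. **Back-track equivalence.** Paths differing by a strictly increasing continuous reparametrization $\phi:[0,1]\to[0,1]$, $\phi(0)=0$, $\phi(1)=1$, are identified. Two paths are elementary back-track equivalent if, after strictly increasing reparametrizations, one of them traverses successively smooth paths $\lambda_3$, $\lambda_2$, the reverse of $\lambda_2$, and $\lambda_1$, while the other traverses successively $\lambda_3$ and $\lambda_1$.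 Two paths are back-track equivalent, $\gamma\simeq_{bt}\gamma'$, if they are connected by a finite sequence of paths with consecutive ones elementary back-track equivalent. Set $\mathcal{P}M^{bt}_c=\mathcal{P}M_c/\simeq_{bt}$; an equivalence class is denoted by a representative $\gamma$. A path $\gamma$ has a back-track over $[T,T+\sigma]$, where $[T,T+2\sigma]\subset[0,1]$, if $\gamma(T+u)=\gamma(T+2\sigma-u)$ for all $u\in[0,\sigma]$. A vector $\widetilde X\in T_\gamma\mathcal{P}M^{bt}_c$ is a smooth vector field along $\gamma$ that is constant near the end points $0,1$ and whose back-track coincides with that of $\gamma$: if $\gamma$ has a back-track over $[T,T+\sigma]$ then $\widetilde X(T+u)=\widetilde X(T+2\sigma-u)$ for all $u\in[0,\sigma]$. Vector fields are also taken up to back-track equivalence (as paths in $TM$), and all paths and vector fields below are considered under this back-track identification. **The category $\mathbf{C}^{\rm geod}$.** Objects and morphisms are as in the claim. Source and target are $\mathrm{s}(\gamma,\widetilde X,a)=(\gamma(0),\widetilde X(0),a)$ and $\mathrm{t}(\gamma,\widetilde X,a)=(\gamma(1),\widetilde X(1),a)$. When $\gamma_2(0)=\gamma_1(1)$ and $\widetilde X_2(0)=\widetilde X_1(1)$, composition is $(\gamma_2,\widetilde X_2,a)\circ(\gamma_1,\widetilde X_1,a)=(\gamma_2\circ\gamma_1,\widetilde X_2\circ\widetilde X_1,a)$, where $\widetilde X_2\circ\widetilde X_1$ is the vector field along $\gamma_2\circ\gamma_1$ given by $\widetilde X_1$ on the first half and $\widetilde X_2$ on the second half. The identity of $(p,X,a)$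 is given by the constant maps $[0,1]\to p$, $[0,1]\to X$ and $a$. **Geodesics on path space.** For $\gamma\in\mathcal{P}M$, $\widetilde X\in T_\gamma\mathcal{P}M$, the path space geodesic $\Gamma^{(\gamma,\widetilde X)}:\mathbb{R}\to\mathcal{P}M$ with initial conditions $(\gamma,\widetilde X)$ is the map such that for each $t\in[0,1]$ the transverse path $\Gamma^{(\gamma,\widetilde X)}_t(s)=\Gamma^{(\gamma,\widetilde X)}(s)(t)$ is the geodesic of $M$ (for the Riemannian connection) with $\Gamma_t(0)=\gamma(t)$ and $\frac{\partial\Gamma_t(s)}{\partial s}\big|_{0}=\widetilde X(t)$; it is defined for all $s\in\mathbb{R}$ because $M$ is complete. Its segment over $[a,b]\subset\mathbb{R}$ is denoted ${}_{[a,b]}\Gamma^{(\gamma,\widetilde X)}$. **The category $\mathbf{C}^{\rm geod}_{(2)}$.** Objects are triples $(\gamma,\widetilde X,a)$ with $\gamma\in\mathcal{P}M^{bt}_c$, $\widetilde X\in T_\gamma\mathcal{P}M^{bt}_c$, $a\in\mathbb{R}$ (that is, the morphisms of $\mathbf{C}^{\rm geod}$); morphisms are the segments ${}_{[a,b]}\Gamma^{(\gamma,\widetilde X)}$ with $\gamma\in\mathcal{P}M^{bt}_c$, $\widetilde X\in T_\gamma\mathcal{P}M^{bt}_c$, $a\le b$. The source is $(\lambda_a,\widetilde Y_a,a)$ and the target is $(\lambda_b,\widetilde Y_b,b)$, where for $r\in\{a,b\}$, $\lambda_r=\Gamma^{(\gamma,\widetilde X)}(r)$ and $\widetilde Y_r(t)=\frac{\partial\Gamma_t^{(\gamma,\widetilde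 X)}(s)}{\partial s}\big|_{r}$. If the source of ${}_{[b,c]}\Gamma^{(\gamma_2,\widetilde X_2)}$ equals the target of ${}_{[a,b]}\Gamma^{(\gamma_1,\widetilde X_1)}$, then necessarily $(\gamma_2,\widetilde X_2)=(\gamma_1,\widetilde X_1)$, and composition is extension of the segment: ${}_{[b,c]}\Gamma^{(\gamma_1,\widetilde X_1)}\star{}_{[a,b]}\Gamma^{(\gamma_1,\widetilde X_1)}={}_{[a,c]}\Gamma^{(\gamma_1,\widetilde X_1)}$. The identity at $(\gamma,\widetilde X,a)$ is the degenerate segment $[a,a]\to\{\gamma\}$. **The partial product.** For ${}_{[a,b]}\Gamma^{(\gamma_1,\widetilde X_1)}$ and ${}_{[a,b]}\Gamma^{(\gamma_2,\widetilde X_2)}$ over the same interval with $\gamma_1(1)=\gamma_2(0)$ and $\widetilde X_1(1)=\widetilde X_2(0)$, define ${}_{[a,b]}\Gamma^{(\gamma_2,\widetilde X_2)}\star_{\rm H}{}_{[a,b]}\Gamma^{(\gamma_1,\widetilde X_1)}={}_{[a,b]}\Gamma^{(\gamma_2\circ\gamma_1,\widetilde X_2\circ\widetilde X_1)}$.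
   Formalization: The back-track condition on vector fields restricts only the identification of pairs as paths in TM (composites and geodesics do not preserve it); the exchange law presupposes its four inner composites (else one side may be defined without the other); M has positive dimension. *)

theory Defs
  imports "HOL-Analysis.Analysis"
begin

section \<open>Smoothness in Euclidean space\<close>

fun Ck_on :: "nat \<Rightarrow> 'e::euclidean_space set \<Rightarrow> ('e \<Rightarrow> 'f::real_normed_vector) \<Rightarrow> bool" where
  "Ck_on 0 S f \<longleftrightarrow> continuous_on S f"
| "Ck_on (Suc k) S f \<longleftrightarrow>
     (\<forall>x\<in>S. f differentiable (at x)) \<and> (\<forall>v. Ck_on k S (\<lambda>x. frechet_derivative f (at x) v))"

text \<open>Only meaningful for open sets.\<close>

definition smooth_on :: "'e::euclidean_space set \<Rightarrow> ('e \<Rightarrow> 'f::real_normed_vector) \<Rightarrow> bool" where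
  "smooth_on S f \<longleftrightarrow> (\<forall>k. Ck_on k S f)"

text \<open>Smoothness of a curve on a set of parameters without isolated points, with one-sided
  derivatives at boundary points; \<open>D k\<close> is the derivative of order \<open>k\<close>.\<close>

definition smooth_curve_on :: "real set \<Rightarrow> (real \<Rightarrow> 'e::real_normed_vector) \<Rightarrow> bool" where
  "smooth_curve_on J f \<longleftrightarrow> (\<exists>D. (\<forall>t\<in>J. D (0::nat) t = f t) \<and>
     (\<forall>k. \<forall>t\<in>J. (D k has_vector_derivative D (Suc k) t) (at t within J)))"


section \<open>Smooth manifolds and tangent vectors\<close>

text \<open>A chart is a pair of its domain and its coordinate map. The manifold is the whole type
  \<open>'a\<close>, with the topology of that type.\<close>

type_synonym ('a, 'e) chart = "'a set \<times> ('a \<Rightarrow> 'e)"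

definition transition :: "('a, 'e) chart \<Rightarrow> ('a, 'e) chart \<Rightarrow> 'e \<Rightarrow> 'e" where
  "transition c c' = snd c' \<circ> inv_into (fst c) (snd c)"

definition smooth_atlas ::
    "('a::{t2_space, second_countable_topology}, 'e::euclidean_space) chart set \<Rightarrow> bool" where
  "smooth_atlas A \<longleftrightarrow>
     (\<Union>c\<in>A. fst c) = UNIV \<and>
     (\<forall>c\<in>A. open (fst c) \<and> open (snd c ` fst c) \<and>
        homeomorphism (fst c) (snd c ` fst c) (snd c) (inv_into (fst c) (snd c))) \<and>
     (\<forall>c\<in>A. \<forall>c'\<in>A. smooth_on (snd c ` (fst c \<inter> fst c')) (transition c c'))"

text \<open>A tangent vector at \<open>p\<close> is the family of its coordinate vectors in all charts around
  \<open>p\<close>, related by the derivatives of the transition maps. At the other charts the family is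
  \<open>0\<close>, so that equality of tangent vectors is equality of functions.\<close>

type_synonym ('a, 'e) tvec = "('a, 'e) chart \<Rightarrow> 'e"

definition tangent_space ::
    "('a, 'e::euclidean_space) chart set \<Rightarrow> 'a \<Rightarrow> ('a, 'e) tvec set" where
  "tangent_space A p = {X.
     (\<forall>c. \<not> (c \<in> A \<and> p \<in> fst c) \<longrightarrow> X c = 0) \<and>
     (\<forall>c\<in>A. \<forall>c'\<in>A. p \<in> fst c \<longrightarrow> p \<in> fst c' \<longrightarrow>
        X c' = frechet_derivative (transition c c') (at (snd c p)) (X c))}"

text \<open>The tangent vector at \<open>p\<close> with coordinates \<open>u\<close> in the chart \<open>c\<close>.\<close>

definition coord_vector ::
    "('a, 'e::euclidean_space) chart set \<Rightarrow> ('a, 'e) chart \<Rightarrow> 'a \<Rightarrow> 'e \<Rightarrow> ('a, 'e) tvec" where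
  "coord_vector A c p u = (\<lambda>c'. if c' \<in> A \<and> p \<in> fst c'
     then frechet_derivative (transition c c') (at (snd c p)) u else 0)"

definition velocity ::
    "('a, 'e::euclidean_space) chart set \<Rightarrow> (real \<Rightarrow> 'a) \<Rightarrow> real \<Rightarrow> ('a, 'e) tvec" where
  "velocity A \<sigma> s = (\<lambda>c. if c \<in> A \<and> \<sigma> s \<in> fst c
     then vector_derivative (snd c \<circ> \<sigma>) (at s) else 0)"


section \<open>Riemannian metrics and geodesics\<close>

text \<open>A metric assigns to \<open>p\<close> a form on the tangent space at \<open>p\<close>; its values off the
  tangent space are irrelevant.\<close>

type_synonym ('a, 'e) metric = "'a \<Rightarrow> ('a, 'e) tvec \<Rightarrow> ('a, 'e) tvec \<Rightarrow> real"

definition local_metric ::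
    "('a, 'e::euclidean_space) chart set \<Rightarrow> ('a, 'e) metric \<Rightarrow> ('a, 'e) chart \<Rightarrow>
     'e \<Rightarrow> 'e \<Rightarrow> 'e \<Rightarrow> real" where
  "local_metric A g c x u v = (let p = inv_into (fst c) (snd c) x in
     g p (coord_vector A c p u) (coord_vector A c p v))"

definition riemannian_metric ::
    "('a, 'e::euclidean_space) chart set \<Rightarrow> ('a, 'e) metric \<Rightarrow> bool" where
  "riemannian_metric A g \<longleftrightarrow> (\<forall>c\<in>A.
     (\<forall>x\<in>snd c ` fst c. bilinear (local_metric A g c x) \<and>
        (\<forall>u v. local_metric A g c x u v = local_metric A g c x v u) \<and>
        (\<forall>u. u \<noteq> 0 \<longrightarrow> local_metric A g c x u u > 0)) \<and>
     (\<forall>u v. smooth_on (snd c ` fst c) (\<lambda>x. local_metric A g c x u v)))"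

text \<open>The Levi-Civita connection in the chart \<open>c\<close>, by the Koszul formula for the commuting
  constant coordinate fields \<open>u\<close>, \<open>v\<close>, \<open>w\<close>: this is the vector
  \<open>\<Gamma>\<^sup>k\<^sub>i\<^sub>j u\<^sup>i v\<^sup>j\<close>.\<close>

definition christoffel ::
    "('a, 'e::euclidean_space) chart set \<Rightarrow> ('a, 'e) metric \<Rightarrow> ('a, 'e) chart \<Rightarrow>
     'e \<Rightarrow> 'e \<Rightarrow> 'e \<Rightarrow> 'e" where
  "christoffel A g c x u v = (THE z. \<forall>w. local_metric A g c x z w =
     (frechet_derivative (\<lambda>y. local_metric A g c y v w) (at x) u
    + frechet_derivative (\<lambda>y. local_metric A g c y u w) (at x) v
    - frechet_derivative (\<lambda>y. local_metric A g c y u v) (at x) w) / 2)"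

definition geodesic ::
    "('a::topological_space, 'e::euclidean_space) chart set \<Rightarrow> ('a, 'e) metric \<Rightarrow>
     (real \<Rightarrow> 'a) \<Rightarrow> bool" where
  "geodesic A g \<sigma> \<longleftrightarrow> continuous_on UNIV \<sigma> \<and>
     (\<forall>c\<in>A. \<forall>s. \<sigma> s \<in> fst c \<longrightarrow>
        (snd c \<circ> \<sigma>) differentiable (at s) \<and>
        ((\<lambda>r. vector_derivative (snd c \<circ> \<sigma>) (at r)) has_vector_derivative
           - christoffel A g c (snd c (\<sigma> s))
               (vector_derivative (snd c \<circ> \<sigma>) (at s))
               (vector_derivative (snd c \<circ> \<sigma>) (at s))) (at s))"

text \<open>Completeness: the exponential map at every point is defined on the whole tangent space.\<close>

definition complete_metric ::
    "('a::topological_space, 'e::euclidean_space) chart set \<Rightarrow> ('a, 'e) metric \<Rightarrow> bool" where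
  "complete_metric A g \<longleftrightarrow> (\<forall>p. \<forall>X\<in>tangent_space A p.
     \<exists>\<sigma>. geodesic A g \<sigma> \<and> \<sigma> 0 = p \<and> velocity A \<sigma> 0 = X)"

definition geodesic_from ::
    "('a::topological_space, 'e::euclidean_space) chart set \<Rightarrow> ('a, 'e) metric \<Rightarrow>
     'a \<times> ('a, 'e) tvec \<Rightarrow> real \<Rightarrow> 'a" where
  "geodesic_from A g v = (THE \<sigma>. geodesic A g \<sigma> \<and> \<sigma> 0 = fst v \<and> velocity A \<sigma> 0 = snd v)"


section \<open>Path spaces\<close>

text \<open>Paths are functions on \<open>real\<close> of which only the values on \<open>{0..1}\<close> matter.\<close>

definition PM :: "('a::topological_space, 'e::euclidean_space) chart set \<Rightarrow> (real \<Rightarrow> 'a) set" where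
  "PM A = {\<gamma>. continuous_on {0..1} \<gamma> \<and>
     (\<forall>c\<in>A. smooth_curve_on {t\<in>{0..1}. \<gamma> t \<in> fst c} (snd c \<circ> \<gamma>))}"

text \<open>Pairs of a smooth path \<open>\<gamma>\<close> and a smooth vector field along \<open>\<gamma>\<close>, as paths
  \<open>t \<mapsto> (\<gamma> t, X t)\<close> in the tangent bundle.\<close>

definition TPM :: "('a::topological_space, 'e::euclidean_space) chart set \<Rightarrow>
    (real \<Rightarrow> 'a \<times> ('a, 'e) tvec) set" where
  "TPM A = {x. fst \<circ> x \<in> PM A \<and>
     (\<forall>t\<in>{0..1}. snd (x t) \<in> tangent_space A (fst (x t))) \<and>
     (\<forall>c\<in>A. smooth_curve_on {t\<in>{0..1}. fst (x t) \<in> fst c} (\<lambda>t. snd (x t) c))}"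

definition constant_near_ends :: "(real \<Rightarrow> 'b) \<Rightarrow> bool" where
  "constant_near_ends x \<longleftrightarrow> (\<exists>\<delta>>0. \<forall>t\<in>{0..1}.
     (t < \<delta> \<longrightarrow> x t = x 0) \<and> (1 - \<delta> < t \<longrightarrow> x t = x 1))"

definition PMc :: "('a::topological_space, 'e::euclidean_space) chart set \<Rightarrow> (real \<Rightarrow> 'a) set" where
  "PMc A = {\<gamma>\<in>PM A. constant_near_ends \<gamma>}"

definition TPMc :: "('a::topological_space, 'e::euclidean_space) chart set \<Rightarrow>
    (real \<Rightarrow> 'a \<times> ('a, 'e) tvec) set" where
  "TPMc A = {x\<in>TPM A. constant_near_ends x}"


section \<open>Back-track equivalence\<close>

definition reparametrization :: "(real \<Rightarrow> real) \<Rightarrow> bool" where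
  "reparametrization \<phi> \<longleftrightarrow>
     continuous_on {0..1} \<phi> \<and> strict_mono_on {0..1} \<phi> \<and> \<phi> 0 = 0 \<and> \<phi> 1 = 1"

definition reparam_equiv :: "(real \<Rightarrow> 'b) \<Rightarrow> (real \<Rightarrow> 'b) \<Rightarrow> bool" where
  "reparam_equiv x y \<longleftrightarrow> (\<exists>\<phi>. reparametrization \<phi> \<and> (\<forall>t\<in>{0..1}. y t = x (\<phi> t)))"

text \<open>The set \<open>P\<close> contains the smooth paths out of which \<open>x\<close> and \<open>y\<close> are
  composed. Since the reparametrizations are arbitrary, the breakpoints can be fixed.\<close>

definition elementary_bt ::
    "(real \<Rightarrow> 'b::topological_space) set \<Rightarrow> (real \<Rightarrow> 'b) \<Rightarrow> (real \<Rightarrow> 'b) \<Rightarrow> bool" where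
  "elementary_bt P x y \<longleftrightarrow> (\<exists>\<phi> \<psi>. \<exists>l\<^sub>1\<in>P. \<exists>l\<^sub>2\<in>P. \<exists>l\<^sub>3\<in>P.
     reparametrization \<phi> \<and> reparametrization \<psi> \<and>
     l\<^sub>3 1 = l\<^sub>2 0 \<and> l\<^sub>2 0 = l\<^sub>1 0 \<and>
     (\<forall>t\<in>{0..1}. x (\<phi> t) = ((l\<^sub>3 +++ l\<^sub>2) +++ (reversepath l\<^sub>2 +++ l\<^sub>1)) t) \<and>
     (\<forall>t\<in>{0..1}. y (\<psi> t) = (l\<^sub>3 +++ l\<^sub>1) t))"

text \<open>Back-track equivalence on the set \<open>Pc\<close> of paths, generated by reparametrization and by
  the insertion and deletion of back-tracks; all intermediate paths lie in \<open>Pc\<close>.\<close>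

definition bt_rel ::
    "(real \<Rightarrow> 'b::topological_space) set \<Rightarrow> (real \<Rightarrow> 'b) set \<Rightarrow> ((real \<Rightarrow> 'b) \<times> (real \<Rightarrow> 'b)) set" where
  "bt_rel P Pc = {(x, y). x \<in> Pc \<and> y \<in> Pc \<and>
     (x, y) \<in> {(x, y). x \<in> Pc \<and> y \<in> Pc \<and>
        (reparam_equiv x y \<or> reparam_equiv y x \<or> elementary_bt P x y \<or> elementary_bt P y x)}\<^sup>*}"

lemma equiv_bt_rel: "equiv Pc (bt_rel P Pc)"
proof -
  define R where "R = {(x, y). x \<in> Pc \<and> y \<in> Pc \<and>
        (reparam_equiv x y \<or> reparam_equiv y x \<or> elementary_bt P x y \<or> elementary_bt P y x)}"
  have "sym R" by (auto simp: R_def sym_def)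
  then have "sym (R\<^sup>*)" by (rule sym_rtrancl)
  then show ?thesis
    unfolding bt_rel_def R_def[symmetric]
    by (auto intro!: equivI refl_onI symI transI dest: symD rtrancl_trans)
qed

definition PMc_bt :: "('a::topological_space, 'e::euclidean_space) chart set \<Rightarrow>
    (real \<Rightarrow> 'a) set set" where
  "PMc_bt A = PMc A // bt_rel (PM A) (PMc A)"

text \<open>Pairs \<open>(\<gamma>, X)\<close> are identified as paths in the tangent bundle: a back-track of
  \<open>\<gamma>\<close> may be deleted only if \<open>X\<close> has the same back-track. A class of pairs determines a
  class of paths, see \<open>bt_rel_base\<close> below.

  The back-track condition is a condition on this identification only; it does not restrict which
  fields along a given path are admitted. Such a restriction would be preserved neither by
  composition (for \<open>\<gamma>\<^sub>2\<close> the reverse of \<open>\<gamma>\<^sub>1\<close>, the fields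
  along the two paths are independent) nor by geodesics of the path space (on the real line,
  \<open>(f, - f)\<close> is moved to \<open>(0, - f)\<close> in unit time).\<close>

definition bt_class :: "('a::topological_space, 'e::euclidean_space) chart set \<Rightarrow>
    (real \<Rightarrow> 'a \<times> ('a, 'e) tvec) \<Rightarrow> (real \<Rightarrow> 'a \<times> ('a, 'e) tvec) set" where
  "bt_class A x = bt_rel (TPM A) (TPMc A) `` {x}"

definition TPMc_bt :: "('a::topological_space, 'e::euclidean_space) chart set \<Rightarrow>
    (real \<Rightarrow> 'a \<times> ('a, 'e) tvec) set set" where
  "TPMc_bt A = TPMc A // bt_rel (TPM A) (TPMc A)"

lemma elementary_bt_base:
  assumes "elementary_bt (TPM A) x y"
  shows "elementary_bt (PM A) (fst \<circ> x) (fst \<circ> y)"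
proof -
  have j: "fst ((p +++ q) t) = ((fst \<circ> p) +++ (fst \<circ> q)) t"
    and r: "fst \<circ> reversepath p = reversepath (fst \<circ> p)"
    and jj: "fst \<circ> (p +++ q) = (fst \<circ> p) +++ (fst \<circ> q)"
    for p q :: "real \<Rightarrow> 'a \<times> ('a, 'b) tvec" and t
    by (auto simp: joinpaths_def reversepath_def fun_eq_iff)
  from assms obtain \<phi> \<psi> l1 l2 l3 where *: "l1 \<in> TPM A" "l2 \<in> TPM A" "l3 \<in> TPM A"
     "reparametrization \<phi>" "reparametrization \<psi>" "l3 1 = l2 0" "l2 0 = l1 0"
     "\<forall>t\<in>{0..1}. x (\<phi> t) = ((l3 +++ l2) +++ (reversepath l2 +++ l1)) t"
     "\<forall>t\<in>{0..1}. y (\<psi> t) = (l3 +++ l1) t"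
    unfolding elementary_bt_def by blast
  have "fst \<circ> l1 \<in> PM A" "fst \<circ> l2 \<in> PM A" "fst \<circ> l3 \<in> PM A"
    using *(1-3) by (auto simp: TPM_def)
  with *(4-) show ?thesis
    unfolding elementary_bt_def
    by (intro exI[of _ \<phi>] exI[of _ \<psi>] bexI[of _ "fst \<circ> l1"] bexI[of _ "fst \<circ> l2"]
        bexI[of _ "fst \<circ> l3"]) (auto simp: j jj r)
qed

lemma bt_rel_base:
  assumes "(x, y) \<in> bt_rel (TPM A) (TPMc A)"
  shows "(fst \<circ> x, fst \<circ> y) \<in> bt_rel (PM A) (PMc A)"
proof -
  have mem: "fst \<circ> z \<in> PMc A" if "z \<in> TPMc A" for z
  proof -
    from that obtain \<delta> where "\<delta> > 0" and \<delta>: "\<forall>t\<in>{0..1}.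
        (t < \<delta> \<longrightarrow> z t = z 0) \<and> (1 - \<delta> < t \<longrightarrow> z t = z 1)"
      unfolding TPMc_def constant_near_ends_def by blast
    have "(t < \<delta> \<longrightarrow> (fst \<circ> z) t = (fst \<circ> z) 0) \<and>
        (1 - \<delta> < t \<longrightarrow> (fst \<circ> z) t = (fst \<circ> z) 1)" if "t \<in> {0..1}" for t
      using bspec[OF \<delta> that] by simp
    then have "constant_near_ends (fst \<circ> z)"
      unfolding constant_near_ends_def using \<open>\<delta> > 0\<close> by blast
    with that show ?thesis
      by (simp add: TPMc_def PMc_def TPM_def)
  qed
  have rep: "reparam_equiv (fst \<circ> z) (fst \<circ> w)" if "reparam_equiv z w"
    for z w :: "real \<Rightarrow> 'a \<times> ('a, 'b) tvec"
    using that unfolding reparam_equiv_def o_def by metis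
  from assms have "x \<in> TPMc A" "y \<in> TPMc A" and
    st: "(x, y) \<in> {(x, y). x \<in> TPMc A \<and> y \<in> TPMc A \<and> (reparam_equiv x y \<or> reparam_equiv y x
        \<or> elementary_bt (TPM A) x y \<or> elementary_bt (TPM A) y x)}\<^sup>*"
    unfolding bt_rel_def by auto
  from st have "(fst \<circ> x, fst \<circ> y) \<in> {(x, y). x \<in> PMc A \<and> y \<in> PMc A \<and>
     (reparam_equiv x y \<or> reparam_equiv y x
        \<or> elementary_bt (PM A) x y \<or> elementary_bt (PM A) y x)}\<^sup>*"
  proof induction
    case (step y z)
    have "y \<in> TPMc A" "z \<in> TPMc A" and
      "reparam_equiv y z \<or> reparam_equiv z y \<or> elementary_bt (TPM A) y z
        \<or> elementary_bt (TPM A) z y"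
      using step.hyps(2) by auto
    then have "reparam_equiv (fst \<circ> y) (fst \<circ> z) \<or> reparam_equiv (fst \<circ> z) (fst \<circ> y)
        \<or> elementary_bt (PM A) (fst \<circ> y) (fst \<circ> z) \<or> elementary_bt (PM A) (fst \<circ> z) (fst \<circ> y)"
      using rep elementary_bt_base by blast
    with mem[OF \<open>y \<in> TPMc A\<close>] mem[OF \<open>z \<in> TPMc A\<close>] step.IH show ?case
      by (elim rtrancl_into_rtrancl) (simp add: o_def)
  qed auto
  with \<open>x \<in> TPMc A\<close> \<open>y \<in> TPMc A\<close> mem show ?thesis
    unfolding bt_rel_def by auto
qed

text \<open>The common value at \<open>0\<close> and at \<open>1\<close> of the representatives of a class.\<close>

definition class_start :: "(real \<Rightarrow> 'b) set \<Rightarrow> 'b" where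
  "class_start k = the_elem ((\<lambda>x. x 0) ` k)"

definition class_finish :: "(real \<Rightarrow> 'b) set \<Rightarrow> 'b" where
  "class_finish k = the_elem ((\<lambda>x. x 1) ` k)"

text \<open>The class of \<open>(\<gamma>\<^sub>2 \<circ> \<gamma>\<^sub>1, X\<^sub>2 \<circ> X\<^sub>1)\<close>.\<close>

definition class_comp :: "('a::topological_space, 'e::euclidean_space) chart set \<Rightarrow>
    (real \<Rightarrow> 'a \<times> ('a, 'e) tvec) set \<Rightarrow> (real \<Rightarrow> 'a \<times> ('a, 'e) tvec) set \<Rightarrow>
    (real \<Rightarrow> 'a \<times> ('a, 'e) tvec) set" where
  "class_comp A k\<^sub>2 k\<^sub>1 = (\<Union>x\<^sub>1\<in>k\<^sub>1. \<Union>x\<^sub>2\<in>k\<^sub>2. bt_class A (x\<^sub>1 +++ x\<^sub>2))"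


section \<open>Categories and double categories\<close>

record ('o, 'm) cat =
  Obj :: "'o set"
  Arr :: "'m set"
  Src :: "'m \<Rightarrow> 'o"
  Tgt :: "'m \<Rightarrow> 'o"
  Idn :: "'o \<Rightarrow> 'm"
  Cmp :: "'m \<Rightarrow> 'm \<Rightarrow> 'm"

definition composable :: "('o, 'm) cat \<Rightarrow> 'm \<Rightarrow> 'm \<Rightarrow> bool" where
  "composable C G F \<longleftrightarrow> G \<in> Arr C \<and> F \<in> Arr C \<and> Src C G = Tgt C F"

definition category :: "('o, 'm) cat \<Rightarrow> bool" where
  "category C \<longleftrightarrow>
     (\<forall>F\<in>Arr C. Src C F \<in> Obj C \<and> Tgt C F \<in> Obj C) \<and>
     (\<forall>X\<in>Obj C. Idn C X \<in> Arr C \<and> Src C (Idn C X) = X \<and> Tgt C (Idn C X) = X) \<and>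
     (\<forall>G F. composable C G F \<longrightarrow> Cmp C G F \<in> Arr C \<and>
        Src C (Cmp C G F) = Src C F \<and> Tgt C (Cmp C G F) = Tgt C G) \<and>
     (\<forall>F\<in>Arr C. Cmp C F (Idn C (Src C F)) = F \<and> Cmp C (Idn C (Tgt C F)) F = F) \<and>
     (\<forall>H G F. composable C H G \<longrightarrow> composable C G F \<longrightarrow>
        Cmp C H (Cmp C G F) = Cmp C (Cmp C H G) F)"

text \<open>The partial operation is \<open>hc\<close>, defined for the pairs satisfying \<open>hdef\<close>. In the
  exchange law, the four inner composites are presupposed, and the law says that if one of the two
  outer composites is defined then so is the other and they are equal. Without this
  presupposition, definedness of one side does not imply that the other side makes sense: the
  composites \<open>G' \<circ> G\<close> and \<open>F' \<circ> F\<close> can be horizontally composable although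
  \<open>G\<close> and \<open>F\<close> are not.\<close>

definition double_category ::
    "('o, 'm) cat \<Rightarrow> ('m, 'n) cat \<Rightarrow> ('n \<Rightarrow> 'n \<Rightarrow> bool) \<Rightarrow> ('n \<Rightarrow> 'n \<Rightarrow> 'n) \<Rightarrow> bool" where
  "double_category C D hdef hc \<longleftrightarrow>
     category C \<and> category D \<and> Obj D = Arr C \<and>
     (\<forall>G F. hdef G F \<longrightarrow> G \<in> Arr D \<and> F \<in> Arr D \<and> hc G F \<in> Arr D \<and>
        composable C (Src D G) (Src D F) \<and> Src D (hc G F) = Cmp C (Src D G) (Src D F) \<and>
        composable C (Tgt D G) (Tgt D F) \<and> Tgt D (hc G F) = Cmp C (Tgt D G) (Tgt D F)) \<and>
     (\<forall>G' G F' F. composable D G' G \<and> composable D F' F \<and> hdef G' F' \<and> hdef G F \<and>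
        (hdef (Cmp D G' G) (Cmp D F' F) \<or> composable D (hc G' F') (hc G F)) \<longrightarrow>
        hdef (Cmp D G' G) (Cmp D F' F) \<and> composable D (hc G' F') (hc G F) \<and>
        hc (Cmp D G' G) (Cmp D F' F) = Cmp D (hc G' F') (hc G F))"


section \<open>The categories of paths and of path space geodesics\<close>

definition Cgeod :: "('a::topological_space, 'e::euclidean_space) chart set \<Rightarrow>
    ('a \<times> ('a, 'e) tvec \<times> real, (real \<Rightarrow> 'a \<times> ('a, 'e) tvec) set \<times> real) cat" where
  "Cgeod A = \<lparr>
     Obj = {(p, X, a). X \<in> tangent_space A p},
     Arr = TPMc_bt A \<times> UNIV,
     Src = (\<lambda>(k, a). (fst (class_start k), snd (class_start k), a)),
     Tgt = (\<lambda>(k, a). (fst (class_finish k), snd (class_finish k), a)),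
     Idn = (\<lambda>(p, X, a). (bt_class A (\<lambda>_. (p, X)), a)),
     Cmp = (\<lambda>(k\<^sub>2, a\<^sub>2) (k\<^sub>1, a\<^sub>1). (class_comp A k\<^sub>2 k\<^sub>1, a\<^sub>1))\<rparr>"

text \<open>For \<open>x = (\<gamma>, X)\<close>, the path space geodesic with initial conditions \<open>(\<gamma>, X)\<close>
  at the parameter \<open>s\<close>, together with its derivative in \<open>s\<close>.\<close>

definition path_geodesic ::
    "('a::topological_space, 'e::euclidean_space) chart set \<Rightarrow> ('a, 'e) metric \<Rightarrow>
     (real \<Rightarrow> 'a \<times> ('a, 'e) tvec) \<Rightarrow> real \<Rightarrow> real \<Rightarrow> 'a \<times> ('a, 'e) tvec" where
  "path_geodesic A g x s =
     (\<lambda>t. (geodesic_from A g (x t) s, velocity A (geodesic_from A g (x t)) s))"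

definition class_geodesic ::
    "('a::topological_space, 'e::euclidean_space) chart set \<Rightarrow> ('a, 'e) metric \<Rightarrow>
     (real \<Rightarrow> 'a \<times> ('a, 'e) tvec) set \<Rightarrow> real \<Rightarrow> (real \<Rightarrow> 'a \<times> ('a, 'e) tvec) set" where
  "class_geodesic A g k s = (\<Union>x\<in>k. bt_class A (path_geodesic A g x s))"

text \<open>A segment \<open>(a, b, f)\<close> consists of its interval and of the restriction of the path space
  geodesic to it. The values of \<open>f\<close> include the velocity, which is needed to define source and
  target when \<open>a = b\<close>.\<close>

type_synonym ('a, 'e) segment = "real \<times> real \<times> (real \<Rightarrow> (real \<Rightarrow> 'a \<times> ('a, 'e) tvec) set)"

definition segment ::
    "('a::topological_space, 'e::euclidean_space) chart set \<Rightarrow> ('a, 'e) metric \<Rightarrow>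
     real \<Rightarrow> real \<Rightarrow> (real \<Rightarrow> 'a \<times> ('a, 'e) tvec) set \<Rightarrow> ('a, 'e) segment" where
  "segment A g a b k = (a, b, restrict (class_geodesic A g k) {a..b})"

text \<open>The initial conditions at the parameter \<open>0\<close>, which need not lie in the interval of the
  segment.\<close>

definition initial ::
    "('a::topological_space, 'e::euclidean_space) chart set \<Rightarrow> ('a, 'e) metric \<Rightarrow>
     ('a, 'e) segment \<Rightarrow> (real \<Rightarrow> 'a \<times> ('a, 'e) tvec) set" where
  "initial A g F = (THE k. k \<in> TPMc_bt A \<and> F = segment A g (fst F) (fst (snd F)) k)"

definition Cgeod2 ::
    "('a::topological_space, 'e::euclidean_space) chart set \<Rightarrow> ('a, 'e) metric \<Rightarrow>
     ((real \<Rightarrow> 'a \<times> ('a, 'e) tvec) set \<times> real, ('a, 'e) segment) cat" where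
  "Cgeod2 A g = \<lparr>
     Obj = TPMc_bt A \<times> UNIV,
     Arr = {segment A g a b k | a b k. k \<in> TPMc_bt A \<and> a \<le> b},
     Src = (\<lambda>(a, b, f). (f a, a)),
     Tgt = (\<lambda>(a, b, f). (f b, b)),
     Idn = (\<lambda>(k, a). (a, a, restrict (\<lambda>_. k) {a..a})),
     Cmp = (\<lambda>G F. segment A g (fst F) (fst (snd G)) (initial A g F))\<rparr>"

definition hdefined ::
    "('a::topological_space, 'e::euclidean_space) chart set \<Rightarrow> ('a, 'e) metric \<Rightarrow>
     ('a, 'e) segment \<Rightarrow> ('a, 'e) segment \<Rightarrow> bool" where
  "hdefined A g G F \<longleftrightarrow> G \<in> Arr (Cgeod2 A g) \<and> F \<in> Arr (Cgeod2 A g) \<and>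
     fst G = fst F \<and> fst (snd G) = fst (snd F) \<and>
     class_finish (initial A g F) = class_start (initial A g G)"

definition hcomp ::
    "('a::topological_space, 'e::euclidean_space) chart set \<Rightarrow> ('a, 'e) metric \<Rightarrow>
     ('a, 'e) segment \<Rightarrow> ('a, 'e) segment \<Rightarrow> ('a, 'e) segment" where
  "hcomp A g G F =
     segment A g (fst F) (fst (snd F)) (class_comp A (initial A g G) (initial A g F))"

end

theory Submission
  imports Defs
begin

text \<open>
  The path space geodesic with initial conditions \<open>x\<close> is \<open>s \<mapsto> \<Phi>\<^sub>s \<circ> x\<close>, where \<open>\<Phi>\<close> is the geodesic flow
  on the tangent bundle. The flow acts pointwise on paths in the tangent bundle, so it commutes with
  reparametrization, with concatenation and with the insertion of back-tracks, and hence descends to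
  back-track classes; since \<open>\<Phi>\<close> is an action of \<open>\<real>\<close>, a segment determines its initial conditions, and
  all the axioms follow from those of the concatenation of classes.

  The analytic part is that \<open>\<Phi>\<^sub>s \<circ> x\<close> is smooth for a smooth path \<open>x\<close>. In a chart and for short time, the
  solutions with initial values \<open>x t\<close> are the fixed points, in the Banach space of bounded continuous
  functions, of a contraction depending smoothly on \<open>t\<close>. A connectedness argument in \<open>s\<close> then
  covers all times, existence of the solutions being given by completeness.
\<close>


section \<open>Iterated differentiability\<close>

text \<open>The parameter of a path runs over subsets of \<open>{0..1}\<close> with end points,
  while the contraction lives on a function space; one notion of differentiability has to serve
  both. Hence derivatives are taken within a set, and higher ones direction by direction, as maps
  \<open>\<lambda>x. f' x v\<close> with the same range as \<open>f\<close>, so that no tower of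
  operator spaces arises. As the solution curves are given in advance, the implicit function theorem
  shrinks to one statement: a given map is differentiable if its composite with an expanding map,
  whose derivative is invertible, is differentiable. The derivative then solves a linear equation
  whose coefficient depends only on the map itself, and each round gains one order.

  On the side of paths, the obstacle is that the smooth pieces of an elementary back-track need not
  be constant near their ends, so that attaching another path to one of them could create a corner.
  Moreover, strictly increasing reparametrizations cannot collapse an interval, so the unit laws
  rest on the constancy of paths near their ends.\<close>

text \<open>Order \<open>0\<close> imposes nothing, not even continuity. Derivatives are taken within \<open>T\<close>, so \<open>f'\<close> is not
  unique if \<open>T\<close> has isolated points.\<close>

fun ndiff :: "nat \<Rightarrow> 'a::real_normed_vector set \<Rightarrow> ('a \<Rightarrow> 'b::real_normed_vector) \<Rightarrow> bool" where
  "ndiff 0 T f \<longleftrightarrow> True"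
| "ndiff (Suc k) T f \<longleftrightarrow> (\<exists>f'. (\<forall>x\<in>T. (f has_derivative f' x) (at x within T)) \<and>
     (\<forall>v. ndiff k T (\<lambda>x. f' x v)))"

abbreviation smooth_within :: "'a::real_normed_vector set \<Rightarrow> ('a \<Rightarrow> 'b::real_normed_vector) \<Rightarrow> bool" where
  "smooth_within T f \<equiv> \<forall>k. ndiff k T f"

lemma ndiff_cong:
  assumes "\<And>x. x \<in> T \<Longrightarrow> f x = h x" "ndiff k T f"
  shows "ndiff k T h"
proof (cases k)
  case (Suc n)
  with assms(2) obtain f' where f': "\<forall>x\<in>T. (f has_derivative f' x) (at x within T)"
    "\<forall>v. ndiff n T (\<lambda>x. f' x v)" by auto
  have "\<forall>x\<in>T. (h has_derivative f' x) (at x within T)"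
    using f'(1) assms(1) by (metis has_derivative_transform)
  with f'(2) Suc show ?thesis by auto
qed simp

lemma ndiff_subset: "ndiff k T f \<Longrightarrow> S \<subseteq> T \<Longrightarrow> ndiff k S f"
proof (induction k arbitrary: f)
  case (Suc k)
  then obtain f' where f': "\<forall>x\<in>T. (f has_derivative f' x) (at x within T)"
    "\<forall>v. ndiff k T (\<lambda>x. f' x v)" by auto
  have "\<forall>x\<in>S. (f has_derivative f' x) (at x within S)"
    using f'(1) Suc.prems(2) by (meson has_derivative_subset subsetD)
  with f'(2) Suc.IH Suc.prems(2) show ?case by auto
qed simp

lemma ndiff_Suc_imp: "ndiff (Suc k) T f \<Longrightarrow> ndiff k T f"
proof (induction k arbitrary: f)
  case (Suc k)
  then obtain f' where f': "\<forall>x\<in>T. (f has_derivative f' x) (at x within T)"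
    "\<forall>v. ndiff (Suc k) T (\<lambda>x. f' x v)" by (metis ndiff.simps(2))
  with Suc.IH have "\<forall>v. ndiff k T (\<lambda>x. f' x v)" by blast
  with f'(1) show ?case by auto
qed simp

lemma ndiff_imp_continuous_on: "ndiff (Suc k) T f \<Longrightarrow> continuous_on T f"
  unfolding continuous_on_eq_continuous_within by (auto intro: has_derivative_continuous)

lemma ndiff_const [simp]: "ndiff k T (\<lambda>_. c)"
proof (induction k arbitrary: c)
  case (Suc k)
  show ?case unfolding ndiff.simps by (intro exI[of _ "\<lambda>_ _. 0"] conjI allI Suc.IH) simp
qed simp

lemma ndiff_linear:
  assumes "bounded_linear f" shows "ndiff k T f"
proof (cases k)
  case (Suc n)
  then show ?thesis
    using bounded_linear_imp_has_derivative[OF assms] by (auto intro!: exI[of _ "\<lambda>_. f"])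
qed simp

lemma ndiff_linear_compose:
  assumes "bounded_linear h" "ndiff k T f"
  shows "ndiff k T (\<lambda>x. h (f x))"
  using assms(2)
proof (induction k arbitrary: f)
  case (Suc k)
  then obtain f' where f': "\<forall>x\<in>T. (f has_derivative f' x) (at x within T)"
    "\<forall>v. ndiff k T (\<lambda>x. f' x v)" by auto
  have "\<forall>x\<in>T. ((\<lambda>x. h (f x)) has_derivative (\<lambda>v. h (f' x v))) (at x within T)"
    using f'(1) bounded_linear.has_derivative[OF assms(1)] by blast
  moreover have "\<forall>v. ndiff k T (\<lambda>x. h (f' x v))"
    using Suc.IH f'(2) by blast
  ultimately show ?case unfolding ndiff.simps by (intro exI[of _ "\<lambda>x v. h (f' x v)"] conjI)
qed simp

lemma ndiff_add:
  assumes "ndiff k T f" "ndiff k T h"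
  shows "ndiff k T (\<lambda>x. f x + h x)"
  using assms
proof (induction k arbitrary: f h)
  case (Suc k)
  obtain f' where f': "\<forall>x\<in>T. (f has_derivative f' x) (at x within T)"
    "\<forall>v. ndiff k T (\<lambda>x. f' x v)" using Suc.prems(1) by auto
  obtain h' where h': "\<forall>x\<in>T. (h has_derivative h' x) (at x within T)"
    "\<forall>v. ndiff k T (\<lambda>x. h' x v)" using Suc.prems(2) by auto
  have "\<forall>x\<in>T. ((\<lambda>x. f x + h x) has_derivative (\<lambda>v. f' x v + h' x v)) (at x within T)"
    using f'(1) h'(1) has_derivative_add by blast
  moreover have "\<forall>v. ndiff k T (\<lambda>x. f' x v + h' x v)"
    using Suc.IH f'(2) h'(2) by blast
  ultimately show ?case unfolding ndiff.simps by (intro exI[of _ "\<lambda>x v. f' x v + h' x v"] conjI)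
qed simp

lemma ndiff_minus: "ndiff k T f \<Longrightarrow> ndiff k T (\<lambda>x. - f x)"
  by (rule ndiff_linear_compose[OF bounded_linear_minus[OF bounded_linear_ident]])

lemma ndiff_diff: "ndiff k T f \<Longrightarrow> ndiff k T h \<Longrightarrow> ndiff k T (\<lambda>x. f x - h x)"
  using ndiff_add[OF _ ndiff_minus] by simp

lemma ndiff_sum:
  assumes "\<And>i. i \<in> I \<Longrightarrow> ndiff k T (f i)"
  shows "ndiff k T (\<lambda>x. \<Sum>i\<in>I. f i x)"
proof (cases "finite I")
  case True
  from this assms show ?thesis by (induction) (auto intro: ndiff_add)
qed simp

lemma ndiff_bilinear:
  assumes "bounded_bilinear B" "ndiff k T f" "ndiff k T h"
  shows "ndiff k T (\<lambda>x. B (f x) (h x))"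
  using assms(2,3)
proof (induction k arbitrary: f h)
  case (Suc k)
  obtain f' where f': "\<forall>x\<in>T. (f has_derivative f' x) (at x within T)"
    "\<forall>v. ndiff k T (\<lambda>x. f' x v)" using Suc.prems(1) by auto
  obtain h' where h': "\<forall>x\<in>T. (h has_derivative h' x) (at x within T)"
    "\<forall>v. ndiff k T (\<lambda>x. h' x v)" using Suc.prems(2) by auto
  have "\<forall>x\<in>T. ((\<lambda>x. B (f x) (h x)) has_derivative (\<lambda>v. B (f x) (h' x v) + B (f' x v) (h x))) (at x within T)"
    using f'(1) h'(1) bounded_bilinear.FDERIV[OF assms(1)] by blast
  moreover have "\<forall>v. ndiff k T (\<lambda>x. B (f x) (h' x v) + B (f' x v) (h x))"
    using Suc.IH f'(2) h'(2) ndiff_Suc_imp[OF Suc.prems(1)] ndiff_Suc_imp[OF Suc.prems(2)]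
    by (intro allI ndiff_add) blast+
  ultimately show ?case unfolding ndiff.simps by (intro exI[of _ "\<lambda>x v. B (f x) (h' x v) + B (f' x v) (h x)"] conjI)
qed simp

lemmas ndiff_scaleR = ndiff_bilinear[OF bounded_bilinear_scaleR]

lemma ndiff_inner_left: "ndiff k T f \<Longrightarrow> ndiff k T (\<lambda>x. f x \<bullet> b)"
  by (rule ndiff_linear_compose[OF bounded_linear_inner_left])

lemma ndiff_Pair:
  assumes "ndiff k T f" "ndiff k T h"
  shows "ndiff k T (\<lambda>x. (f x, h x))"
proof -
  have "ndiff k T (\<lambda>x. (f x, 0) + (0, h x))"
    by (intro ndiff_add ndiff_linear_compose[of "\<lambda>u. (u, 0)"] ndiff_linear_compose[of "\<lambda>u. (0, u)"]
        bounded_linear_Pair bounded_linear_ident bounded_linear_zero assms)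
  then show ?thesis by simp
qed

lemma linear_eq_sum_Basis:
  fixes f :: "'a::euclidean_space \<Rightarrow> 'b::real_vector"
  assumes "linear f" shows "f v = (\<Sum>b\<in>Basis. (v \<bullet> b) *\<^sub>R f b)"
  by (subst euclidean_representation[of v, symmetric])
    (simp only: linear_sum[OF assms] linear_cmul[OF assms])

lemma ndiff_compose:
  fixes f :: "'a::real_normed_vector \<Rightarrow> 'e::euclidean_space"
  assumes "ndiff k T f" "ndiff k S h" "\<And>x. x \<in> T \<Longrightarrow> f x \<in> S"
  shows "ndiff k T (\<lambda>x. h (f x))"
  using assms
proof (induction k arbitrary: f h)
  case (Suc k)
  obtain f' where f': "\<forall>x\<in>T. (f has_derivative f' x) (at x within T)"
    "\<forall>v. ndiff k T (\<lambda>x. f' x v)" using Suc.prems(1) by auto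
  obtain h' where h': "\<forall>x\<in>S. (h has_derivative h' x) (at x within S)"
    "\<forall>v. ndiff k S (\<lambda>x. h' x v)" using Suc.prems(2) by auto
  have d: "((\<lambda>x. h (f x)) has_derivative (\<lambda>v. h' (f x) (f' x v))) (at x within T)" if "x \<in> T" for x
  proof -
    have "(h has_derivative h' (f x)) (at (f x) within f ` T)"
      using h'(1) Suc.prems(3) that by (meson has_derivative_subset image_subsetI)
    then show ?thesis using f'(1) that has_derivative_in_compose by blast
  qed
  have "ndiff k T (\<lambda>x. \<Sum>b\<in>Basis. (f' x v \<bullet> b) *\<^sub>R h' (f x) b)" for v
    using f'(2) h'(2) Suc.prems(3)
    by (intro ndiff_sum ndiff_scaleR ndiff_inner_left)
      (auto intro!: Suc.IH ndiff_Suc_imp[OF Suc.prems(1)])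
  moreover have "h' (f x) (f' x v) = (\<Sum>b\<in>Basis. (f' x v \<bullet> b) *\<^sub>R h' (f x) b)" if "x \<in> T" for x v
    using h'(1) Suc.prems(3)[OF that] by (intro linear_eq_sum_Basis has_derivative_linear) blast
  ultimately have "ndiff k T (\<lambda>x. h' (f x) (f' x v))" for v
    using ndiff_cong by (metis (no_types, lifting))
  with d show ?case unfolding ndiff.simps by (intro exI[of _ "\<lambda>x v. h' (f x) (f' x v)"]) blast
qed simp

lemma smooth_on_derivative:
  fixes f :: "'a::euclidean_space \<Rightarrow> 'b::real_normed_vector"
  assumes "smooth_on S f"
  shows "x \<in> S \<Longrightarrow> (f has_derivative frechet_derivative f (at x)) (at x)"
    and "smooth_on S (\<lambda>x. frechet_derivative f (at x) v)"
proof -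
  from assms have k: "Ck_on (Suc k) S f" for k unfolding smooth_on_def by blast
  show "x \<in> S \<Longrightarrow> (f has_derivative frechet_derivative f (at x)) (at x)"
    using k[of 0] by (simp add: frechet_derivative_works)
  show "smooth_on S (\<lambda>x. frechet_derivative f (at x) v)"
    using k by (simp add: smooth_on_def)
qed

lemma smooth_on_imp_smooth_within:
  fixes f :: "'a::euclidean_space \<Rightarrow> 'b::real_normed_vector"
  assumes "smooth_on S f"
  shows "ndiff k S f"
  using assms
proof (induction k arbitrary: f)
  case (Suc k)
  show ?case
    unfolding ndiff.simps
  proof (intro exI[of _ "\<lambda>x. frechet_derivative f (at x)"] conjI ballI allI)
    show "(f has_derivative frechet_derivative f (at x)) (at x within S)" if "x \<in> S" for x
      using smooth_on_derivative(1)[OF Suc.prems that] by (rule has_derivative_at_withinI)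
    show "ndiff k S (\<lambda>x. frechet_derivative f (at x) v)" for v
      by (rule Suc.IH[OF smooth_on_derivative(2)[OF Suc.prems]])
  qed
qed simp

section \<open>Linear equations depending on a parameter\<close>

lemma linear_homeomorphic_inverse:
  fixes L :: "'y::real_normed_vector \<Rightarrow> 'z::real_normed_vector"
  assumes "bounded_linear L" "surj L" "\<And>u. norm u \<le> C * norm (L u)"
  obtains M where "bounded_linear M" "\<And>u. M (L u) = u" "\<And>u. L (M u) = u"
    "\<And>v. norm (M v) \<le> C * norm v"
proof
  interpret L: bounded_linear L by fact
  \<comment> \<open>The a priori bound yields injectivity here and, below, the norm of the
    inverse.\<close>
  have inj: "inj L"
  proof (rule injI)
    fix u v assume "L u = L v"
    then have "norm (u - v) \<le> C * norm (0::'z)"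
      using assms(3)[of "u - v"] by (simp add: L.diff)
    then show "u = v" by simp
  qed
  show L: "L (inv L v) = v" for v using assms(2) by (simp add: surj_f_inv_f)
  show R: "inv L (L u) = u" for u using inj by simp
  show n: "norm (inv L v) \<le> C * norm v" for v using assms(3)[of "inv L v"] L by simp
  show "bounded_linear (inv L)"
  proof (rule bounded_linear_intro[of _ C])
    show "inv L (x + y) = inv L x + inv L y" for x y by (metis L R L.add)
    show "inv L (r *\<^sub>R x) = r *\<^sub>R inv L x" for r x by (metis L R L.scaleR)
    show "norm (inv L x) \<le> norm x * C" for x using n[of x] by (simp add: mult.commute)
  qed
qed

text \<open>Formally \<open>w' = M (r' - G' w)\<close>, by differentiating the equation. The inverse
  is used at \<open>p\<close> only: rewriting the equation at \<open>q\<close> with \<open>M\<close>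
  gives local boundedness of \<open>w\<close>, from it continuity at \<open>p\<close>, and from this
  the derivative.\<close>

lemma has_derivative_solve:
  fixes G :: "'a::real_normed_vector \<Rightarrow> ('y::real_normed_vector \<Rightarrow>\<^sub>L 'z::real_normed_vector)"
  assumes G: "(G has_derivative G') (at p within T)" and r: "(r has_derivative r') (at p within T)"
    and sol: "\<And>q. q \<in> T \<Longrightarrow> G q (w q) = r q" and p: "p \<in> T"
    and M: "bounded_linear M" "\<And>u. M (G p u) = u" "\<And>u. G p (M u) = u"
  shows "(w has_derivative (\<lambda>h. M (r' h - G' h (w p)))) (at p within T)"
proof -
  let ?F = "at p within T"
  interpret M: bounded_linear M by fact
  obtain C where C: "C > 0" "\<And>v. norm (M v) \<le> norm v * C" using M.pos_bounded by blast
  have eq: "w q = M (r q) - M ((G q - G p) (w q))" if "q \<in> T" for q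
    using sol[OF that] M(2)[of "w q"] by (simp add: M.diff blinfun.diff_left)
  have Gc: "(G \<longlongrightarrow> G p) ?F" and rc: "(r \<longlongrightarrow> r p) ?F"
    using has_derivative_continuous[OF G] has_derivative_continuous[OF r] by (auto simp: continuous_within)
  \<comment> \<open>Within this radius the term \<open>M ((G q - G p) (w q))\<close> has at most
    half the norm of \<open>w q\<close> and can be absorbed on the left.\<close>
  have "eventually (\<lambda>q. dist (G q) (G p) < 1 / (2 * C)) ?F"
    using Gc C(1) by (intro tendstoD) auto
  moreover have "eventually (\<lambda>q. q \<in> T) ?F"
    by (simp add: eventually_at_filter)
  ultimately have bd: "eventually (\<lambda>q. norm (w q) \<le> 2 * norm (M (r q))) ?F"
  proof eventually_elim
    case (elim q)
    have "norm (M ((G q - G p) (w q))) \<le> norm ((G q - G p) (w q)) * C" by (rule C)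
    also have "\<dots> \<le> (norm (G q - G p) * norm (w q)) * C"
      using C(1) norm_blinfun by (intro mult_right_mono) auto
    also have "\<dots> \<le> (1 / (2 * C) * norm (w q)) * C"
      using elim C(1) by (intro mult_right_mono) (auto simp: dist_norm)
    also have "\<dots> = norm (w q) / 2" using C(1) by simp
    finally have "norm (w q) \<le> norm (M (r q)) + norm (w q) / 2"
      using eq[OF elim(2)] norm_triangle_ineq4[of "M (r q)" "M ((G q - G p) (w q))"] by simp
    then show ?case by simp
  qed
  have "((\<lambda>q. norm (G q - G p) * (2 * norm (M (r q)))) \<longlongrightarrow> norm (G p - G p) * (2 * norm (M (r p)))) ?F"
    by (intro tendsto_intros Gc M.tendsto rc)
  then have lim: "((\<lambda>q. norm (G q - G p) * (2 * norm (M (r q)))) \<longlongrightarrow> 0) ?F" by simp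
  have "((\<lambda>q. (G q - G p) (w q)) \<longlongrightarrow> 0) ?F"
    by (rule Lim_null_comparison[OF eventually_mono[OF bd] lim])
      (rule order_trans[OF norm_blinfun mult_left_mono[OF _ norm_ge_zero]])
  from M.tendsto[OF this] have "((\<lambda>q. M ((G q - G p) (w q))) \<longlongrightarrow> 0) ?F"
    by (simp add: M.zero)
  then have "((\<lambda>q. M (r q) - M ((G q - G p) (w q))) \<longlongrightarrow> M (r p) - 0) ?F"
    by (intro tendsto_intros M.tendsto rc)
  then have wc: "(w \<longlongrightarrow> w p) ?F"
    using sol[OF p] M(2)[of "w p"] by (auto simp: eq[symmetric] eventually_at_filter elim!: Lim_transform_eventually)
  have aux: "a - (f - h) = (b - c - f) - ((d - e) - i) - (i - h)" if "a = b - c - (d - e)"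
    for a b c d e f h i :: 'y
    using that by simp
  \<comment> \<open>The remainder of \<open>w\<close> splits into the remainder of \<open>r\<close>,
    the remainder of \<open>G\<close> applied to \<open>w q\<close>, and \<open>G'\<close> applied
    to \<open>w q - w p\<close>; the last is small because \<open>w\<close> is already known to be
    continuous at \<open>p\<close>.\<close>
  have ident: "(w q - w p - M (r' (q - p) - G' (q - p) (w p))) /\<^sub>R norm (q - p) =
       M ((r q - r p - r' (q - p)) /\<^sub>R norm (q - p)) - M (((G q - G p - G' (q - p)) /\<^sub>R norm (q - p)) (w q))
       - M (blinfun_apply (G' (q - p) /\<^sub>R norm (q - p)) (w q - w p))" if "q \<in> T" for q
  proof -
    have "w q - w p = M (r q - r p) - M ((G q - G p) (w q))"
      using eq[OF that] sol[OF p] M(2)[of "w p"] by (simp add: M.diff)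
    then have "w q - w p - M (r' (q - p) - G' (q - p) (w p)) =
      M (r q - r p - r' (q - p)) - M ((G q - G p - G' (q - p)) (w q)) - M (G' (q - p) (w q - w p))"
      unfolding M.diff blinfun.diff_left blinfun.diff_right by (rule aux)
    then show ?thesis by (simp only: M.scaleR blinfun.scaleR_left scaleR_diff_right[symmetric])
  qed
  interpret G': bounded_linear G' using G by (rule has_derivative_bounded_linear)
  interpret r': bounded_linear r' using r by (rule has_derivative_bounded_linear)
  obtain K where K: "\<And>v. norm (G' v) \<le> norm v * K" "K > 0" using G'.pos_bounded by blast
  have "((\<lambda>q. blinfun_apply (G' (q - p) /\<^sub>R norm (q - p)) (w q - w p)) \<longlongrightarrow> 0) ?F"
  proof (rule tendsto_0_le[OF LIM_zero[OF wc] always_eventually], rule)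
    fix q
    have "norm (G' (q - p) /\<^sub>R norm (q - p)) \<le> K"
      using K(1)[of "q - p"] K(2) by (cases "q = p") (auto simp: divide_simps mult.commute)
    from order_trans[OF norm_blinfun mult_right_mono[OF this norm_ge_zero]]
    show "norm ((G' (q - p) /\<^sub>R norm (q - p)) (w q - w p)) \<le> norm (w q - w p) * K"
      by (simp only: mult.commute[of K])
  qed
  from M.tendsto[OF this]
  have "((\<lambda>q. M (blinfun_apply (G' (q - p) /\<^sub>R norm (q - p)) (w q - w p))) \<longlongrightarrow> 0) ?F"
    by (simp add: M.zero)
  moreover have "((\<lambda>q. M ((r q - r p - r' (q - p)) /\<^sub>R norm (q - p))) \<longlongrightarrow> M 0) ?F"
    using r by (intro M.tendsto) (simp add: has_derivative_at_within)
  moreover have "((\<lambda>q. M (((G q - G p - G' (q - p)) /\<^sub>R norm (q - p)) (w q))) \<longlongrightarrow> M ((0::'y \<Rightarrow>\<^sub>L 'z) (w p))) ?F"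
    using G wc by (intro M.tendsto bounded_bilinear.tendsto[OF bounded_bilinear_blinfun_apply]) (simp_all add: has_derivative_at_within)
  ultimately have "((\<lambda>q. M ((r q - r p - r' (q - p)) /\<^sub>R norm (q - p)) - M (((G q - G p - G' (q - p)) /\<^sub>R norm (q - p)) (w q))
       - M (blinfun_apply (G' (q - p) /\<^sub>R norm (q - p)) (w q - w p))) \<longlongrightarrow> M 0 - M ((0::'y \<Rightarrow>\<^sub>L 'z) (w p)) - 0) ?F"
    by (intro tendsto_intros)
  then have "((\<lambda>q. (w q - w p - M (r' (q - p) - G' (q - p) (w p))) /\<^sub>R norm (q - p)) \<longlongrightarrow> 0) ?F"
    by (auto simp: ident M.zero eventually_at_filter elim!: Lim_transform_eventually)
  moreover have "bounded_linear (\<lambda>h. M (r' h - G' h (w p)))"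
    by (intro bounded_linear_compose[OF M(1)] bounded_linear_sub r'.bounded_linear_axioms
       bounded_linear_compose[OF blinfun.bounded_linear_left] G'.bounded_linear_axioms)
  ultimately show ?thesis by (simp add: has_derivative_at_within)
qed

text \<open>The derivative of \<open>w\<close> in direction \<open>h\<close> solves the same
  equation with right side \<open>r' x h - G' x h (w x)\<close>. This contains \<open>w\<close>
  undifferentiated, hence has order \<open>k\<close> by the induction hypothesis, which is then
  applied again to the differentiated equation. No formula for the derivative of an inverse operator
  enters.\<close>

lemma ndiff_solve:
  fixes G :: "'a::real_normed_vector \<Rightarrow> ('y::real_normed_vector \<Rightarrow>\<^sub>L 'z::real_normed_vector)"
  assumes "ndiff k T G" "ndiff k T r"
    and sol: "\<And>q. q \<in> T \<Longrightarrow> G q (w q) = r q"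
    and inv: "\<And>q. q \<in> T \<Longrightarrow> \<exists>M. bounded_linear M \<and> (\<forall>u. M (G q u) = u) \<and> (\<forall>u. G q (M u) = u)"
  shows "ndiff k T w"
  using assms(1,2) sol
proof (induction k arbitrary: r w)
  case (Suc k)
  obtain G' where G': "\<forall>x\<in>T. (G has_derivative G' x) (at x within T)"
    "\<forall>v. ndiff k T (\<lambda>x. G' x v)" using Suc.prems(1) by auto
  obtain r' where r': "\<forall>x\<in>T. (r has_derivative r' x) (at x within T)"
    "\<forall>v. ndiff k T (\<lambda>x. r' x v)" using Suc.prems(2) by auto
  from inv obtain M where M: "\<And>q. q \<in> T \<Longrightarrow> bounded_linear (M q)" "\<And>q u. q \<in> T \<Longrightarrow> M q (G q u) = u"
    "\<And>q u. q \<in> T \<Longrightarrow> G q (M q u) = u" by metis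
  have w: "(w has_derivative (\<lambda>h. M x (r' x h - G' x h (w x)))) (at x within T)" if "x \<in> T" for x
    by (rule has_derivative_solve[OF bspec[OF G'(1) that] bspec[OF r'(1) that] Suc.prems(3) that M[OF that]])
  have wk: "ndiff k T w"
    by (rule Suc.IH[OF ndiff_Suc_imp[OF Suc.prems(1)] ndiff_Suc_imp[OF Suc.prems(2)] Suc.prems(3)])
  have "ndiff k T (\<lambda>x. M x (r' x h - G' x h (w x)))" for h
  proof (rule Suc.IH)
    show "ndiff k T G" using Suc.prems(1) by (rule ndiff_Suc_imp)
    show "ndiff k T (\<lambda>x. r' x h - G' x h (w x))"
      using G'(2) r'(2) wk
      by (intro ndiff_diff ndiff_bilinear[OF bounded_bilinear_blinfun_apply]) auto
  qed (simp_all add: M)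
  with w show ?case unfolding ndiff.simps by (intro exI[of _ "\<lambda>x h. M x (r' x h - G' x h (w x))"]) blast
qed simp


section \<open>Smooth curves\<close>

text \<open>Weaker than the topological notion of the same name: there are no isolated points, but
  the set may fail to be closed. This is what makes derivatives within the set unique.\<close>

definition perfect_set :: "real set \<Rightarrow> bool" where
  "perfect_set J \<longleftrightarrow> (\<forall>t\<in>J. at t within J \<noteq> bot)"

lemma perfect_set_derivative:
  assumes "perfect_set J" "t \<in> J" "(f has_vector_derivative d) (at t within J)"
  shows "vector_derivative f (at t within J) = d"
  using assms(1,2) by (intro vector_derivative_within[OF _ assms(3)]) (simp add: perfect_set_def)

lemma has_derivative_imp_has_vector_derivative:
  assumes "(f has_derivative f') (at t within J)"
  shows "(f has_vector_derivative f' 1) (at t within J)"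
proof -
  have "f' h = h *\<^sub>R f' 1" for h
    using linear_cmul[OF has_derivative_linear[OF assms], of h 1] by simp
  then have "(\<lambda>h. h *\<^sub>R f' 1) = f'" by (intro ext) (rule sym)
  with assms show ?thesis unfolding has_vector_derivative_def by simp
qed

lemma ndiff_SucI_vector:
  assumes "\<And>t. t \<in> J \<Longrightarrow> (f has_vector_derivative f' t) (at t within J)" "ndiff k J f'"
  shows "ndiff (Suc k) J f"
  unfolding ndiff.simps
proof (intro exI[of _ "\<lambda>t h. h *\<^sub>R f' t"] conjI allI)
  show "ndiff k J (\<lambda>t. v *\<^sub>R f' t)" for v
    by (rule ndiff_linear_compose[OF bounded_linear_scaleR_right assms(2)])
qed (use assms(1) in \<open>auto simp: has_vector_derivative_def\<close>)

lemma ndiff_Suc_perfect: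
  assumes "perfect_set J"
  shows "ndiff (Suc k) J f \<longleftrightarrow> (\<forall>t\<in>J. (f has_vector_derivative vector_derivative f (at t within J)) (at t within J))
     \<and> ndiff k J (\<lambda>t. vector_derivative f (at t within J))" (is "_ \<longleftrightarrow> ?R")
proof
  assume "ndiff (Suc k) J f"
  then obtain f' where f': "\<forall>x\<in>J. (f has_derivative f' x) (at x within J)"
    "\<forall>v. ndiff k J (\<lambda>x. f' x v)" by auto
  have *: "(f has_vector_derivative f' t 1) (at t within J)" if "t \<in> J" for t
    using f'(1) that by (blast intro: has_derivative_imp_has_vector_derivative)
  have e: "f' t 1 = vector_derivative f (at t within J)" if "t \<in> J" for t
    using perfect_set_derivative[OF assms that *[OF that]] by simp
  have "ndiff k J (\<lambda>t. vector_derivative f (at t within J))"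
    using f'(2) by (intro ndiff_cong[of J "\<lambda>t. f' t 1", OF e]) auto
  with * e show ?R by auto
next
  assume ?R
  then show "ndiff (Suc k) J f"
    by (intro ndiff_SucI_vector) auto
qed

lemma smooth_curve_on_imp_smooth_within:
  assumes "smooth_curve_on J f"
  shows "ndiff k J f"
proof -
  obtain D where D: "\<forall>t\<in>J. D (0::nat) t = f t"
     "\<forall>k. \<forall>t\<in>J. (D k has_vector_derivative D (Suc k) t) (at t within J)"
    using assms unfolding smooth_curve_on_def by blast
  have "ndiff k J (D n)" for n
  proof (induction k arbitrary: n)
    case (Suc k)
    show ?case
      using D(2) Suc[of "Suc n"] by (intro ndiff_SucI_vector) auto
  qed simp
  from this[of 0] D(1) show ?thesis by (auto intro: ndiff_cong)
qed

text \<open>\<open>ndiff\<close> gives a separate tower of derivatives for each order,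
  \<open>smooth_curve_on\<close> wants a single infinite one. Uniqueness of derivatives within
  \<open>J\<close> identifies all towers with the iterated \<open>vector_derivative\<close>.\<close>

lemma smooth_curve_on_iff:
  assumes "perfect_set J"
  shows "smooth_curve_on J f \<longleftrightarrow> smooth_within J f"
proof
  assume s: "smooth_within J f"
  define D where "D = rec_nat f (\<lambda>_ h t. vector_derivative h (at t within J))"
  have D0: "D 0 = f" and DS: "D (Suc n) = (\<lambda>t. vector_derivative (D n) (at t within J))" for n
    by (auto simp: D_def)
  have sD: "smooth_within J (D n)" for n
  proof (induction n)
    case (Suc n)
    show ?case
    proof
      fix k show "ndiff k J (D (Suc n))"
        unfolding DS using Suc ndiff_Suc_perfect[OF assms, of k "D n"] by blast
    qed
  qed (use s D0 in auto)
  have "\<forall>t\<in>J. (D n has_vector_derivative D (Suc n) t) (at t within J)" for n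
    unfolding DS using sD[of n] ndiff_Suc_perfect[OF assms, of 0 "D n"] by blast
  with D0 show "smooth_curve_on J f"
    unfolding smooth_curve_on_def by blast
qed (use smooth_curve_on_imp_smooth_within in blast)

lemma at_within_Int_nhd:
  assumes "open U" "t \<in> U"
  shows "at t within (J \<inter> U) = at t within J"
  by (rule at_within_nhd[OF assms(2,1)]) blast

lemma perfect_set_Int_open:
  assumes "perfect_set J" "open U'"
  shows "perfect_set (J \<inter> U')"
  unfolding perfect_set_def
proof
  fix t assume t: "t \<in> J \<inter> U'"
  have "at t within (J \<inter> U') = at t within J"
    using t by (intro at_within_Int_nhd assms(2)) blast
  with assms(1) show "at t within (J \<inter> U') \<noteq> bot"
    using t by (simp add: perfect_set_def)
qed

text \<open>\<open>ndiff\<close> asks for one choice of derivative on the whole of \<open>J\<close>.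
  Without isolated points this choice is forced, and it is unaffected by intersecting
  \<open>J\<close> with an open set, so the local derivatives glue.\<close>

lemma ndiff_local:
  assumes J: "perfect_set J" and "\<And>t. t \<in> J \<Longrightarrow> \<exists>U'. open U' \<and> t \<in> U' \<and> ndiff k (J \<inter> U') f"
  shows "ndiff k J f"
  using assms(2)
proof (induction k arbitrary: f)
  case (Suc k)
  have w: "at t within J \<inter> U' = at t within J" if "open U'" "t \<in> J" "t \<in> U'" for t U'
    using that by (intro at_within_Int_nhd) auto
  show ?case
    unfolding ndiff_Suc_perfect[OF J]
  proof (intro conjI ballI)
    fix t assume t: "t \<in> J"
    then obtain U' where U': "open U'" "t \<in> U'" "ndiff (Suc k) (J \<inter> U') f" using Suc.prems by blast
    with ndiff_Suc_perfect[OF perfect_set_Int_open[OF J U'(1)]] t w[OF U'(1) t U'(2)]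
    show "(f has_vector_derivative vector_derivative f (at t within J)) (at t within J)"
      by (metis IntI)
  next
    show "ndiff k J (\<lambda>t. vector_derivative f (at t within J))"
    proof (rule Suc.IH)
      fix t assume t: "t \<in> J"
      then obtain U' where U': "open U'" "t \<in> U'" "ndiff (Suc k) (J \<inter> U') f" using Suc.prems by blast
      with ndiff_Suc_perfect[OF perfect_set_Int_open[OF J U'(1)]]
      have "ndiff k (J \<inter> U') (\<lambda>t. vector_derivative f (at t within J \<inter> U'))" by blast
      then have "ndiff k (J \<inter> U') (\<lambda>t. vector_derivative f (at t within J))"
        using w U' by (auto elim!: ndiff_cong[rotated])
      with U' show "\<exists>U'. open U' \<and> t \<in> U' \<and> ndiff k (J \<inter> U') (\<lambda>t. vector_derivative f (at t within J))"
        by blast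
    qed
  qed
qed simp

section \<open>Smooth dependence of short-time solutions of an ODE on the initial value\<close>

text \<open>Each order of \<open>ndiff\<close> comes with its own derivative. On an open set all of
  them are the Frechet derivative, so one operator-valued \<open>G\<close> serves every
  order.\<close>

lemma smooth_within_open_derivative:
  fixes h :: "'e::euclidean_space \<Rightarrow> 'b::real_normed_vector"
  assumes "open W" "smooth_within W h"
  obtains G :: "'e \<Rightarrow> 'e \<Rightarrow>\<^sub>L 'b" where "\<And>x. x \<in> W \<Longrightarrow> (h has_derivative blinfun_apply (G x)) (at x)"
    "\<And>v. smooth_within W (\<lambda>x. G x v)"
proof
  define G where "G x = Blinfun (frechet_derivative h (at x))" for x
  have d: "(h has_derivative frechet_derivative h (at x)) (at x)" if "x \<in> W" for x
  proof -
    obtain f' where "\<forall>x\<in>W. (h has_derivative f' x) (at x within W)"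
      using assms(2)[rule_format, of "Suc 0"] by auto
    with that have "(h has_derivative f' x) (at x within W)" by blast
    then have "(h has_derivative f' x) (at x)" using at_within_open[OF that assms(1)] by simp
    then show ?thesis by (simp add: frechet_derivative_at[symmetric])
  qed
  have G: "blinfun_apply (G x) = frechet_derivative h (at x)" if "x \<in> W" for x
    using has_derivative_bounded_linear[OF d[OF that]] by (simp add: G_def bounded_linear_Blinfun_apply)
  show "(h has_derivative blinfun_apply (G x)) (at x)" if "x \<in> W" for x
    using d that G by simp
  show "smooth_within W (\<lambda>x. G x v)" for v
  proof
    fix k
    obtain f' where f': "\<forall>x\<in>W. (h has_derivative f' x) (at x within W)" "\<forall>v. ndiff k W (\<lambda>x. f' x v)"
      using assms(2)[rule_format, of "Suc k"] by auto
    have "f' x v = G x v" if "x \<in> W" for x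
    proof -
      have "(h has_derivative f' x) (at x)" using f'(1) at_within_open[OF that assms(1)] that by metis
      with G[OF that] show ?thesis by (simp add: frechet_derivative_at[symmetric])
    qed
    with f'(2) show "ndiff k W (\<lambda>x. G x v)"
      using ndiff_cong[of W "\<lambda>x. f' x v" "\<lambda>x. G x v" k] by simp
  qed
qed

section \<open>Curves with clipped time as elements of a Banach space\<close>

definition clip :: "real \<Rightarrow> real \<Rightarrow> real" where
  "clip \<eta> s = max (-\<eta>) (min \<eta> s)"

lemma clip_mem: "\<eta> \<ge> 0 \<Longrightarrow> clip \<eta> s \<in> {-\<eta>..\<eta>}"
  by (auto simp: clip_def)

lemma clip_eq: "s \<in> {-\<eta>..\<eta>} \<Longrightarrow> clip \<eta> s = s"
  by (auto simp: clip_def)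

lemma continuous_on_clip: "continuous_on S (clip \<eta>)"
  unfolding clip_def by (intro continuous_intros)

lemma apply_Bcontfun:
  fixes f :: "'a::topological_space \<Rightarrow> 'b::real_normed_vector"
  assumes "continuous_on UNIV f" "\<And>x. norm (f x) \<le> b"
  shows "apply_bcontfun (Bcontfun f) = f"
  using bcontfun_normI[OF assms] by (simp add: Bcontfun_inverse)

text \<open>Time is clipped to \<open>{-\<eta>..\<eta>}\<close> so that solutions on this interval become elements of a Banach
  space of functions on the real line.\<close>

definition primitive :: "real \<Rightarrow> (real \<Rightarrow>\<^sub>C 'f::euclidean_space) \<Rightarrow> real \<Rightarrow>\<^sub>C 'f" where
  "primitive \<eta> u = Bcontfun (\<lambda>s. integral {-\<eta>..clip \<eta> s} u - integral {-\<eta>..0} u)"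

text \<open>An integral over an interval with reversed bounds is \<open>0\<close>, so the integral
  from \<open>0\<close> is written as a difference of integrals from \<open>-\<eta>\<close>. The two
  terms are at most \<open>2 * \<eta>\<close> and \<open>\<eta>\<close> times the norm of
  \<open>u\<close>, whence the factor \<open>3\<close>.\<close>

lemma
  fixes u :: "real \<Rightarrow>\<^sub>C 'f::euclidean_space"
  assumes \<eta>: "\<eta> > 0"
  shows apply_primitive: "primitive \<eta> u s = integral {-\<eta>..clip \<eta> s} u - integral {-\<eta>..0} u"
    and norm_primitive: "norm (primitive \<eta> u) \<le> 3 * \<eta> * norm u"
proof -
  have int: "u integrable_on {a..b}" for a b by (intro integrable_continuous_real) simp
  have b: "norm (integral {-\<eta>..x} u) \<le> norm u * (x + \<eta>)" if "x \<in> {-\<eta>..\<eta>}" for x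
    using integral_bound[of "-\<eta>" x u "norm u"] that by (auto simp: norm_bounded)
  have bd: "norm (integral {-\<eta>..clip \<eta> s} u - integral {-\<eta>..0} u) \<le> 3 * \<eta> * norm u" for s
  proof -
    have "clip \<eta> s \<in> {-\<eta>..\<eta>}" using \<eta> by (intro clip_mem) simp
    then have "norm u * (clip \<eta> s + \<eta>) \<le> norm u * (2 * \<eta>)" by (intro mult_left_mono) auto
    with b[OF \<open>clip \<eta> s \<in> _\<close>] b[of 0] \<eta>
      norm_triangle_ineq4[of "integral {-\<eta>..clip \<eta> s} u" "integral {-\<eta>..0} u"]
    show ?thesis by (simp add: algebra_simps)
  qed
  have "continuous_on UNIV (\<lambda>s. integral {-\<eta>..clip \<eta> s} u)"
    by (rule continuous_on_compose2[OF indefinite_integral_continuous_1[OF int[of "-\<eta>" \<eta>]] continuous_on_clip])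
      (use clip_mem[of \<eta>] \<eta> in auto)
  then have c: "continuous_on UNIV (\<lambda>s. integral {-\<eta>..clip \<eta> s} u - integral {-\<eta>..0} u)"
    by (intro continuous_intros)
  have ap: "apply_bcontfun (primitive \<eta> u) = (\<lambda>s. integral {-\<eta>..clip \<eta> s} u - integral {-\<eta>..0} u)"
    unfolding primitive_def by (rule apply_Bcontfun[OF c bd])
  then show "primitive \<eta> u s = integral {-\<eta>..clip \<eta> s} u - integral {-\<eta>..0} u" by simp
  show "norm (primitive \<eta> u) \<le> 3 * \<eta> * norm u"
    by (rule norm_bound) (simp only: ap bd)
qed

lemma bounded_linear_primitive:
  assumes \<eta>: "\<eta> > 0"
  shows "bounded_linear (primitive \<eta> :: (real \<Rightarrow>\<^sub>C 'f::euclidean_space) \<Rightarrow> _)"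
proof (rule bounded_linear_intro[of _ "3 * \<eta>"])
  have int: "apply_bcontfun u integrable_on {a..b}" for a b and u :: "real \<Rightarrow>\<^sub>C 'f"
    by (intro integrable_continuous_real) simp
  show "primitive \<eta> (u + v) = primitive \<eta> u + primitive \<eta> v" for u v :: "real \<Rightarrow>\<^sub>C 'f"
    by (rule bcontfun_eqI) (simp add: apply_primitive[OF \<eta>] plus_bcontfun.rep_eq integral_add[OF int int] cong: integral_cong)
  show "primitive \<eta> (c *\<^sub>R u) = c *\<^sub>R primitive \<eta> u" for c and u :: "real \<Rightarrow>\<^sub>C 'f"
    by (rule bcontfun_eqI) (simp add: apply_primitive[OF \<eta>] scaleR_bcontfun.rep_eq scaleR_diff_right)
  show "norm (primitive \<eta> u) \<le> norm u * (3 * \<eta>)" for u :: "real \<Rightarrow>\<^sub>C 'f"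
    using norm_primitive[OF \<eta>, of u] by (simp add: mult.commute)
qed

lemma bounded_linear_apply_bcontfun: "bounded_linear (\<lambda>u :: 'a::topological_space \<Rightarrow>\<^sub>C 'b::real_normed_vector. apply_bcontfun u s)"
  by (rule bounded_linear_intro[of _ 1]) (auto simp: plus_bcontfun.rep_eq scaleR_bcontfun.rep_eq norm_bounded)

lemma bounded_linear_const_bcontfun:
  "bounded_linear (const_bcontfun :: 'b::real_normed_vector \<Rightarrow> 'a::topological_space \<Rightarrow>\<^sub>C 'b)"
proof (rule bounded_linear_intro[of _ 1])
  show "norm (const_bcontfun x :: 'a \<Rightarrow>\<^sub>C 'b) \<le> norm x * 1" for x :: 'b
    by (rule norm_bound) (simp add: const_bcontfun.rep_eq)
qed (auto intro!: bcontfun_eqI simp: plus_bcontfun.rep_eq scaleR_bcontfun.rep_eq const_bcontfun.rep_eq)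

text \<open>The product of \<open>a\<close> with one coordinate of \<open>u\<close>. Summed over
  \<open>Basis\<close> with \<open>a\<close> the function
  \<open>s \<mapsto> G (\<zeta> s) b\<close>, it yields the pointwise application of
  \<open>G (\<zeta> s)\<close> to \<open>u s\<close>, built from bounded bilinear maps only.\<close>

definition comp_mult :: "'f::euclidean_space \<Rightarrow> (real \<Rightarrow>\<^sub>C 'f) \<Rightarrow> (real \<Rightarrow>\<^sub>C 'g::real_normed_vector) \<Rightarrow> real \<Rightarrow>\<^sub>C 'g" where
  "comp_mult b u a = Bcontfun (\<lambda>s. (u s \<bullet> b) *\<^sub>R a s)"

lemma
  fixes u :: "real \<Rightarrow>\<^sub>C 'f::euclidean_space" and a :: "real \<Rightarrow>\<^sub>C 'g::real_normed_vector"
  shows apply_comp_mult: "comp_mult b u a s = (u s \<bullet> b) *\<^sub>R a s"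
    and norm_comp_mult: "norm (comp_mult b u a) \<le> norm u * norm a * norm b"
proof -
  have bd: "norm ((u s \<bullet> b) *\<^sub>R a s) \<le> norm u * norm a * norm b" for s
  proof -
    have "norm ((u s \<bullet> b) *\<^sub>R a s) \<le> (norm (u s) * norm b) * norm (a s)"
      using Cauchy_Schwarz_ineq2[of "u s" b] by (simp add: mult_right_mono)
    also have "\<dots> \<le> (norm u * norm b) * norm a"
      by (intro mult_mono mult_nonneg_nonneg norm_bounded) auto
    finally show ?thesis by (simp add: ac_simps)
  qed
  have ap: "apply_bcontfun (comp_mult b u a) = (\<lambda>s. (u s \<bullet> b) *\<^sub>R a s)"
    unfolding comp_mult_def by (rule apply_Bcontfun[OF _ bd]) (intro continuous_intros continuous_on_apply_bcontfun)
  then show "comp_mult b u a s = (u s \<bullet> b) *\<^sub>R a s" by simp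
  show "norm (comp_mult b u a) \<le> norm u * norm a * norm b"
    by (rule norm_bound) (simp only: ap bd)
qed

lemma bounded_bilinear_comp_mult:
  "bounded_bilinear (comp_mult b :: (real \<Rightarrow>\<^sub>C 'f::euclidean_space) \<Rightarrow> (real \<Rightarrow>\<^sub>C 'g::real_normed_vector) \<Rightarrow> _)"
proof
  show "\<exists>K. \<forall>(u::real \<Rightarrow>\<^sub>C 'f) (a::real \<Rightarrow>\<^sub>C 'g). norm (comp_mult b u a) \<le> norm u * norm a * K"
    using norm_comp_mult by blast
qed (rule bcontfun_eqI, simp add: apply_comp_mult plus_bcontfun.rep_eq scaleR_bcontfun.rep_eq
      inner_add_left scaleR_add_left scaleR_add_right)+

text \<open>The Nemytskii operator of \<open>h\<close>. It is applied to curves with values in a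
  compact set on which \<open>h\<close> is continuous; there the composite is bounded and
  \<open>Bcontfun\<close> returns it unchanged.\<close>

definition superpose :: "('f::real_normed_vector \<Rightarrow> 'g::real_normed_vector) \<Rightarrow> (real \<Rightarrow>\<^sub>C 'f) \<Rightarrow> real \<Rightarrow>\<^sub>C 'g" where
  "superpose h u = Bcontfun (\<lambda>s. h (u s))"

definition funs_in :: "'f::metric_space set \<Rightarrow> (real \<Rightarrow>\<^sub>C 'f) set" where
  "funs_in K = {u. \<forall>s. apply_bcontfun u s \<in> K}"

lemma apply_superpose:
  fixes h :: "'f::real_normed_vector \<Rightarrow> 'g::real_normed_vector"
  assumes "compact K" "continuous_on K h" "u \<in> funs_in K"
  shows "superpose h u s = h (u s)"
proof -
  obtain B where B: "\<And>x. x \<in> K \<Longrightarrow> norm (h x) \<le> B"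
    using compact_imp_bounded[OF compact_continuous_image[OF assms(2,1)]] unfolding bounded_iff by auto
  have "continuous_on UNIV (\<lambda>s. h (u s))"
    using assms(3) by (intro continuous_on_compose2[OF assms(2)]) (auto simp: funs_in_def)
  then have "apply_bcontfun (superpose h u) = (\<lambda>s. h (u s))"
    unfolding superpose_def using B assms(3) by (intro apply_Bcontfun[of _ B]) (auto simp: funs_in_def)
  then show ?thesis by simp
qed

lemma apply_bcontfun_sum:
  fixes f :: "'i \<Rightarrow> 'a::topological_space \<Rightarrow>\<^sub>C 'b::real_normed_vector"
  shows "apply_bcontfun (\<Sum>i\<in>I. f i) s = (\<Sum>i\<in>I. apply_bcontfun (f i) s)"
  using bounded_linear_apply_bcontfun by (rule linear_sum[OF bounded_linear.linear])

lemma apply_superpose_derivative: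
  fixes G :: "'f::euclidean_space \<Rightarrow> 'f \<Rightarrow>\<^sub>L 'g::real_normed_vector"
  assumes "compact K" "\<And>v. continuous_on K (\<lambda>x. G x v)" "\<zeta> \<in> funs_in K"
  shows "apply_bcontfun (\<Sum>b\<in>Basis. comp_mult b u (superpose (\<lambda>x. G x b) \<zeta>)) s = G (\<zeta> s) (u s)"
  by (simp add: apply_bcontfun_sum apply_comp_mult apply_superpose[OF assms]
      linear_eq_sum_Basis[OF blinfun.bounded_linear_right[THEN bounded_linear.linear], of _ "u s"])

text \<open>The derivative is pointwise application of \<open>G (\<zeta> s)\<close> to
  \<open>u s\<close>. Uniform continuity of \<open>G\<close> on the compact set \<open>K\<close>
  makes the mean value remainder small uniformly in \<open>s\<close>, as the supremum norm demands;
  convexity keeps the segments between values in \<open>K\<close>.\<close>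

lemma superpose_has_derivative:
  fixes h :: "'f::euclidean_space \<Rightarrow> 'g::real_normed_vector" and G :: "'f \<Rightarrow> 'f \<Rightarrow>\<^sub>L 'g"
  assumes K: "compact K" "convex K"
    and h: "\<And>x. x \<in> K \<Longrightarrow> (h has_derivative blinfun_apply (G x)) (at x within K)"
    and G: "\<And>v. continuous_on K (\<lambda>x. G x v)"
    and \<zeta>: "\<zeta> \<in> funs_in K"
  shows "(superpose h has_derivative (\<lambda>u. \<Sum>b\<in>Basis. comp_mult b u (superpose (\<lambda>x. G x b) \<zeta>)))
    (at \<zeta> within funs_in K)"
  unfolding has_derivative_within_alt
proof (intro conjI allI impI)
  show "bounded_linear (\<lambda>u. \<Sum>b\<in>Basis. comp_mult b u (superpose (\<lambda>x. G x b) \<zeta>))"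
    by (intro bounded_linear_sum bounded_bilinear.bounded_linear_left[OF bounded_bilinear_comp_mult])
  fix e :: real assume e: "e > 0"
  have hc: "continuous_on K h"
    unfolding continuous_on_eq_continuous_within using h has_derivative_continuous by blast
  have "continuous_on K G"
    by (rule continuous_on_blinfun_componentwise) (rule G)
  then have "uniformly_continuous_on K G" using K(1) by (rule compact_uniformly_continuous)
  then obtain d where d: "d > 0" "\<And>x y. x \<in> K \<Longrightarrow> y \<in> K \<Longrightarrow> dist y x < d \<Longrightarrow> dist (G y) (G x) < e"
    unfolding uniformly_continuous_on_def using e by metis
  show "\<exists>d>0. \<forall>\<xi>\<in>funs_in K. norm (\<xi> - \<zeta>) < d \<longrightarrow> norm (superpose h \<xi> - superpose h \<zeta> -
      (\<Sum>b\<in>Basis. comp_mult b (\<xi> - \<zeta>) (superpose (\<lambda>x. G x b) \<zeta>))) \<le> e * norm (\<xi> - \<zeta>)"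
  proof (intro exI[of _ d] conjI ballI impI)
    fix \<xi> assume \<xi>: "\<xi> \<in> funs_in K" and less: "norm (\<xi> - \<zeta>) < d"
    show "norm (superpose h \<xi> - superpose h \<zeta> -
      (\<Sum>b\<in>Basis. comp_mult b (\<xi> - \<zeta>) (superpose (\<lambda>x. G x b) \<zeta>))) \<le> e * norm (\<xi> - \<zeta>)"
    proof (rule norm_bound)
      fix s
      define a where "a = apply_bcontfun \<zeta> s"
      define b where "b = apply_bcontfun \<xi> s"
      have ab: "a \<in> K" "b \<in> K" using \<zeta> \<xi> by (auto simp: a_def b_def funs_in_def)
      then have seg: "closed_segment a b \<subseteq> K" using K(2) closed_segment_subset by blast
      have le: "norm (b - a) \<le> norm (\<xi> - \<zeta>)"
        using norm_bounded[of "\<xi> - \<zeta>" s] by (simp add: a_def b_def minus_bcontfun.rep_eq)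
      have "norm (h b - h a - G a (b - a)) \<le> norm (b - a) * e"
      proof (rule differentiable_bound_linearization[where S="closed_segment a b" and f'="\<lambda>x. blinfun_apply (G x)"])
        show "a + t *\<^sub>R (b - a) \<in> closed_segment a b" if "t \<in> {0..1}" for t
          using that by (auto simp: closed_segment_def algebra_simps intro!: exI[of _ t])
        show "(h has_derivative blinfun_apply (G x)) (at x within closed_segment a b)" if "x \<in> closed_segment a b" for x
          using that seg h by (meson has_derivative_subset subsetD)
        show "onorm (blinfun_apply (G x) - blinfun_apply (G a)) \<le> e" if "x \<in> closed_segment a b" for x
        proof -
          have "dist x a \<le> norm (b - a)" using segment_bound(1)[OF that] by (simp add: dist_norm norm_minus_commute)
          then have "dist x a < d" using le less by linarith
          then have "dist (G x) (G a) < e" using d(2)[of a x] that seg ab by auto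
          then have "norm (G x - G a) \<le> e" by (simp add: dist_norm)
          then show ?thesis by (simp add: norm_blinfun.rep_eq minus_blinfun.rep_eq fun_diff_def)
        qed
      qed simp
      also have "\<dots> \<le> e * norm (\<xi> - \<zeta>)" using le e by (simp add: mult.commute)
      finally show "norm (apply_bcontfun (superpose h \<xi> - superpose h \<zeta> -
        (\<Sum>b\<in>Basis. comp_mult b (\<xi> - \<zeta>) (superpose (\<lambda>x. G x b) \<zeta>))) s) \<le> e * norm (\<xi> - \<zeta>)"
        by (simp add: minus_bcontfun.rep_eq apply_superpose_derivative[OF K(1) G \<zeta>]
            apply_superpose[OF K(1) hc \<zeta>] apply_superpose[OF K(1) hc \<xi>] a_def b_def)
    qed
  qed (rule d)
qed

text \<open>The derivative consists of superpositions of the smooth functions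
  \<open>\<lambda>x. G x b\<close>, multiplied by the derivative of \<open>f\<close>. Hence the
  induction varies \<open>h\<close> and keeps \<open>f\<close>.\<close>

lemma ndiff_superpose:
  fixes h :: "'f::euclidean_space \<Rightarrow> 'g::real_normed_vector"
  assumes W: "open W" and K: "compact K" "convex K" "K \<subseteq> W"
    and "smooth_within W h" "ndiff k T f" and fK: "\<And>t. t \<in> T \<Longrightarrow> f t \<in> funs_in K"
  shows "ndiff k T (\<lambda>t. superpose h (f t))"
  using assms(5,6)
proof (induction k arbitrary: h)
  case (Suc k)
  obtain G where G: "\<And>x. x \<in> W \<Longrightarrow> (h has_derivative blinfun_apply (G x)) (at x)"
    "\<And>v. smooth_within W (\<lambda>x. G x v)"
    using smooth_within_open_derivative[OF W Suc.prems(1)] by blast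
  obtain f' where f': "\<forall>x\<in>T. (f has_derivative f' x) (at x within T)"
    "\<forall>v. ndiff k T (\<lambda>x. f' x v)" using Suc.prems(2) by auto
  have Gc: "continuous_on K (\<lambda>x. G x v)" for v
    using ndiff_imp_continuous_on[of 0 W "\<lambda>x. G x v"] G(2)[of v] K(3) continuous_on_subset by blast
  have h': "(superpose h has_derivative (\<lambda>u. \<Sum>b\<in>Basis. comp_mult b u (superpose (\<lambda>x. G x b) \<zeta>)))
    (at \<zeta> within funs_in K)" if "\<zeta> \<in> funs_in K" for \<zeta>
    using K G(1) Gc that by (intro superpose_has_derivative) (auto intro: has_derivative_at_withinI)
  show ?case
    unfolding ndiff.simps
  proof (intro exI[of _ "\<lambda>t v. \<Sum>b\<in>Basis. comp_mult b (f' t v) (superpose (\<lambda>x. G x b) (f t))"] conjI ballI allI)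
    fix t assume t: "t \<in> T"
    show "((\<lambda>t. superpose h (f t)) has_derivative
        (\<lambda>v. \<Sum>b\<in>Basis. comp_mult b (f' t v) (superpose (\<lambda>x. G x b) (f t)))) (at t within T)"
      by (rule has_derivative_in_compose[OF bspec[OF f'(1) t]
           has_derivative_subset[OF h'[OF fK[OF t]]]]) (use fK in auto)
  next
    fix v
    show "ndiff k T (\<lambda>t. \<Sum>b\<in>Basis. comp_mult b (f' t v) (superpose (\<lambda>x. G x b) (f t)))"
      by (intro ndiff_sum ndiff_bilinear[OF bounded_bilinear_comp_mult] spec[OF f'(2)]
          Suc.IH[OF G(2)] ndiff_Suc_imp[OF Suc.prems(2)])
  qed
qed simp

text \<open>An implicit function theorem for a map \<open>\<zeta>\<close> that is already there. By
  \<open>lip\<close>, increments of \<open>\<zeta>\<close> are at most proportional to those of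
  \<open>F\<close> along \<open>\<zeta>\<close>, hence to \<open>q - p\<close>; so the error of
  linearizing \<open>F\<close> is of smaller order, and \<open>M\<close> inverts the
  linearization.\<close>

lemma has_derivative_of_implicit:
  fixes F :: "'x::real_normed_vector \<Rightarrow> 'y::real_normed_vector" and \<zeta> :: "'a::real_normed_vector \<Rightarrow> 'x"
  assumes F: "(F has_derivative F') (at (\<zeta> p) within S)" and \<zeta>S: "\<And>q. q \<in> T \<Longrightarrow> \<zeta> q \<in> S" and p: "p \<in> T"
    and c: "((\<lambda>q. F (\<zeta> q)) has_derivative c') (at p within T)"
    and M: "bounded_linear M" "\<And>u. M (F' u) = u"
    and lip: "\<And>q. q \<in> T \<Longrightarrow> norm (\<zeta> q - \<zeta> p) \<le> C * norm (F (\<zeta> q) - F (\<zeta> p))"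
  shows "(\<zeta> has_derivative (\<lambda>h. M (c' h))) (at p within T)"
  unfolding has_derivative_within_alt
proof (intro conjI allI impI)
  interpret M: bounded_linear M by fact
  interpret c: bounded_linear c' using c by (rule has_derivative_bounded_linear)
  show "bounded_linear (\<lambda>h. M (c' h))"
    by (intro bounded_linear_compose[OF M(1)] c.bounded_linear_axioms)
  fix e :: real assume e: "e > 0"
  obtain N where N: "N > 0" "\<And>v. norm (M v) \<le> norm v * N" using M.pos_bounded by blast
  obtain B where B: "B > 0" "\<And>v. norm (c' v) \<le> norm v * B" using c.pos_bounded by blast
  define C' where "C' = max C 1"
  have C': "C' > 0" "\<And>q. q \<in> T \<Longrightarrow> norm (\<zeta> q - \<zeta> p) \<le> C' * norm (F (\<zeta> q) - F (\<zeta> p))"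
    using order_trans[OF lip mult_right_mono[of C C']] by (auto simp: C'_def)
  \<comment> \<open>Each of the two remainders, after applying \<open>M\<close> with its bound
    \<open>N\<close>, may cost \<open>e / 2\<close>. The factor \<open>B + 1\<close> bounds the
    growth of \<open>F\<close> along \<open>\<zeta>\<close> near \<open>p\<close>, thanks to
    \<open>e2 \<le> 1\<close>.\<close>
  define e1 where "e1 = e / (2 * N * C' * (B + 1))"
  define e2 where "e2 = min 1 (e / (2 * N))"
  have e12: "e1 > 0" "e2 > 0" using e N B C' by (auto simp: e1_def e2_def)
  obtain d1 where d1: "d1 > 0" "\<And>y. y \<in> S \<Longrightarrow> norm (y - \<zeta> p) < d1 \<Longrightarrow>
      norm (F y - F (\<zeta> p) - F' (y - \<zeta> p)) \<le> e1 * norm (y - \<zeta> p)"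
    using F e12 unfolding has_derivative_within_alt by metis
  obtain d2 where d2: "d2 > 0" "\<And>q. q \<in> T \<Longrightarrow> norm (q - p) < d2 \<Longrightarrow>
      norm (F (\<zeta> q) - F (\<zeta> p) - c' (q - p)) \<le> e2 * norm (q - p)"
    using c e12 unfolding has_derivative_within_alt by metis
  define d where "d = min d2 (d1 / (C' * (B + 1)))"
  show "\<exists>d>0. \<forall>q\<in>T. norm (q - p) < d \<longrightarrow> norm (\<zeta> q - \<zeta> p - M (c' (q - p))) \<le> e * norm (q - p)"
  proof (intro exI[of _ d] conjI ballI impI)
    show "d > 0" using d1 d2 C' B by (auto simp: d_def)
    fix q assume q: "q \<in> T" "norm (q - p) < d"
    have 1: "norm (F (\<zeta> q) - F (\<zeta> p) - c' (q - p)) \<le> e2 * norm (q - p)"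
      using d2 q by (auto simp: d_def)
    have "norm (F (\<zeta> q) - F (\<zeta> p)) \<le> e2 * norm (q - p) + norm (q - p) * B"
      using 1 B(2)[of "q - p"] norm_triangle_sub[of "F (\<zeta> q) - F (\<zeta> p)" "c' (q - p)"] by linarith
    also have "\<dots> \<le> (B + 1) * norm (q - p)"
      using mult_right_mono[of e2 1 "norm (q - p)"] by (simp add: algebra_simps e2_def)
    finally have "C' * norm (F (\<zeta> q) - F (\<zeta> p)) \<le> C' * ((B + 1) * norm (q - p))"
      using C'(1) by (intro mult_left_mono) auto
    with C'(2)[OF q(1)] have 2: "norm (\<zeta> q - \<zeta> p) \<le> C' * (B + 1) * norm (q - p)"
      by (simp add: mult.assoc)
    have "norm (q - p) * (C' * (B + 1)) < d1"
      using q(2) C'(1) B(1) by (auto simp: d_def pos_less_divide_eq)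
    with 2 have "norm (\<zeta> q - \<zeta> p) < d1" by (simp add: mult.commute)
    then have "norm (F (\<zeta> q) - F (\<zeta> p) - F' (\<zeta> q - \<zeta> p)) \<le> e1 * norm (\<zeta> q - \<zeta> p)"
      using d1(2) \<zeta>S q(1) by blast
    also have "\<dots> \<le> e1 * (C' * (B + 1) * norm (q - p))" using 2 e12 by (intro mult_left_mono) auto
    also have "\<dots> = e / (2 * N) * norm (q - p)" using C'(1) B(1) by (simp add: e1_def)
    finally have 3: "norm (F (\<zeta> q) - F (\<zeta> p) - F' (\<zeta> q - \<zeta> p)) * N \<le> e / 2 * norm (q - p)"
      using N(1) by (simp add: field_simps)
    have "e2 * norm (q - p) \<le> e / (2 * N) * norm (q - p)" by (intro mult_right_mono) (auto simp: e2_def)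
    with 1 have "norm (F (\<zeta> q) - F (\<zeta> p) - c' (q - p)) \<le> e / (2 * N) * norm (q - p)" by linarith
    then have 4: "norm (F (\<zeta> q) - F (\<zeta> p) - c' (q - p)) * N \<le> e / 2 * norm (q - p)"
      using N(1) by (simp add: field_simps)
    have "\<zeta> q - \<zeta> p - M (c' (q - p)) = M (F (\<zeta> q) - F (\<zeta> p) - c' (q - p)) -
        M (F (\<zeta> q) - F (\<zeta> p) - F' (\<zeta> q - \<zeta> p))"
      by (simp add: M.diff[of _ "c' _"] M.diff[of _ "F' _"] M(2))
    then have "norm (\<zeta> q - \<zeta> p - M (c' (q - p))) \<le> norm (M (F (\<zeta> q) - F (\<zeta> p) - c' (q - p))) +
        norm (M (F (\<zeta> q) - F (\<zeta> p) - F' (\<zeta> q - \<zeta> p)))"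
      by (simp add: norm_triangle_ineq4)
    also have "\<dots> \<le> e / 2 * norm (q - p) + e / 2 * norm (q - p)"
      using 3 4 N(2) by (meson add_mono order_trans)
    finally show "norm (\<zeta> q - \<zeta> p - M (c' (q - p))) \<le> e * norm (q - p)" by simp
  qed
qed

section \<open>The integral equation and its linearization\<close>

definition ode_solution :: "('f::real_normed_vector \<Rightarrow> 'f) \<Rightarrow> 'f set \<Rightarrow> real \<Rightarrow> (real \<Rightarrow> 'f) \<Rightarrow> bool" where
  "ode_solution V K \<eta> z \<longleftrightarrow>
     (\<forall>s\<in>{-\<eta>..\<eta>}. z s \<in> K \<and> (z has_vector_derivative V (z s)) (at s within {-\<eta>..\<eta>}))"

text \<open>The fundamental theorem of calculus evaluates both integrals from
  \<open>-\<eta>\<close>; their difference is \<open>z (clip \<eta> s) - z 0\<close>.\<close>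

lemma ode_solution_fixed_point:
  fixes V :: "'f::euclidean_space \<Rightarrow> 'f"
  assumes \<eta>: "\<eta> > 0" and K: "compact K" "continuous_on K V" and z: "ode_solution V K \<eta> z"
  defines "\<zeta> \<equiv> Bcontfun (\<lambda>s. z (clip \<eta> s))"
  shows "\<And>s. \<zeta> s = z (clip \<eta> s)" "\<zeta> \<in> funs_in K"
    "\<zeta> - primitive \<eta> (superpose V \<zeta>) = const_bcontfun (z 0)"
proof -
  have cl: "clip \<eta> s \<in> {-\<eta>..\<eta>}" for s using \<eta> by (intro clip_mem) simp
  have zK: "z s \<in> K" and zd: "(z has_vector_derivative V (z s)) (at s within {-\<eta>..\<eta>})" if "s \<in> {-\<eta>..\<eta>}" for s
    using z that by (auto simp: ode_solution_def)
  obtain B where B: "\<And>x. x \<in> K \<Longrightarrow> norm x \<le> B"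
    using compact_imp_bounded[OF K(1)] unfolding bounded_iff by auto
  have zc: "continuous_on {-\<eta>..\<eta>} z"
    unfolding continuous_on_eq_continuous_within using zd has_vector_derivative_continuous by blast
  then have "continuous_on UNIV (\<lambda>s. z (clip \<eta> s))"
    using cl by (intro continuous_on_compose2[OF zc continuous_on_clip]) auto
  then have "apply_bcontfun \<zeta> = (\<lambda>s. z (clip \<eta> s))"
    unfolding \<zeta>_def using B zK cl by (intro apply_Bcontfun[of _ B]) auto
  then show ap: "\<zeta> s = z (clip \<eta> s)" for s by simp
  show \<zeta>K: "\<zeta> \<in> funs_in K" using zK cl by (auto simp: funs_in_def ap)
  have int: "integral {-\<eta>..s} (superpose V \<zeta>) = z s - z (-\<eta>)" if s: "s \<in> {-\<eta>..\<eta>}" for s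
  proof -
    have "((\<lambda>r. V (z r)) has_integral z s - z (-\<eta>)) {-\<eta>..s}"
      using s by (intro fundamental_theorem_of_calculus) (auto intro!: has_vector_derivative_within_subset[OF zd])
    then have "integral {-\<eta>..s} (\<lambda>r. V (z r)) = z s - z (-\<eta>)" by (rule integral_unique)
    moreover have "integral {-\<eta>..s} (superpose V \<zeta>) = integral {-\<eta>..s} (\<lambda>r. V (z r))"
      using s by (intro integral_cong) (auto simp: apply_superpose[OF K \<zeta>K] ap clip_eq)
    ultimately show ?thesis by simp
  qed
  show "\<zeta> - primitive \<eta> (superpose V \<zeta>) = const_bcontfun (z 0)"
    by (rule bcontfun_eqI) (use int[OF cl] int[of 0] \<eta> in \<open>simp add: minus_bcontfun.rep_eq apply_primitive ap const_bcontfun.rep_eq\<close>)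
qed

text \<open>Solving \<open>u - S u = r\<close> is a fixed point problem for the contraction
  \<open>\<lambda>u. r + S u\<close>, which gives surjectivity; the bound
  \<open>norm u \<le> 2 * norm (u - S u)\<close> gives the rest.\<close>

lemma perturbation_of_identity_inverse:
  fixes S :: "'x::{real_normed_vector, complete_space} \<Rightarrow> 'x"
  assumes S: "bounded_linear S" "\<And>u. norm (S u) \<le> norm u / 2"
  obtains M where "bounded_linear M" "\<And>u. M (u - S u) = u" "\<And>u. M u - S (M u) = u"
proof -
  interpret S: bounded_linear S by fact
  have "surj (\<lambda>u. u - S u)"
    unfolding surj_def
  proof
    fix r
    have "\<exists>!u. r + S u = u"
      by (rule banach_fix_type[of "1/2"]) (use S(2) in \<open>simp_all add: dist_norm S.diff[symmetric] field_simps\<close>)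
    then show "\<exists>u. r = u - S u" by (metis add_diff_cancel_right')
  qed
  moreover have "norm u \<le> 2 * norm (u - S u)" for u
    using S(2)[of u] norm_triangle_sub[of u "S u"] by simp
  moreover have "bounded_linear (\<lambda>u. u - S u)"
    by (intro bounded_linear_sub bounded_linear_ident S(1))
  ultimately show thesis
    using that linear_homeomorphic_inverse[of "\<lambda>u. u - S u" 2] by metis
qed

text \<open>The bound \<open>3 * \<eta> * L \<le> 1 / 2\<close> makes \<open>\<zeta> \<mapsto> primitive \<eta> (superpose V \<zeta>)\<close> a contraction with
  constant \<open>1 / 2\<close>.\<close>

locale short_time =
  fixes V :: "'f::euclidean_space \<Rightarrow> 'f" and W K :: "'f set" and \<eta> L :: real
    and G :: "'f \<Rightarrow> 'f \<Rightarrow>\<^sub>L 'f"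
  assumes W: "open W" and K: "compact K" "convex K" "K \<subseteq> W" and \<eta>: "\<eta> > 0"
    and V: "smooth_within W V" and G: "\<And>x. x \<in> W \<Longrightarrow> (V has_derivative blinfun_apply (G x)) (at x)"
    and G_smooth: "\<And>v. smooth_within W (\<lambda>x. G x v)"
    and L: "\<And>x. x \<in> K \<Longrightarrow> norm (G x) \<le> L" "L \<ge> 0" "3 * \<eta> * L \<le> 1 / 2"
begin

abbreviation "P \<equiv> primitive \<eta> :: (real \<Rightarrow>\<^sub>C 'f) \<Rightarrow> real \<Rightarrow>\<^sub>C 'f"

lemma V_continuous: "continuous_on K V"
  using ndiff_imp_continuous_on[of 0 W V] V K(3) continuous_on_subset by blast

lemma G_continuous: "continuous_on K (\<lambda>x. G x v)"
  using ndiff_imp_continuous_on[of 0 W "\<lambda>x. G x v"] G_smooth[of v] K(3) continuous_on_subset by blast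

text \<open>The derivative of \<open>superpose V\<close> at \<open>\<zeta>\<close>: at time
  \<open>s\<close> it is \<open>G (\<zeta> s)\<close> applied to \<open>u s\<close>.\<close>

definition lin :: "(real \<Rightarrow>\<^sub>C 'f) \<Rightarrow> (real \<Rightarrow>\<^sub>C 'f) \<Rightarrow> real \<Rightarrow>\<^sub>C 'f" where
  "lin \<zeta> u = (\<Sum>b\<in>Basis. comp_mult b u (superpose (\<lambda>x. G x b) \<zeta>))"

lemma bounded_linear_lin: "bounded_linear (lin \<zeta>)"
  unfolding lin_def[abs_def]
  by (intro bounded_linear_sum bounded_bilinear.bounded_linear_left[OF bounded_bilinear_comp_mult])

lemma half: "norm (P v) \<le> norm u / 2" if "norm v \<le> L * norm u"
  for u :: "'x::real_normed_vector" and v :: "real \<Rightarrow>\<^sub>C 'f"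
proof -
  have "norm (P v) \<le> 3 * \<eta> * norm v" using \<eta> by (rule norm_primitive)
  also have "\<dots> \<le> 3 * \<eta> * (L * norm u)" using \<eta> that by simp
  also have "\<dots> = (3 * \<eta> * L) * norm u" by simp
  also have "\<dots> \<le> 1 / 2 * norm u" using L(3) by (intro mult_right_mono) auto
  finally show ?thesis by simp
qed

lemma norm_lin:
  assumes "\<zeta> \<in> funs_in K" shows "norm (lin \<zeta> u) \<le> L * norm u"
proof (rule norm_bound)
  fix s
  have "norm (G (\<zeta> s) (u s)) \<le> norm (G (\<zeta> s)) * norm (u s)" by (rule norm_blinfun)
  also have "\<dots> \<le> L * norm u"
    using assms L norm_bounded[of u s] by (intro mult_mono) (auto simp: funs_in_def)
  finally show "norm (lin \<zeta> u s) \<le> L * norm u"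
    unfolding lin_def by (simp add: apply_superpose_derivative[OF K(1) G_continuous assms])
qed

lemma V_Lipschitz: assumes "x \<in> K" "y \<in> K" shows "norm (V y - V x) \<le> L * norm (y - x)"
  using assms K G L(1)
  by (intro differentiable_bound[OF K(2), of V "\<lambda>x. blinfun_apply (G x)"])
    (auto intro: has_derivative_at_withinI simp: norm_blinfun.rep_eq[symmetric])

lemma superpose_Lipschitz:
  assumes "\<zeta> \<in> funs_in K" "\<xi> \<in> funs_in K"
  shows "norm (superpose V \<xi> - superpose V \<zeta>) \<le> L * norm (\<xi> - \<zeta>)"
proof (rule norm_bound)
  fix s
  have "norm (V (\<xi> s) - V (\<zeta> s)) \<le> L * norm (\<xi> s - \<zeta> s)"
    using assms by (intro V_Lipschitz) (auto simp: funs_in_def)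
  also have "\<dots> \<le> L * norm (\<xi> - \<zeta>)"
    using L(2) norm_bounded[of "\<xi> - \<zeta>" s] by (intro mult_left_mono) (auto simp: minus_bcontfun.rep_eq)
  finally show "norm ((superpose V \<xi> - superpose V \<zeta>) s) \<le> L * norm (\<xi> - \<zeta>)"
    by (simp add: minus_bcontfun.rep_eq apply_superpose[OF K(1) V_continuous] assms)
qed

text \<open>The solutions of the integral equation are the \<open>\<zeta>\<close> whose defect is a constant function, the
  constant being the initial value.\<close>

definition defect :: "(real \<Rightarrow>\<^sub>C 'f) \<Rightarrow> real \<Rightarrow>\<^sub>C 'f" where
  "defect \<zeta> = \<zeta> - P (superpose V \<zeta>)"

text \<open>The identity minus a contraction with constant \<open>1 / 2\<close> shrinks distances at
  most by the factor \<open>1 / 2\<close>. This gives uniqueness of solutions and also the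
  hypothesis \<open>lip\<close> of \<open>has_derivative_of_implicit\<close>.\<close>

lemma defect_expanding:
  assumes "\<zeta> \<in> funs_in K" "\<xi> \<in> funs_in K"
  shows "norm (\<xi> - \<zeta>) \<le> 2 * norm (defect \<xi> - defect \<zeta>)"
proof -
  interpret P: bounded_linear P by (rule bounded_linear_primitive[OF \<eta>])
  have "norm (P (superpose V \<xi> - superpose V \<zeta>)) \<le> norm (\<xi> - \<zeta>) / 2"
    by (rule half[OF superpose_Lipschitz[OF assms]])
  moreover have "\<xi> - \<zeta> = (defect \<xi> - defect \<zeta>) + P (superpose V \<xi> - superpose V \<zeta>)"
    by (simp add: defect_def P.diff)
  ultimately show ?thesis
    using norm_triangle_ineq[of "defect \<xi> - defect \<zeta>" "P (superpose V \<xi> - superpose V \<zeta>)"] by simp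
qed

lemma defect_derivative:
  assumes "\<zeta> \<in> funs_in K"
  shows "(defect has_derivative (\<lambda>u. u - P (lin \<zeta> u))) (at \<zeta> within funs_in K)"
proof -
  have "(superpose V has_derivative lin \<zeta>) (at \<zeta> within funs_in K)"
    unfolding lin_def[abs_def] using K G G_continuous assms
    by (intro superpose_has_derivative) (auto intro: has_derivative_at_withinI)
  from has_derivative_diff[OF has_derivative_ident bounded_linear.has_derivative[OF bounded_linear_primitive[OF \<eta>] this]]
  show ?thesis unfolding defect_def[abs_def] .
qed

lemma inverse_lin:
  assumes "\<zeta> \<in> funs_in K"
  shows "\<exists>M. bounded_linear M \<and> (\<forall>u. M (u - P (lin \<zeta> u)) = u) \<and> (\<forall>u. M u - P (lin \<zeta> (M u)) = u)"
  using perturbation_of_identity_inverse[of "\<lambda>u. P (lin \<zeta> u)"]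
    bounded_linear_compose[OF bounded_linear_primitive[OF \<eta>] bounded_linear_lin] half[OF norm_lin[OF assms]]
  by metis

text \<open>\<open>ndiff_solve\<close> wants the coefficient differentiable in operator norm.
  \<open>Q b\<close> is a bounded linear map from coefficient functions to operators, so the
  coefficient is the identity minus a finite sum of linear images of superpositions.\<close>

lemma ndiff_lin:
  assumes "ndiff k J \<zeta>" "\<And>t. t \<in> J \<Longrightarrow> \<zeta> t \<in> funs_in K"
  shows "ndiff k J (\<lambda>t. Blinfun (\<lambda>u. u - P (lin (\<zeta> t) u)))"
proof -
  define Q where "Q b a = Blinfun (\<lambda>u. P (comp_mult b u a))" for b :: 'f and a :: "real \<Rightarrow>\<^sub>C 'f"
  interpret P: bounded_linear P by (rule bounded_linear_primitive[OF \<eta>])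
  interpret C: bounded_bilinear "comp_mult b :: (real \<Rightarrow>\<^sub>C 'f) \<Rightarrow> (real \<Rightarrow>\<^sub>C 'f) \<Rightarrow> _" for b
    by (rule bounded_bilinear_comp_mult)
  have bl: "bounded_linear (\<lambda>u. P (comp_mult b u a))" for b :: 'f and a :: "real \<Rightarrow>\<^sub>C 'f"
    by (intro bounded_linear_compose[OF P.bounded_linear_axioms] C.bounded_linear_left)
  have Q: "Q b a u = P (comp_mult b u a)" for b a u
    by (simp add: Q_def bounded_linear_Blinfun_apply[OF bl])
  have "bounded_linear (Q b)" for b
  proof (rule bounded_linear_intro[of _ "3 * \<eta> * norm b"])
    show "Q b (a + a') = Q b a + Q b a'" for a a'
      by (rule blinfun_eqI) (simp add: Q blinfun.add_left C.add_right P.add)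
    show "Q b (c *\<^sub>R a) = c *\<^sub>R Q b a" for c a
      by (rule blinfun_eqI) (simp add: Q blinfun.scaleR_left C.scaleR_right P.scaleR)
    show "norm (Q b a) \<le> norm a * (3 * \<eta> * norm b)" for a
    proof (rule norm_blinfun_bound)
      fix u
      have "norm (Q b a u) \<le> 3 * \<eta> * norm (comp_mult b u a)" unfolding Q by (rule norm_primitive[OF \<eta>])
      also have "\<dots> \<le> 3 * \<eta> * (norm u * norm a * norm b)"
        using \<eta> norm_comp_mult by (intro mult_left_mono) auto
      finally show "norm (Q b a u) \<le> norm a * (3 * \<eta> * norm b) * norm u" by (simp add: ac_simps)
    qed (use \<eta> in auto)
  qed
  then have *: "ndiff k J (\<lambda>t. id_blinfun - (\<Sum>b\<in>Basis. Q b (superpose (\<lambda>x. G x b) (\<zeta> t))))"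
    by (intro ndiff_diff ndiff_const ndiff_sum ndiff_linear_compose[of "Q _"]
        ndiff_superpose[OF W K G_smooth assms]) auto
  have bl2: "bounded_linear (\<lambda>u. u - P (lin (\<zeta> t) u))" for t
    by (intro bounded_linear_sub bounded_linear_ident bounded_linear_compose[OF P.bounded_linear_axioms] bounded_linear_lin)
  have "id_blinfun - (\<Sum>b\<in>Basis. Q b (superpose (\<lambda>x. G x b) (\<zeta> t))) = Blinfun (\<lambda>u. u - P (lin (\<zeta> t) u))" for t
    by (rule blinfun_eqI)
      (simp add: bounded_linear_Blinfun_apply[OF bl2, unfolded lin_def P.sum] blinfun.diff_left blinfun.sum_left Q lin_def P.sum)
  with * show ?thesis by simp
qed

text \<open>Equal initial values mean equal defects, and \<open>defect\<close> is injective on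
  curves in \<open>K\<close> by \<open>defect_expanding\<close>.\<close>

lemma solution_unique:
  assumes "ode_solution V K \<eta> z" "ode_solution V K \<eta> z'" "z 0 = z' 0" "s \<in> {-\<eta>..\<eta>}"
  shows "z s = z' s"
proof -
  note f = ode_solution_fixed_point[OF \<eta> K(1) V_continuous assms(1)]
    and f' = ode_solution_fixed_point[OF \<eta> K(1) V_continuous assms(2)]
  from defect_expanding[OF f(2) f'(2)] have "Bcontfun (\<lambda>s. z' (clip \<eta> s)) = Bcontfun (\<lambda>s. z (clip \<eta> s))"
    unfolding defect_def f(3) f'(3) assms(3) by simp
  with f(1)[of s] f'(1)[of s] assms(4) show ?thesis by (simp add: clip_eq)
qed

text \<open>The defect of \<open>\<zeta> t\<close> is the constant function with value
  \<open>Z t 0\<close> and so inherits its order in \<open>t\<close>; \<open>\<zeta>\<close> is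
  recovered from the defect. Smoothness is proved for the whole curve \<open>\<zeta> t\<close> as a
  point of the function space, and evaluated at \<open>s\<close> only at the end.\<close>

lemma ndiff_solution:
  assumes sol: "\<And>t. t \<in> J \<Longrightarrow> ode_solution V K \<eta> (Z t)" and k: "ndiff k J (\<lambda>t. Z t 0)" and s: "s \<in> {-\<eta>..\<eta>}"
  shows "ndiff k J (\<lambda>t. Z t s)"
proof -
  define \<zeta> where "\<zeta> t = Bcontfun (\<lambda>s. Z t (clip \<eta> s))" for t
  have f: "\<And>s. \<zeta> t s = Z t (clip \<eta> s)" "\<zeta> t \<in> funs_in K" "defect (\<zeta> t) = const_bcontfun (Z t 0)"
    if "t \<in> J" for t
    using ode_solution_fixed_point[OF \<eta> K(1) V_continuous sol[OF that]] by (auto simp: \<zeta>_def defect_def)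
  have "ndiff k J \<zeta>"
    using k
  proof (induction k)
    case (Suc k)
    have "ndiff (Suc k) J (\<lambda>t. const_bcontfun (Z t 0) :: real \<Rightarrow>\<^sub>C 'f)"
      by (rule ndiff_linear_compose[OF bounded_linear_const_bcontfun Suc.prems])
    then have "ndiff (Suc k) J (\<lambda>t. defect (\<zeta> t))"
      by (rule ndiff_cong[rotated]) (simp add: f)
    then obtain c' where c': "\<forall>t\<in>J. ((\<lambda>t. defect (\<zeta> t)) has_derivative c' t) (at t within J)"
      "\<forall>v. ndiff k J (\<lambda>t. c' t v)" by auto
    have "\<forall>t\<in>J. \<exists>M. bounded_linear M \<and> (\<forall>u. M (u - P (lin (\<zeta> t) u)) = u)
        \<and> (\<forall>u. M u - P (lin (\<zeta> t) (M u)) = u)"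
      using inverse_lin f(2) by blast
    then obtain M where M: "\<And>t. t \<in> J \<Longrightarrow> bounded_linear (M t)"
      "\<And>t u. t \<in> J \<Longrightarrow> M t (u - P (lin (\<zeta> t) u)) = u"
      "\<And>t u. t \<in> J \<Longrightarrow> M t u - P (lin (\<zeta> t) (M t u)) = u" by metis
    have bl2: "bounded_linear (\<lambda>u. u - P (lin (\<zeta> t) u))" for t
      by (intro bounded_linear_sub bounded_linear_ident
          bounded_linear_compose[OF bounded_linear_primitive[OF \<eta>]] bounded_linear_lin)
    show ?case
      unfolding ndiff.simps
    proof (intro exI[of _ "\<lambda>t h. M t (c' t h)"] conjI ballI allI)
      fix t assume t: "t \<in> J"
      show "(\<zeta> has_derivative (\<lambda>h. M t (c' t h))) (at t within J)"
        by (rule has_derivative_of_implicit[OF defect_derivative[OF f(2)[OF t]] f(2) t bspec[OF c'(1) t]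
              M(1)[OF t] M(2)[OF t] defect_expanding[OF f(2)[OF t] f(2)]])
    next
      fix h
      \<comment> \<open>Bootstrapping: order \<open>k\<close> of \<open>\<zeta>\<close> gives order
        \<open>k\<close> of the linearized operator, then of the derivative of
        \<open>\<zeta>\<close> as solution of a linear equation, and thus order \<open>Suc k\<close>
        of \<open>\<zeta>\<close>.\<close>
      have "ndiff k J \<zeta>" using Suc.IH ndiff_Suc_imp[OF Suc.prems] by simp
      then have S: "ndiff k J (\<lambda>t. Blinfun (\<lambda>u. u - P (lin (\<zeta> t) u)))"
        using f(2) by (rule ndiff_lin)
      show "ndiff k J (\<lambda>t. M t (c' t h))"
      proof (rule ndiff_solve[OF S spec[OF c'(2), of h]])
        fix t assume t: "t \<in> J"
        show "Blinfun (\<lambda>u. u - P (lin (\<zeta> t) u)) (M t (c' t h)) = c' t h"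
          by (simp add: bounded_linear_Blinfun_apply[OF bl2] M(3)[OF t])
        show "\<exists>M. bounded_linear M \<and> (\<forall>u. M (Blinfun (\<lambda>u. u - P (lin (\<zeta> t) u)) u) = u)
          \<and> (\<forall>u. Blinfun (\<lambda>u. u - P (lin (\<zeta> t) u)) (M u) = u)"
          using M[OF t] by (auto simp: bounded_linear_Blinfun_apply[OF bl2])
      qed
    qed
  qed simp
  then have "ndiff k J (\<lambda>t. \<zeta> t s)" by (rule ndiff_linear_compose[OF bounded_linear_apply_bcontfun])
  then show ?thesis by (rule ndiff_cong[rotated]) (simp add: f clip_eq[OF s])
qed

end

text \<open>A summary of the results of the locale in terms of \<open>V\<close>, \<open>K\<close>
  and \<open>\<eta>\<close> alone; the auxiliary \<open>G\<close> and \<open>L\<close> disappear. It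
  speaks about given solutions and asserts no existence.\<close>

definition smoothly_determined :: "('f::real_normed_vector \<Rightarrow> 'f) \<Rightarrow> 'f set \<Rightarrow> real \<Rightarrow> bool" where
  "smoothly_determined V K \<eta> \<longleftrightarrow>
     (\<forall>z z'. ode_solution V K \<eta> z \<longrightarrow> ode_solution V K \<eta> z' \<longrightarrow> z 0 = z' 0 \<longrightarrow> (\<forall>s\<in>{-\<eta>..\<eta>}. z s = z' s)) \<and>
     (\<forall>(J::real set) Z k. (\<forall>t\<in>J. ode_solution V K \<eta> (Z t)) \<longrightarrow> ndiff k J (\<lambda>t. Z t 0) \<longrightarrow>
       (\<forall>s\<in>{-\<eta>..\<eta>}. ndiff k J (\<lambda>t. Z t s)))"

proposition ode_local:
  fixes V :: "'f::euclidean_space \<Rightarrow> 'f"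
  assumes W: "open W" "z0 \<in> W" and V: "smooth_within W V"
  obtains r \<eta> B where "r > 0" "\<eta> > 0" "cball z0 r \<subseteq> W" "\<forall>y\<in>cball z0 r. norm (V y) \<le> B"
    "\<eta> * B < r / 2" "smoothly_determined V (cball z0 r) \<eta>"
proof -
  obtain r where r: "r > 0" "cball z0 r \<subseteq> W" using W open_contains_cball by blast
  obtain G where G: "\<And>x. x \<in> W \<Longrightarrow> (V has_derivative blinfun_apply (G x)) (at x)"
    "\<And>v. smooth_within W (\<lambda>x. G x v)"
    using smooth_within_open_derivative[OF W(1) V] by blast
  have bdd: "\<exists>B\<ge>0. \<forall>x\<in>cball z0 r. norm (f x) \<le> B" if "continuous_on (cball z0 r) f"
    for f :: "'f \<Rightarrow> 'x::real_normed_vector"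
  proof -
    have "bounded (f ` cball z0 r)"
      by (rule compact_imp_bounded[OF compact_continuous_image[OF that compact_cball]])
    then show ?thesis unfolding bounded_pos by (auto intro: less_imp_le)
  qed
  have "continuous_on (cball z0 r) G"
    using ndiff_imp_continuous_on[of 0 W "\<lambda>x. G x _"] G(2) r(2) continuous_on_subset
    by (intro continuous_on_blinfun_componentwise) blast
  from bdd[OF this] obtain L where L: "L \<ge> 0" "\<forall>x\<in>cball z0 r. norm (G x) \<le> L" by blast
  have "continuous_on (cball z0 r) V"
    using ndiff_imp_continuous_on[of 0 W V] V r(2) continuous_on_subset by blast
  from bdd[OF this] obtain B where B: "B \<ge> 0" "\<forall>x\<in>cball z0 r. norm (V x) \<le> B" by blast
  note LB = L(1) B(1)
  \<comment> \<open>The first bound makes the integral operator a contraction. The second gives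
    \<open>\<eta> * B < r / 2\<close>, so that a curve of speed at most \<open>B\<close> starting
    within \<open>r / 2\<close> of \<open>z0\<close> cannot leave \<open>cball z0 r\<close>. Adding
    \<open>1\<close> avoids division by \<open>0\<close>.\<close>
  define \<eta> where "\<eta> = min (1 / (6 * (L + 1))) (r / (4 * (B + 1)))"
  have \<eta>: "\<eta> > 0" using LB r(1) by (auto simp: \<eta>_def)
  have "\<eta> * (6 * (L + 1)) \<le> 1 / (6 * (L + 1)) * (6 * (L + 1))"
    using LB by (intro mult_right_mono) (auto simp: \<eta>_def)
  then have "3 * \<eta> * L \<le> 1 / 2" using LB \<eta> by (simp add: algebra_simps)
  have "\<eta> * (4 * (B + 1)) \<le> r / (4 * (B + 1)) * (4 * (B + 1))"
    using LB by (intro mult_right_mono) (auto simp: \<eta>_def)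
  moreover have "r / (4 * (B + 1)) * (4 * (B + 1)) = r" using LB by simp
  ultimately have "\<eta> * B < r / 2" using LB \<eta> r(1) by (simp add: algebra_simps)
  interpret short_time V W "cball z0 r" \<eta> L G
    by unfold_locales (use W V G L LB r \<eta> \<open>3 * \<eta> * L \<le> 1 / 2\<close> in auto)
  show thesis
  proof (rule that[OF r(1) \<eta> r(2) _ \<open>\<eta> * B < r / 2\<close>])
    show "\<forall>y\<in>cball z0 r. norm (V y) \<le> B" by (rule B(2))
    show "smoothly_determined V (cball z0 r) \<eta>"
      unfolding smoothly_determined_def
    proof (intro conjI allI impI ballI)
      show "z s = z' s" if "ode_solution V (cball z0 r) \<eta> z" "ode_solution V (cball z0 r) \<eta> z'"
        "z 0 = z' 0" "s \<in> {-\<eta>..\<eta>}" for z z' s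
        using that by (rule solution_unique)
      fix J :: "real set" and Z k s
      assume "\<forall>t\<in>J. ode_solution V (cball z0 r) \<eta> (Z t)" and k: "ndiff k J (\<lambda>t. Z t 0)" and s: "s \<in> {-\<eta>..\<eta>}"
      then have "ode_solution V (cball z0 r) \<eta> (Z t)" if "t \<in> J" for t using that by blast
      from ndiff_solution[OF this k s] show "ndiff k J (\<lambda>t. Z t s)" .
    qed
  qed
qed

section \<open>The geodesic spray\<close>

definition tangent_bundle :: "('a, 'e::euclidean_space) chart set \<Rightarrow> ('a \<times> ('a, 'e) tvec) set" where
  "tangent_bundle A = {v. snd v \<in> tangent_space A (fst v)}"

definition phase :: "('a, 'e::euclidean_space) chart \<Rightarrow> 'a \<times> ('a, 'e) tvec \<Rightarrow> 'e \<times> 'e" where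
  "phase c v = (snd c (fst v), snd v c)"

definition spray :: "('a, 'e::euclidean_space) chart set \<Rightarrow> ('a, 'e) metric \<Rightarrow> ('a, 'e) chart \<Rightarrow>
    'e \<times> 'e \<Rightarrow> 'e \<times> 'e" where
  "spray A g c p = (snd p, - christoffel A g c (fst p) (snd p) (snd p))"

lemma bilinear_sum_Basis:
  fixes B :: "'e::euclidean_space \<Rightarrow> 'e \<Rightarrow> 'b::real_vector"
  assumes "bilinear B"
  shows "B u v = (\<Sum>i\<in>Basis. \<Sum>j\<in>Basis. ((u \<bullet> i) * (v \<bullet> j)) *\<^sub>R B i j)"
proof -
  have l: "linear (\<lambda>x. B x y)" "linear (B x)" for x y using assms by (auto simp: bilinear_def)
  have "B u v = (\<Sum>i\<in>Basis. (u \<bullet> i) *\<^sub>R B i v)" by (rule linear_eq_sum_Basis[OF l(1)])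
  also have "\<dots> = (\<Sum>i\<in>Basis. (u \<bullet> i) *\<^sub>R (\<Sum>j\<in>Basis. (v \<bullet> j) *\<^sub>R B i j))"
    by (subst linear_eq_sum_Basis[OF l(2)]) simp
  finally show ?thesis by (simp add: scaleR_sum_right)
qed

context
  fixes A :: "('a::{t2_space, second_countable_topology}, 'e::euclidean_space) chart set"
    and g :: "('a, 'e) metric" and c :: "('a, 'e) chart"
  assumes atlas: "smooth_atlas A" and metric: "riemannian_metric A g" and c: "c \<in> A"
begin

private abbreviation "U \<equiv> snd c ` fst c"
private abbreviation "m \<equiv> local_metric A g c"
private abbreviation "Dm x u v \<equiv> frechet_derivative (\<lambda>y. m y u v) (at x)"

private lemma open_U: "open U" using atlas c by (simp add: smooth_atlas_def)

private lemma m_bilinear: "x \<in> U \<Longrightarrow> bilinear (m x)"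
  and m_pos: "x \<in> U \<Longrightarrow> u \<noteq> 0 \<Longrightarrow> m x u u > 0"
  and m_smooth: "smooth_on U (\<lambda>x. m x u v)"
  using metric c by (auto simp: riemannian_metric_def)

private lemma m_derivative: "x \<in> U \<Longrightarrow> ((\<lambda>y. m y u v) has_derivative Dm x u v) (at x)"
  by (rule smooth_on_derivative(1)[OF m_smooth])

text \<open>Each value of the metric is the finite sum of its bilinear expansion on the open set
  \<open>U\<close>; differentiating the sum and uniqueness of the derivative carry bilinearity over
  to \<open>Dm\<close>.\<close>

private lemma Dm_bilinear:
  assumes x: "x \<in> U"
  shows "Dm x u v w = (\<Sum>i\<in>Basis. \<Sum>j\<in>Basis. ((u \<bullet> i) * (v \<bullet> j)) *\<^sub>R Dm x i j w)"
proof -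
  have "((\<lambda>y. \<Sum>i\<in>Basis. \<Sum>j\<in>Basis. ((u \<bullet> i) * (v \<bullet> j)) *\<^sub>R m y i j) has_derivative
     (\<lambda>w. \<Sum>i\<in>Basis. \<Sum>j\<in>Basis. ((u \<bullet> i) * (v \<bullet> j)) *\<^sub>R Dm x i j w)) (at x)"
    by (intro has_derivative_sum has_derivative_scaleR_right m_derivative[OF x])
  then have "((\<lambda>y. m y u v) has_derivative
     (\<lambda>w. \<Sum>i\<in>Basis. \<Sum>j\<in>Basis. ((u \<bullet> i) * (v \<bullet> j)) *\<^sub>R Dm x i j w)) (at x)"
    by (rule has_derivative_transform_within_open[OF _ open_U x])
      (erule bilinear_sum_Basis[OF m_bilinear, symmetric])
  from fun_cong[OF has_derivative_unique[OF m_derivative[OF x] this]] show ?thesis .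
qed

text \<open>The right side of the Koszul formula for two equal fields \<open>v\<close>, the only
  case that the geodesic equation involves.\<close>

private definition koszul :: "'e \<Rightarrow> 'e \<Rightarrow> 'e \<Rightarrow> real" where
  "koszul x v w = (Dm x v w v + Dm x v w v - Dm x v v w) / 2"

private lemma linear_koszul:
  assumes x: "x \<in> U" shows "linear (koszul x v)"
proof -
  have eq: "koszul x v w = (\<Sum>i\<in>Basis. \<Sum>j\<in>Basis. ((v \<bullet> i) * (w \<bullet> j)) *\<^sub>R Dm x i j v) - Dm x v v w / 2" for w
    by (simp add: koszul_def Dm_bilinear[OF x, of v w v])
  have D: "linear (Dm x v v)" using m_derivative[OF x] has_derivative_linear by blast
  show ?thesis
    by (rule linearI) (simp_all add: eq linear_add[OF D] linear_cmul[OF D] inner_add_left algebra_simps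
      sum.distrib sum_distrib_left add_divide_distrib)
qed

text \<open>The operator representing the metric with respect to the Euclidean inner product. In
  this form its smooth dependence on \<open>x\<close>, in operator norm, can be read off.\<close>

private definition gram :: "'e \<Rightarrow> 'e \<Rightarrow>\<^sub>L 'e" where
  "gram x = (\<Sum>i\<in>Basis. \<Sum>j\<in>Basis. m x i j *\<^sub>R Blinfun (\<lambda>z. (z \<bullet> i) *\<^sub>R j))"

private lemma gram_inner:
  assumes x: "x \<in> U" and b: "b \<in> Basis" shows "gram x z \<bullet> b = m x z b"
proof -
  have bl: "bounded_linear (\<lambda>z::'e. (z \<bullet> i) *\<^sub>R (j::'e))" for i j
    by (intro bounded_linear_scaleR_const bounded_linear_inner_left)
  have "gram x z \<bullet> b = (\<Sum>i\<in>Basis. \<Sum>j\<in>Basis. m x i j * (z \<bullet> i) * (j \<bullet> b))"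
    by (simp add: gram_def blinfun.sum_left blinfun.scaleR_left bounded_linear_Blinfun_apply[OF bl] inner_sum_left
         mult.assoc)
  also have "\<dots> = (\<Sum>i\<in>Basis. m x i b * (z \<bullet> i))"
    using b by (intro sum.cong refl) (simp add: inner_Basis if_distrib cong: if_cong)
  also have "\<dots> = m x z b"
    using linear_eq_sum_Basis[of "\<lambda>z. m x z b" z] m_bilinear[OF x] by (simp add: bilinear_def mult.commute)
  finally show ?thesis .
qed

text \<open>A kernel vector \<open>z\<close> satisfies \<open>m x z z = 0\<close>, which positive
  definiteness excludes unless \<open>z = 0\<close>.\<close>

private lemma inj_gram:
  assumes x: "x \<in> U" shows "inj (gram x)"
proof (rule linear_injective_0[THEN iffD2], rule blinfun.bounded_linear_right[THEN bounded_linear.linear], intro allI impI)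
  fix z assume "gram x z = 0"
  then have 0: "m x z b = 0" if "b \<in> Basis" for b using gram_inner[OF x that, of z] by simp
  have "m x z z = (\<Sum>b\<in>Basis. (z \<bullet> b) *\<^sub>R m x z b)"
    using m_bilinear[OF x] by (intro linear_eq_sum_Basis) (simp add: bilinear_def)
  then show "z = 0" using m_pos[OF x, of z] 0 by auto
qed

private lemma gram_inverse:
  assumes x: "x \<in> U"
  shows "\<exists>M. bounded_linear M \<and> (\<forall>u. M (gram x u) = u) \<and> (\<forall>u. gram x (M u) = u)"
proof -
  have l: "linear (gram x)" by (rule blinfun.bounded_linear_right[THEN bounded_linear.linear])
  obtain M where "linear M" "\<forall>u. M (gram x u) = u" "\<forall>u. gram x (M u) = u"
    using linear_injective_isomorphism[OF l inj_gram[OF x]] by blast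
  then show ?thesis using linear_conv_bounded_linear by blast
qed

text \<open>Replaces the definite description in \<open>christoffel\<close> by a linear equation
  with invertible coefficient. Smoothness in base point and vector then follows from
  \<open>ndiff_solve\<close>, without inverting a matrix explicitly.\<close>

private lemma gram_christoffel:
  assumes x: "x \<in> U"
  shows "gram x (christoffel A g c x v v) = (\<Sum>b\<in>Basis. koszul x v b *\<^sub>R b)"
proof -
  have K: "koszul x v w = (\<Sum>b\<in>Basis. (w \<bullet> b) *\<^sub>R koszul x v b)" for w
    by (rule linear_eq_sum_Basis[OF linear_koszul[OF x]])
  have mK: "m x z w = (\<Sum>b\<in>Basis. (w \<bullet> b) *\<^sub>R m x z b)" for z w
    using m_bilinear[OF x] by (intro linear_eq_sum_Basis) (simp add: bilinear_def)
  have iff: "(\<forall>w. m x z w = koszul x v w) \<longleftrightarrow> gram x z = (\<Sum>b\<in>Basis. koszul x v b *\<^sub>R b)" for z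
  proof
    assume *: "\<forall>w. m x z w = koszul x v w"
    show "gram x z = (\<Sum>b\<in>Basis. koszul x v b *\<^sub>R b)"
      by (rule euclidean_eqI) (simp add: gram_inner[OF x] *)
  next
    assume *: "gram x z = (\<Sum>b\<in>Basis. koszul x v b *\<^sub>R b)"
    have "m x z b = koszul x v b" if "b \<in> Basis" for b
      using gram_inner[OF x that, of z] * that by simp
    then show "\<forall>w. m x z w = koszul x v w" by (subst K, subst mK) simp
  qed
  obtain M where M: "\<And>u. gram x (M u) = u" using gram_inverse[OF x] by blast
  have "\<exists>!z. \<forall>w. m x z w = koszul x v w"
    unfolding iff
  proof (rule ex1I)
    show "gram x (M (\<Sum>b\<in>Basis. koszul x v b *\<^sub>R b)) = (\<Sum>b\<in>Basis. koszul x v b *\<^sub>R b)" by (rule M)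
  qed (rule injD[OF inj_gram[OF x]], simp only: M)
  then have "\<forall>w. m x (THE z. \<forall>w. m x z w = koszul x v w) w = koszul x v w" by (rule theI')
  moreover have "christoffel A g c x v v = (THE z. \<forall>w. m x z w = koszul x v w)"
    by (simp only: christoffel_def koszul_def)
  ultimately show ?thesis using iff by simp
qed

lemma smooth_spray: "smooth_within (U \<times> UNIV) (spray A g c)"
proof
  fix k
  have f: "ndiff k (U \<times> UNIV) (\<lambda>p. h (fst p))" if "ndiff k U h" for h :: "'e \<Rightarrow> 'x::real_normed_vector"
    by (rule ndiff_compose[OF ndiff_linear[OF bounded_linear_fst] that]) auto
  have s: "ndiff k (U \<times> UNIV) (\<lambda>p. snd p \<bullet> (b::'e))" for b
    by (rule ndiff_linear) (intro bounded_linear_compose[OF bounded_linear_inner_left bounded_linear_snd])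
  have "ndiff k U gram"
    unfolding gram_def[abs_def]
    by (intro ndiff_sum ndiff_scaleR smooth_on_imp_smooth_within[OF m_smooth] ndiff_const)
  then have G: "ndiff k (U \<times> UNIV) (\<lambda>p. gram (fst p))" by (rule f)
  have D: "ndiff k (U \<times> UNIV) (\<lambda>p. Dm (fst p) i j b)" for i j b
    by (rule f) (rule smooth_on_imp_smooth_within[OF smooth_on_derivative(2)[OF m_smooth]])
  \<comment> \<open>Smoothness of \<open>Dm\<close> in \<open>x\<close> is available for fixed
    vectors only; expanding all three arguments over \<open>Basis\<close> leaves a polynomial in the
    coordinates of \<open>v\<close> with coefficients smooth in \<open>x\<close>.\<close>
  have expand: "koszul x v b = ((\<Sum>i\<in>Basis. \<Sum>j\<in>Basis. ((v \<bullet> i) *\<^sub>R (b \<bullet> j) *\<^sub>R (\<Sum>l\<in>Basis. (v \<bullet> l) *\<^sub>R Dm x i j l)))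
      - (1 / 2) *\<^sub>R (\<Sum>i\<in>Basis. \<Sum>j\<in>Basis. ((v \<bullet> i) *\<^sub>R (v \<bullet> j) *\<^sub>R Dm x i j b)))" if x: "x \<in> U" for x v b
  proof -
    have "(\<Sum>l\<in>Basis. (v \<bullet> l) *\<^sub>R Dm x i j l) = Dm x i j v" for i j
      using has_derivative_linear[OF m_derivative[OF x]] by (rule linear_eq_sum_Basis[symmetric])
    then show ?thesis
      unfolding koszul_def Dm_bilinear[OF x, of v b v] Dm_bilinear[OF x, of v v b] by (simp add: mult.assoc)
  qed
  have kz: "ndiff k (U \<times> UNIV) (\<lambda>p. koszul (fst p) (snd p) b)" for b
    by (rule ndiff_cong[rotated, where f="\<lambda>p. (\<Sum>i\<in>Basis. \<Sum>j\<in>Basis. ((snd p \<bullet> i) *\<^sub>R (b \<bullet> j) *\<^sub>R (\<Sum>l\<in>Basis. (snd p \<bullet> l) *\<^sub>R Dm (fst p) i j l)))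
      - (1 / 2) *\<^sub>R (\<Sum>i\<in>Basis. \<Sum>j\<in>Basis. ((snd p \<bullet> i) *\<^sub>R (snd p \<bullet> j) *\<^sub>R Dm (fst p) i j b))"])
      (intro ndiff_diff ndiff_sum ndiff_scaleR s D ndiff_const, rule expand[symmetric], auto)
  have R: "ndiff k (U \<times> UNIV) (\<lambda>p. \<Sum>b\<in>Basis. koszul (fst p) (snd p) b *\<^sub>R b)"
    by (intro ndiff_sum ndiff_scaleR kz ndiff_const)
  have "ndiff k (U \<times> UNIV) (\<lambda>p. christoffel A g c (fst p) (snd p) (snd p))"
    by (rule ndiff_solve[OF G R]) (auto simp: gram_christoffel gram_inverse)
  then show "ndiff k (U \<times> UNIV) (spray A g c)"
    unfolding spray_def[abs_def] by (intro ndiff_Pair[OF ndiff_linear[OF bounded_linear_snd]] ndiff_minus)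
qed

end

section \<open>Translation in time\<close>

lemma has_vector_derivative_shift:
  fixes f :: "real \<Rightarrow> 'b::real_normed_vector"
  shows
  "((\<lambda>s. f (s + a)) has_vector_derivative d) (at s) \<longleftrightarrow> (f has_vector_derivative d) (at (s + a))"
proof -
  have sh: "((\<lambda>s. h (s + b)) has_vector_derivative d) (at r)" if "(h has_vector_derivative d) (at (r + b))"
    for h :: "real \<Rightarrow> 'b" and b r
  proof -
    have "((\<lambda>s. s + b) has_vector_derivative 1) (at r)" by (auto intro!: derivative_eq_intros)
    from vector_diff_chain_at[OF this that] show ?thesis by (simp add: o_def)
  qed
  show ?thesis
    using sh[of "\<lambda>s. f (s + a)" "s + a" "-a"] sh[of f s a] by auto
qed

lemma vector_derivative_shift:
  "vector_derivative (\<lambda>s. f (s + a)) (at s) = vector_derivative f (at (s + a))"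
  unfolding vector_derivative_def has_vector_derivative_shift ..

lemma geodesic_shift:
  assumes "geodesic A g \<sigma>" shows "geodesic A g (\<lambda>s. \<sigma> (s + a))"
proof -
  have comp: "snd c \<circ> (\<lambda>s. \<sigma> (s + a)) = (\<lambda>s. (snd c \<circ> \<sigma>) (s + a))" for c :: "('a, 'b) chart"
    by auto
  have "continuous_on UNIV (\<lambda>s. \<sigma> (s + a))"
    using assms unfolding geodesic_def
    by (elim conjE continuous_on_compose2[of UNIV \<sigma>]) (auto intro: continuous_intros)
  moreover have "(\<lambda>s. f (s + a)) differentiable (at s)" if "f differentiable (at (s + a))" for f :: "real \<Rightarrow> 'b" and s
    using that has_vector_derivative_shift[of f a _ s] vector_derivative_works differentiableI_vector by blast
  ultimately show ?thesis
    using assms has_vector_derivative_shift[of "\<lambda>r. vector_derivative (snd c \<circ> \<sigma>) (at r)" a for c]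
    unfolding geodesic_def comp vector_derivative_shift by blast
qed

lemma velocity_shift: "velocity A (\<lambda>s. \<sigma> (s + a)) s = velocity A \<sigma> (s + a)"
proof -
  have comp: "snd c \<circ> (\<lambda>s. \<sigma> (s + a)) = (\<lambda>s. (snd c \<circ> \<sigma>) (s + a))" for c :: "('a, 'b) chart"
    by auto
  show ?thesis unfolding velocity_def comp vector_derivative_shift ..
qed

text \<open>Real induction, by the supremum of the initial segments on which \<open>Q\<close> holds.
  It is meant for trapping a curve in a ball, where \<open>step\<close> is openness and
  \<open>lim\<close> a closedness argument.\<close>

lemma interval_induction:
  fixes Q :: "real \<Rightarrow> bool"
  assumes "Q 0" and step: "\<And>u. 0 \<le> u \<Longrightarrow> u < 1 \<Longrightarrow> (\<forall>v\<in>{0..u}. Q v) \<Longrightarrow> \<exists>d>0. \<forall>v\<in>{u..u + d}. Q v"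
    and lim: "\<And>u. 0 < u \<Longrightarrow> u \<le> 1 \<Longrightarrow> (\<forall>v\<in>{0..<u}. Q v) \<Longrightarrow> Q u"
    and "u \<in> {0..1}"
  shows "Q u"
proof -
  define S where "S = {u\<in>{0..1}. \<forall>v\<in>{0..u}. Q v}"
  have S0: "0 \<in> S" using \<open>Q 0\<close> by (auto simp: S_def)
  have bdd: "bdd_above S" by (rule bdd_aboveI[of _ 1]) (auto simp: S_def)
  define s where "s = Sup S"
  have s: "0 \<le> s" "s \<le> 1"
    unfolding s_def
  proof -
    show "0 \<le> Sup S" by (rule cSup_upper[OF S0 bdd])
    have "S \<noteq> {}" using S0 by blast
    then show "Sup S \<le> 1" by (rule cSup_least) (simp add: S_def)
  qed
  have lt: "Q v" if "v \<in> {0..<s}" for v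
  proof -
    have "v < Sup S" using that by (simp add: s_def)
    then obtain w where "w \<in> S" "v < w" using less_cSupD[of S v] S0 by blast
    then show ?thesis using that by (auto simp: S_def)
  qed
  have "Q s" using lim[of s] lt s \<open>Q 0\<close> by (cases "s = 0") auto
  then have all: "\<forall>v\<in>{0..s}. Q v" using lt by (auto simp: le_less)
  have "s = 1"
  proof (rule ccontr)
    assume "s \<noteq> 1"
    with s have "s < 1" by simp
    then obtain d where d: "d > 0" "\<forall>v\<in>{s..s + d}. Q v" using step s all by blast
    \<comment> \<open>The step is cut off at \<open>1 - s\<close> because \<open>S\<close> contains
      only points of \<open>{0..1}\<close>.\<close>
    have "Q v" if "v \<in> {0..s + min d (1 - s)}" for v
      using that all d by (cases "v \<le> s") auto
    then have "s + min d (1 - s) \<in> S"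
      using d \<open>s < 1\<close> s by (auto simp: S_def)
    then have "s + min d (1 - s) \<le> s" unfolding s_def by (rule cSup_upper[OF _ bdd])
    with d \<open>s < 1\<close> show False by simp
  qed
  with all \<open>u \<in> {0..1}\<close> show ?thesis by auto
qed

text \<open>By \<open>loc\<close> the truth value of \<open>P\<close> is locally constant, so
  \<open>P\<close> and its negation define open sets, and the line is connected.\<close>

lemma real_local_induction:
  fixes P :: "real \<Rightarrow> bool"
  assumes "P a" and loc: "\<And>s. \<exists>\<delta>>0. \<forall>r r'. \<bar>r - s\<bar> < \<delta> \<longrightarrow> \<bar>r' - s\<bar> < \<delta> \<longrightarrow> P r \<longrightarrow> P r'"
  shows "P b"
proof -
  have iff: "\<exists>\<delta>>0. \<forall>r. dist r s < \<delta> \<longrightarrow> (P r \<longleftrightarrow> P s)" for s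
  proof -
    obtain \<delta> where "\<delta> > 0" "\<And>r r'. \<bar>r - s\<bar> < \<delta> \<Longrightarrow> \<bar>r' - s\<bar> < \<delta> \<Longrightarrow> P r \<Longrightarrow> P r'"
      using loc[of s] by blast
    then show ?thesis by (intro exI[of _ \<delta>]) (simp add: dist_real_def, metis abs_zero diff_self)
  qed
  have "open {s. Q (P s)}" for Q
    unfolding open_dist
  proof
    fix s assume s: "s \<in> {s. Q (P s)}"
    obtain \<delta> where \<delta>: "\<delta> > 0" "\<And>r. dist r s < \<delta> \<Longrightarrow> P r \<longleftrightarrow> P s" using iff[of s] by blast
    have "r \<in> {s. Q (P s)}" if "dist r s < \<delta>" for r
      using s unfolding mem_Collect_eq \<delta>(2)[OF that] .
    with \<delta>(1) show "\<exists>\<delta>>0. \<forall>r. dist r s < \<delta> \<longrightarrow> r \<in> {s. Q (P s)}" by blast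
  qed
  from this[of "\<lambda>b. b"] this[of Not] have "open {s. P s}" "open (- {s. P s})"
    by (simp_all add: Collect_neg_eq)
  then have "{s. P s} = {} \<or> {s. P s} = UNIV"
    using connectedD[OF connected_UNIV, of "{s. P s}" "- {s. P s}"] by auto
  with \<open>P a\<close> show ?thesis by auto
qed

section \<open>Uniqueness of geodesics\<close>

locale riemannian =
  fixes A :: "('a::{t2_space, second_countable_topology}, 'e::euclidean_space) chart set"
    and g :: "('a, 'e) metric"
  assumes atlas: "smooth_atlas A" and metric: "riemannian_metric A g"
begin

abbreviation "TB \<equiv> tangent_bundle A"

abbreviation "lift \<sigma> s \<equiv> (\<sigma> s, velocity A \<sigma> s)"

section \<open>Charts and tangent vectors\<close>

lemma chart_cover: obtains c where "c \<in> A" "p \<in> fst c"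
proof -
  have "p \<in> (\<Union>c\<in>A. fst c)" using atlas by (simp add: smooth_atlas_def)
  then show thesis using that by blast
qed

lemma open_chart: "c \<in> A \<Longrightarrow> open (fst c)"
  and open_chart_image: "c \<in> A \<Longrightarrow> open (snd c ` fst c)"
  and chart_homeomorphism: "c \<in> A \<Longrightarrow> homeomorphism (fst c) (snd c ` fst c) (snd c) (inv_into (fst c) (snd c))"
  and transition_smooth: "c \<in> A \<Longrightarrow> c' \<in> A \<Longrightarrow> smooth_on (snd c ` (fst c \<inter> fst c')) (transition c c')"
  using atlas by (auto simp: smooth_atlas_def)

lemma continuous_on_chart_inverse: "c \<in> A \<Longrightarrow> continuous_on (snd c ` fst c) (inv_into (fst c) (snd c))"
  and chart_inverse: "c \<in> A \<Longrightarrow> p \<in> fst c \<Longrightarrow> inv_into (fst c) (snd c) (snd c p) = p"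
  using chart_homeomorphism[of c] by (auto simp: homeomorphism_def)

lemma chart_inj: "c \<in> A \<Longrightarrow> p \<in> fst c \<Longrightarrow> q \<in> fst c \<Longrightarrow> snd c p = snd c q \<Longrightarrow> p = q"
  using chart_inverse by metis

lemma transition_apply: "c \<in> A \<Longrightarrow> p \<in> fst c \<Longrightarrow> transition c c' (snd c p) = snd c' p"
  by (simp add: transition_def chart_inverse)

lemma transition_derivative:
  assumes "c \<in> A" "c' \<in> A" "p \<in> fst c" "p \<in> fst c'"
  shows "(transition c c' has_derivative frechet_derivative (transition c c') (at (snd c p))) (at (snd c p))"
  using smooth_on_derivative(1)[OF transition_smooth[OF assms(1,2)]] assms(3,4) by blast

lemma tangent_transition:
  assumes "X \<in> tangent_space A p" "c \<in> A" "c' \<in> A" "p \<in> fst c" "p \<in> fst c'"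
  shows "X c' = frechet_derivative (transition c c') (at (snd c p)) (X c)"
  using assms unfolding tangent_space_def by blast

lemma tangent_eqI:
  assumes "X \<in> tangent_space A p" "Y \<in> tangent_space A p" "c \<in> A" "p \<in> fst c" "X c = Y c"
  shows "X = Y"
proof
  fix c'
  show "X c' = Y c'"
  proof (cases "c' \<in> A \<and> p \<in> fst c'")
    case True
    then have c': "c' \<in> A" "p \<in> fst c'" by simp_all
    show ?thesis
      unfolding tangent_transition[OF assms(1,3) c'(1) assms(4) c'(2)]
        tangent_transition[OF assms(2,3) c'(1) assms(4) c'(2)] assms(5) ..
  next
    case False
    then have "X c' = 0" "Y c' = 0" using assms(1,2) unfolding tangent_space_def by blast+
    then show ?thesis by simp
  qed
qed

lemma tangent_bundle_eqI:
  assumes "v \<in> TB" "w \<in> TB" "c \<in> A" "fst v \<in> fst c" "fst w \<in> fst c"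
    "phase c v = phase c w"
  shows "v = w"
proof -
  have p: "fst v = fst w" using assms chart_inj[of c] by (simp add: phase_def)
  have "snd v = snd w"
    using assms p by (intro tangent_eqI[of _ "fst v" _ c]) (simp_all add: phase_def tangent_bundle_def)
  with p show ?thesis by (rule prod_eqI)
qed

section \<open>A single geodesic in coordinates\<close>

context
  fixes \<sigma> assumes geo: "geodesic A g \<sigma>"
begin

lemma geodesic_continuous: "continuous_on UNIV \<sigma>"
  using geo unfolding geodesic_def by blast

lemma geodesic_open_vimage: "open U \<Longrightarrow> open (\<sigma> -` U)"
  using geodesic_continuous open_vimage by blast

lemma geodesic_coord_derivative:
  assumes "c \<in> A" "\<sigma> s \<in> fst c"
  shows "((snd c \<circ> \<sigma>) has_vector_derivative velocity A \<sigma> s c) (at s)"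
  using geo assms unfolding geodesic_def by (simp add: velocity_def vector_derivative_works)

text \<open>Near \<open>s\<close> the curve in the chart \<open>c'\<close> is the transition map
  after the curve in \<open>c\<close>, and the chain rule is the transformation law of tangent
  vectors.\<close>

lemma velocity_tangent: "velocity A \<sigma> s \<in> tangent_space A (\<sigma> s)"
  unfolding tangent_space_def mem_Collect_eq
proof (intro conjI ballI allI impI)
  show "velocity A \<sigma> s c = 0" if "\<not> (c \<in> A \<and> \<sigma> s \<in> fst c)" for c
    using that unfolding velocity_def by (rule if_not_P)
next
  fix c c' assume c: "c \<in> A" "c' \<in> A" "\<sigma> s \<in> fst c" "\<sigma> s \<in> fst c'"
  let ?D = "frechet_derivative (transition c c') (at (snd c (\<sigma> s)))"
  have "((snd c \<circ> \<sigma>) has_derivative (\<lambda>h. h *\<^sub>R velocity A \<sigma> s c)) (at s)"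
    using geodesic_coord_derivative[OF c(1,3)] by (simp add: has_vector_derivative_def)
  from diff_chain_at[OF this] transition_derivative[OF c]
  have "(transition c c' \<circ> (snd c \<circ> \<sigma>) has_derivative ?D \<circ> (\<lambda>h. h *\<^sub>R velocity A \<sigma> s c)) (at s)"
    by simp
  then have "(snd c' \<circ> \<sigma> has_derivative ?D \<circ> (\<lambda>h. h *\<^sub>R velocity A \<sigma> s c)) (at s)"
    by (rule has_derivative_transform_within_open[OF _ geodesic_open_vimage[OF open_chart[OF c(1)]]])
      (use c in \<open>simp_all add: transition_apply\<close>)
  then have "((snd c' \<circ> \<sigma>) has_vector_derivative (?D \<circ> (\<lambda>h. h *\<^sub>R velocity A \<sigma> s c)) 1) (at s)"
    by (rule has_derivative_imp_has_vector_derivative)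
  then have "((snd c' \<circ> \<sigma>) has_vector_derivative ?D (velocity A \<sigma> s c)) (at s)" by simp
  from vector_derivative_unique_at[OF this geodesic_coord_derivative[OF c(2,4)]]
  show "velocity A \<sigma> s c' = ?D (velocity A \<sigma> s c)" by simp
qed

lemma velocity_mem: "lift \<sigma> s \<in> TB"
  using velocity_tangent by (simp add: tangent_bundle_def)

lemma geodesic_phase_derivative:
  assumes "c \<in> A" "\<sigma> s \<in> fst c"
  shows "((\<lambda>r. phase c (lift \<sigma> r)) has_vector_derivative
    spray A g c (phase c (lift \<sigma> s))) (at s)"
proof -
  have "((\<lambda>r. vector_derivative (snd c \<circ> \<sigma>) (at r)) has_vector_derivative
           - christoffel A g c (snd c (\<sigma> s)) (velocity A \<sigma> s c) (velocity A \<sigma> s c)) (at s)"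
    using geo assms unfolding geodesic_def by (simp add: velocity_def)
  then have "((\<lambda>r. velocity A \<sigma> r c) has_vector_derivative
           - christoffel A g c (snd c (\<sigma> s)) (velocity A \<sigma> s c) (velocity A \<sigma> s c)) (at s)"
    by (rule has_vector_derivative_transform_within_open[OF _ geodesic_open_vimage[OF open_chart[OF assms(1)]]])
      (use assms in \<open>simp_all add: velocity_def\<close>)
  from has_vector_derivative_Pair[OF geodesic_coord_derivative[OF assms] this]
  show ?thesis by (simp add: phase_def spray_def)
qed

lemma geodesic_phase_continuous:
  assumes "c \<in> A" "\<sigma> s \<in> fst c"
  shows "isCont (\<lambda>r. phase c (lift \<sigma> r)) s"
  using has_vector_derivative_continuous[OF geodesic_phase_derivative[OF assms]] .

lemma geodesic_near:
  assumes "c \<in> A" "\<sigma> s \<in> fst c" "open N" "phase c (lift \<sigma> s) \<in> N"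
  obtains d where "d > 0" "\<And>r. \<bar>r - s\<bar> < d \<Longrightarrow> \<sigma> r \<in> fst c \<and> phase c (lift \<sigma> r) \<in> N"
proof -
  have "eventually (\<lambda>r. phase c (lift \<sigma> r) \<in> N) (nhds s)"
    using geodesic_phase_continuous[OF assms(1,2)] assms(3,4)
    by (auto simp: isCont_def intro!: eventually_nhds_conv_at[THEN iffD2] topological_tendstoD)
  moreover have "eventually (\<lambda>r. \<sigma> r \<in> fst c) (nhds s)"
    using eventually_nhds_in_open[OF geodesic_open_vimage[OF open_chart[OF assms(1)]], of s] assms(2)
    by simp
  ultimately have "eventually (\<lambda>r. \<sigma> r \<in> fst c \<and> phase c (lift \<sigma> r) \<in> N) (nhds s)"
    by (rule eventually_elim2) simp
  then show thesis using that unfolding eventually_nhds_metric dist_real_def by blast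
qed

text \<open>As long as the phase stays in \<open>cball z0 r\<close> its speed is at most
  \<open>B\<close>, so within time \<open>\<eta>\<close> it drifts by less than \<open>r / 2\<close>
  and ends in the open ball, from where it can be continued a little further.\<close>

lemma geodesic_stays:
  assumes c: "c \<in> A" and r: "r > 0" "cball z0 r \<subseteq> snd c ` fst c \<times> UNIV"
    and B: "\<And>y. y \<in> cball z0 r \<Longrightarrow> norm (spray A g c y) \<le> B" and \<eta>: "\<eta> * B < r / 2"
    and init: "\<sigma> 0 \<in> fst c" "phase c (lift \<sigma> 0) \<in> cball z0 (r / 2)"
    and s: "s \<in> {-\<eta>..\<eta>}"
  shows "\<sigma> s \<in> fst c \<and> phase c (lift \<sigma> s) \<in> cball z0 r"
proof -
  define f where "f r = phase c (lift \<sigma> r)" for r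
  \<comment> \<open>The time \<open>s\<close> may be negative; rescaling to \<open>u * s\<close>
    with \<open>u\<close> in \<open>{0..1}\<close> treats both directions at once.\<close>
  define Q where "Q u \<longleftrightarrow> \<sigma> (u * s) \<in> fst c \<and> f (u * s) \<in> cball z0 r" for u
  have B0: "B \<ge> 0" using order_trans[OF norm_ge_zero B[of z0]] r(1) by simp
  have f_cont: "isCont (\<lambda>u. f (u * s)) u" if "\<sigma> (u * s) \<in> fst c" for u
  proof -
    have "isCont f (u * s)" using geodesic_phase_continuous[OF c that] by (simp add: f_def[abs_def])
    moreover have "isCont (\<lambda>u. u * s) u" by (intro continuous_intros)
    ultimately show ?thesis using isCont_o2[of u "\<lambda>u. u * s" f] by simp
  qed
  have \<sigma>_cont: "continuous_on UNIV (\<lambda>u. \<sigma> (u * s))"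
    by (rule continuous_on_compose2[OF geodesic_continuous]) (auto intro: continuous_intros)
  have "Q 1"
  proof (rule interval_induction)
    show "Q 0" using init r(1) by (auto simp: Q_def f_def)
  next
    fix u :: real assume u: "0 \<le> u" "u < 1" and all: "\<forall>v\<in>{0..u}. Q v"
    have d: "((\<lambda>v. f (v * s)) has_vector_derivative s *\<^sub>R spray A g c (f (v * s))) (at v within {0..u})"
      if "v \<in> {0..u}" for v
    proof -
      have "\<sigma> (v * s) \<in> fst c" using all that by (auto simp: Q_def)
      then have 2: "(f has_vector_derivative spray A g c (f (v * s))) (at (v * s))"
        using geodesic_phase_derivative[OF c] by (simp add: f_def[abs_def])
      have "((\<lambda>v. v * s) has_vector_derivative s) (at v)" by (auto intro!: derivative_eq_intros)
      from vector_diff_chain_at[OF this 2] show ?thesis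
        by (auto simp: o_def intro: has_vector_derivative_at_within)
    qed
    have "norm (f (u * s) - f (0 * s)) \<le> (\<eta> * B) * norm (u - 0)"
    proof (rule differentiable_bound[where S="{0..u}" and f'="\<lambda>v h. h *\<^sub>R (s *\<^sub>R spray A g c (f (v * s)))"])
      show "onorm (\<lambda>h. h *\<^sub>R (s *\<^sub>R spray A g c (f (v * s)))) \<le> \<eta> * B" if "v \<in> {0..u}" for v
      proof (rule onorm_le)
        fix h :: real
        have "norm (spray A g c (f (v * s))) \<le> B" using all that by (intro B) (auto simp: Q_def)
        then have "\<bar>s\<bar> * norm (spray A g c (f (v * s))) \<le> \<eta> * B"
          using s B0 by (intro mult_mono) auto
        then show "norm (h *\<^sub>R (s *\<^sub>R spray A g c (f (v * s)))) \<le> \<eta> * B * norm h"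
          using mult_left_mono[of _ _ "\<bar>h\<bar>"] by (simp add: mult.assoc abs_mult mult.commute[of _ "\<bar>h\<bar>"])
      qed
    qed (use u d in \<open>auto simp: has_vector_derivative_def\<close>)
    also have "\<dots> \<le> (\<eta> * B) * 1" using u s B0 by (intro mult_left_mono) auto
    finally have "dist (f (u * s)) (f 0) < r / 2" using \<eta> by (simp add: dist_norm)
    moreover have "dist (f 0) z0 \<le> r / 2" using init by (simp add: f_def dist_commute)
    ultimately have "dist (f (u * s)) z0 < r" using dist_triangle[of "f (u * s)" z0 "f 0"] by linarith
    then have in_ball: "f (u * s) \<in> ball z0 r" by (simp add: dist_commute)
    have "\<sigma> (u * s) \<in> fst c" using all u by (auto simp: Q_def)
    then obtain d where d: "d > 0" "\<And>q. \<bar>q - u * s\<bar> < d \<Longrightarrow> \<sigma> q \<in> fst c \<and> f q \<in> ball z0 r"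
      using geodesic_near[OF c _ open_ball, of "u * s"] in_ball unfolding f_def by blast
    define e where "e = d / (2 * (\<bar>s\<bar> + 1))"
    have e: "e > 0" using d by (simp add: e_def)
    have "Q v" if "v \<in> {u..u + e}" for v
    proof -
      have "\<bar>v * s - u * s\<bar> = \<bar>v - u\<bar> * \<bar>s\<bar>" by (simp add: abs_mult[symmetric] left_diff_distrib)
      also have "\<dots> \<le> e * (\<bar>s\<bar> + 1)" using that by (intro mult_mono) auto
      also have "\<dots> = d / 2"
      proof -
        have "\<bar>s\<bar> + 1 \<noteq> 0" by linarith
        then show ?thesis by (simp add: e_def field_simps)
      qed
      finally have "\<bar>v * s - u * s\<bar> < d" using d by simp
      from d(2)[OF this] show ?thesis by (simp add: Q_def)
    qed
    with e show "\<exists>d>0. \<forall>v\<in>{u..u + d}. Q v" by blast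
  next
    fix u :: real assume u: "0 < u" "u \<le> 1" and all: "\<forall>v\<in>{0..<u}. Q v"
    \<comment> \<open>The curve might leave the domain of the chart while its coordinates remain
      bounded. The preimage of the closed coordinate ball is compact, hence closed in a Hausdorff
      space, so the limit point still lies in the chart.\<close>
    define C where "C = inv_into (fst c) (snd c) ` cball (fst z0) r"
    have sub: "cball (fst z0) r \<subseteq> snd c ` fst c"
    proof
      fix x assume "x \<in> cball (fst z0) r"
      then have "(x, snd z0) \<in> cball z0 r" by (simp add: dist_prod_def)
      with r(2) show "x \<in> snd c ` fst c" by blast
    qed
    have "compact C"
      unfolding C_def using continuous_on_subset[OF continuous_on_chart_inverse[OF c] sub]
      by (intro compact_continuous_image) auto
    then have "closed ((\<lambda>u. \<sigma> (u * s)) -` C)"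
      using \<sigma>_cont by (intro closed_vimage compact_imp_closed)
    moreover have "{0..<u} \<subseteq> (\<lambda>u. \<sigma> (u * s)) -` C"
    proof
      fix v assume "v \<in> {0..<u}"
      then have v: "\<sigma> (v * s) \<in> fst c" "f (v * s) \<in> cball z0 r" using all by (auto simp: Q_def)
      have "dist (fst z0) (snd c (\<sigma> (v * s))) \<le> dist z0 (f (v * s))"
        using dist_fst_le[of z0 "f (v * s)"] by (simp add: f_def phase_def)
      with v(2) have "snd c (\<sigma> (v * s)) \<in> cball (fst z0) r" by simp
      then show "v \<in> (\<lambda>u. \<sigma> (u * s)) -` C"
        unfolding C_def vimage_eq using chart_inverse[OF c v(1)] by (metis imageI)
    qed
    ultimately have "closure {0..<u} \<subseteq> (\<lambda>u. \<sigma> (u * s)) -` C" by (rule closure_minimal[rotated])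
    then have "{0..u} \<subseteq> (\<lambda>u. \<sigma> (u * s)) -` C" using u by (simp add: closure_atLeastLessThan)
    from subsetD[OF this, of u] have "\<sigma> (u * s) \<in> C" using u by simp
    then obtain x where x: "x \<in> cball (fst z0) r" "\<sigma> (u * s) = inv_into (fst c) (snd c) x"
      unfolding C_def by blast
    then have \<sigma>u: "\<sigma> (u * s) \<in> fst c"
      using inv_into_into[OF subsetD[OF sub x(1)]] by simp
    have "f (u * s) \<in> cball z0 r"
    proof (rule Lim_in_closed_set[of _ "\<lambda>v. f (v * s)" "at_left u"])
      show "((\<lambda>v. f (v * s)) \<longlongrightarrow> f (u * s)) (at_left u)"
        using f_cont[OF \<sigma>u] unfolding isCont_def by (rule tendsto_within_subset) simp
      have "eventually (\<lambda>v. v \<in> {0<..<u}) (at_left u)"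
        using eventually_at_left_real[OF u(1)] .
      then show "eventually (\<lambda>v. f (v * s) \<in> cball z0 r) (at_left u)"
        by (rule eventually_mono) (use all in \<open>auto simp: Q_def\<close>)
    qed auto
    with \<sigma>u show "Q u" by (simp add: Q_def)
  qed auto
  then show ?thesis by (simp add: Q_def f_def)
qed

end

section \<open>Geodesics for short time\<close>

definition starts_in :: "('a, 'e) chart \<Rightarrow> ('e \<times> 'e) set \<Rightarrow> (real \<Rightarrow> 'a) \<Rightarrow> bool" where
  "starts_in c N \<sigma> \<longleftrightarrow> geodesic A g \<sigma> \<and> \<sigma> 0 \<in> fst c \<and> phase c (lift \<sigma> 0) \<in> N"

text \<open>The geodesics here are defined for all times, in the form in which completeness supplies
  them. The third clause concerns families over an arbitrary set of real parameters, since it will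
  be applied to the parameter of a path near one of its points, possibly an end point.\<close>

definition short_geodesics :: "('a, 'e) chart \<Rightarrow> ('e \<times> 'e) set \<Rightarrow> real \<Rightarrow> bool" where
  "short_geodesics c N \<eta> \<longleftrightarrow>
     (\<forall>\<sigma>. starts_in c N \<sigma> \<longrightarrow> (\<forall>s. \<bar>s\<bar> < \<eta> \<longrightarrow> \<sigma> s \<in> fst c)) \<and>
     (\<forall>\<sigma> \<tau>. starts_in c N \<sigma> \<longrightarrow> starts_in c N \<tau> \<longrightarrow> lift \<tau> 0 = lift \<sigma> 0 \<longrightarrow>
       (\<forall>s. \<bar>s\<bar> < \<eta> \<longrightarrow> lift \<tau> s = lift \<sigma> s)) \<and>
     (\<forall>(J::real set) \<sigma> k. (\<forall>t\<in>J. starts_in c N (\<sigma> t)) \<longrightarrow> ndiff k J (\<lambda>t. phase c (lift (\<sigma> t) 0)) \<longrightarrow>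
       (\<forall>s. \<bar>s\<bar> < \<eta> \<longrightarrow> ndiff k J (\<lambda>t. phase c (lift (\<sigma> t) s))))"

text \<open>Initial phases come from a ball of half the radius: by \<open>geodesic_stays\<close>
  such geodesics remain in \<open>cball z0 r\<close> up to time \<open>\<eta>\<close>, hence they
  are solutions in the sense of \<open>ode_solution\<close> and \<open>smoothly_determined\<close>
  applies to them.\<close>

lemma local_geodesics:
  assumes c: "c \<in> A" and z0: "fst z0 \<in> snd c ` fst c"
  obtains \<rho> \<eta> where "\<rho> > 0" "\<eta> > 0" "short_geodesics c (ball z0 \<rho>) \<eta>"
proof -
  let ?W = "snd c ` fst c \<times> (UNIV :: 'e set)"
  have W: "open ?W" "z0 \<in> ?W" using z0 by (auto intro!: open_Times open_chart_image[OF c] simp: mem_Times_iff)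
  obtain r \<eta> B where r: "r > 0" "\<eta> > 0" "cball z0 r \<subseteq> ?W" "\<forall>y\<in>cball z0 r. norm (spray A g c y) \<le> B"
    "\<eta> * B < r / 2"
    and det: "smoothly_determined (spray A g c) (cball z0 r) \<eta>"
    by (rule ode_local[OF W smooth_spray[OF atlas metric c]])
  have stay: "\<sigma> s \<in> fst c \<and> phase c (lift \<sigma> s) \<in> cball z0 r"
    if "starts_in c (ball z0 (r / 2)) \<sigma>" "s \<in> {-\<eta>..\<eta>}" for \<sigma> s
    using that r(4) by (intro geodesic_stays[OF _ c r(1,3) _ r(5)]) (auto simp: starts_in_def)
  have sol: "ode_solution (spray A g c) (cball z0 r) \<eta> (\<lambda>s. phase c (lift \<sigma> s))"
    if \<sigma>: "starts_in c (ball z0 (r / 2)) \<sigma>" for \<sigma>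
  proof -
    have "geodesic A g \<sigma>" using \<sigma> by (simp add: starts_in_def)
    from stay[OF \<sigma>] has_vector_derivative_at_within[OF geodesic_phase_derivative[OF this c]] show ?thesis
      unfolding ode_solution_def by blast
  qed
  show thesis
  proof (rule that[of "r / 2" \<eta>])
    have s: "s \<in> {-\<eta>..\<eta>}" if "\<bar>s\<bar> < \<eta>" for s using that by auto
    show "short_geodesics c (ball z0 (r / 2)) \<eta>"
      unfolding short_geodesics_def
    proof (intro conjI allI impI)
      fix \<sigma> s assume "starts_in c (ball z0 (r / 2)) \<sigma>" "\<bar>s\<bar> < \<eta>"
      then show "\<sigma> s \<in> fst c" using stay s by blast
    next
      fix \<sigma> \<tau> s assume st: "starts_in c (ball z0 (r / 2)) \<sigma>" "starts_in c (ball z0 (r / 2)) \<tau>"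
        and eq: "lift \<tau> 0 = lift \<sigma> 0" and "\<bar>s\<bar> < \<eta>"
      note s = s[OF this(4)]
      show "lift \<tau> s = lift \<sigma> s"
      proof (rule tangent_bundle_eqI[OF velocity_mem velocity_mem c])
        show "geodesic A g \<sigma>" "geodesic A g \<tau>" using st by (auto simp: starts_in_def)
        show "fst (lift \<tau> s) \<in> fst c" "fst (lift \<sigma> s) \<in> fst c"
          using stay[OF st(1) s] stay[OF st(2) s] by simp_all
        have "phase c (lift \<tau> 0) = phase c (lift \<sigma> 0)" by (simp only: eq)
        then show "phase c (lift \<tau> s) = phase c (lift \<sigma> s)"
          using conjunct1[OF det[unfolded smoothly_determined_def], rule_format, OF sol[OF st(2)] sol[OF st(1)] _ s]
          by simp
      qed
    next
      fix J :: "real set" and \<sigma> k s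
      assume J: "\<forall>t\<in>J. starts_in c (ball z0 (r / 2)) (\<sigma> t)"
        and k: "ndiff k J (\<lambda>t. phase c (lift (\<sigma> t) 0))" and "\<bar>s\<bar> < \<eta>"
      have "\<forall>t\<in>J. ode_solution (spray A g c) (cball z0 r) \<eta> (\<lambda>s. phase c (lift (\<sigma> t) s))"
        using J sol by blast
      from conjunct2[OF det[unfolded smoothly_determined_def], THEN spec, THEN spec, THEN spec, THEN mp, OF this,
          THEN mp, OF k, THEN bspec, OF s[OF \<open>\<bar>s\<bar> < \<eta>\<close>]]
      show "ndiff k J (\<lambda>t. phase c (lift (\<sigma> t) s))" .
    qed
  qed (use r in auto)
qed

text \<open>Agreement of position and velocity at one time \<open>r\<close> near \<open>s\<close> is
  passed on to every time \<open>r'\<close> near \<open>s\<close>. This single statement contains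
  both openness and closedness of the set of times of agreement.\<close>

lemma geodesic_unique:
  assumes \<sigma>: "geodesic A g \<sigma>" and \<tau>: "geodesic A g \<tau>"
    and init: "\<tau> 0 = \<sigma> 0" "velocity A \<tau> 0 = velocity A \<sigma> 0"
  shows "\<tau> = \<sigma>"
proof
  fix s
  have "lift \<tau> s = lift \<sigma> s"
  proof (rule real_local_induction[where a=0])
    show "lift \<tau> 0 = lift \<sigma> 0" using init by simp
    fix s
    obtain c where c: "c \<in> A" "\<sigma> s \<in> fst c" by (rule chart_cover)
    let ?z = "phase c (lift \<sigma> s)"
    have "fst ?z \<in> snd c ` fst c" using c by (simp add: phase_def)
    obtain \<rho> \<eta> where e: "\<rho> > 0" "\<eta> > 0" and short: "short_geodesics c (ball ?z \<rho>) \<eta>"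
      by (rule local_geodesics[OF c(1) \<open>fst ?z \<in> _\<close>])
    obtain d where d: "d > 0" "\<And>r. \<bar>r - s\<bar> < d \<Longrightarrow> \<sigma> r \<in> fst c \<and> phase c (lift \<sigma> r) \<in> ball ?z \<rho>"
      using geodesic_near[OF \<sigma> c open_ball, of ?z \<rho>] e(1) by auto
    \<comment> \<open>The bound \<open>d\<close> puts the phase at time \<open>r\<close> into the
      ball where short geodesics are controlled; two distances below \<open>\<eta> / 2\<close> leave
      less than \<open>\<eta>\<close> between \<open>r\<close> and \<open>r'\<close>.\<close>
    define \<delta> where "\<delta> = min d (\<eta> / 2)"
    have step: "(\<tau> r', velocity A \<tau> r') = (\<sigma> r', velocity A \<sigma> r')"
      if r: "\<bar>r - s\<bar> < \<delta>" "\<bar>r' - s\<bar> < \<delta>" and eq: "lift \<tau> r = lift \<sigma> r" for r r'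
    proof -
      have "\<bar>r - s\<bar> < d" "\<bar>r' - r\<bar> < \<eta>" using r unfolding \<delta>_def by linarith+
      have "starts_in c (ball ?z \<rho>) (\<lambda>s. \<sigma> (s + r))" "starts_in c (ball ?z \<rho>) (\<lambda>s. \<tau> (s + r))"
        using geodesic_shift[OF \<sigma>, of r] geodesic_shift[OF \<tau>, of r] d(2)[OF \<open>\<bar>r - s\<bar> < d\<close>] eq
        by (auto simp: starts_in_def velocity_shift)
      moreover have "lift (\<lambda>s. \<tau> (s + r)) 0 = lift (\<lambda>s. \<sigma> (s + r)) 0"
        using eq by (simp add: velocity_shift)
      ultimately have "lift (\<lambda>s. \<tau> (s + r)) (r' - r) = lift (\<lambda>s. \<sigma> (s + r)) (r' - r)"
        using short \<open>\<bar>r' - r\<bar> < \<eta>\<close> unfolding short_geodesics_def by blast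
      then show ?thesis by (simp add: velocity_shift)
    qed
    have "\<delta> > 0" using d(1) e(2) by (simp add: \<delta>_def)
    then show "\<exists>\<delta>>0. \<forall>r r'. \<bar>r - s\<bar> < \<delta> \<longrightarrow> \<bar>r' - s\<bar> < \<delta> \<longrightarrow> lift \<tau> r = lift \<sigma> r \<longrightarrow>
      (\<tau> r', velocity A \<tau> r') = (\<sigma> r', velocity A \<sigma> r')"
      by (intro exI[of _ \<delta>] conjI allI impI) (assumption, rule step)
  qed
  then show "\<tau> s = \<sigma> s" by simp
qed

end

section \<open>The geodesic flow\<close>

text \<open>The chart is existential because the flow carries \<open>y t\<close> from chart to
  chart; \<open>locally_smooth_chart\<close> moves the statement to a prescribed one.\<close>

definition locally_smooth ::
    "('a, 'e::euclidean_space) chart set \<Rightarrow> real set \<Rightarrow> (real \<Rightarrow> 'a \<times> ('a, 'e) tvec) \<Rightarrow> real \<Rightarrow> bool" where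
  "locally_smooth A J y t \<longleftrightarrow> (\<exists>c\<in>A. \<exists>U. open U \<and> t \<in> U \<and> (\<forall>u\<in>J \<inter> U. fst (y u) \<in> fst c) \<and>
     smooth_within (J \<inter> U) (\<lambda>u. phase c (y u)))"

definition bundle_smooth ::
    "('a, 'e::euclidean_space) chart set \<Rightarrow> real set \<Rightarrow> (real \<Rightarrow> 'a \<times> ('a, 'e) tvec) \<Rightarrow> bool" where
  "bundle_smooth A J y \<longleftrightarrow> (\<forall>t\<in>J. y t \<in> tangent_bundle A \<and> locally_smooth A J y t)"

lemma locally_smooth_cong:
  assumes "open V" "t \<in> V" "J \<inter> V \<subseteq> J'" "\<And>u. u \<in> J \<inter> V \<Longrightarrow> y u = y' u" "locally_smooth A J' y t"
  shows "locally_smooth A J y' t"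
proof -
  obtain c U where c: "c \<in> A" and U: "open U" "t \<in> U" "\<forall>u\<in>J' \<inter> U. fst (y u) \<in> fst c"
    "smooth_within (J' \<inter> U) (\<lambda>u. phase c (y u))"
    using assms(5) unfolding locally_smooth_def by blast
  have "smooth_within (J \<inter> (U \<inter> V)) (\<lambda>u. phase c (y' u))"
  proof
    fix k
    have "ndiff k (J \<inter> (U \<inter> V)) (\<lambda>u. phase c (y u))"
      by (rule ndiff_subset[OF spec[OF U(4)]]) (use assms(3) in auto)
    then show "ndiff k (J \<inter> (U \<inter> V)) (\<lambda>u. phase c (y' u))"
      by (rule ndiff_cong[rotated]) (simp add: assms(4))
  qed
  moreover have "\<forall>u\<in>J \<inter> (U \<inter> V). fst (y' u) \<in> fst c"
  proof
    fix u assume u: "u \<in> J \<inter> (U \<inter> V)"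
    then have "u \<in> J' \<inter> U" using assms(3) by auto
    then have "fst (y u) \<in> fst c" using U(3) by blast
    moreover have "y u = y' u" using u by (intro assms(4)) blast
    ultimately show "fst (y' u) \<in> fst c" by simp
  qed
  ultimately show ?thesis
    unfolding locally_smooth_def using c U(1,2) assms(1,2)
    by (intro bexI[of _ c] exI[of _ "U \<inter> V"] conjI open_Int) auto
qed

section \<open>Smooth curves in the tangent bundle\<close>

context riemannian
begin

text \<open>The vector part transforms by the derivative of the transition map at a moving base
  point. Expanding the vector over \<open>Basis\<close> reduces this to derivatives in fixed
  directions, which are smooth functions of the base point.\<close>

lemma ndiff_chart_change:
  assumes c: "c \<in> A" "c' \<in> A"
    and y: "\<And>u. u \<in> S \<Longrightarrow> y u \<in> TB \<and> fst (y u) \<in> fst c \<and> fst (y u) \<in> fst c'"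
    and k: "ndiff k S (\<lambda>u. phase c (y u))"
  shows "ndiff k S (\<lambda>u. phase c' (y u))"
proof -
  let ?D = "\<lambda>x. frechet_derivative (transition c c') (at x)"
  have x: "ndiff k S (\<lambda>u. snd c (fst (y u)))"
    using ndiff_linear_compose[OF bounded_linear_fst k] by (simp add: phase_def)
  have X: "ndiff k S (\<lambda>u. snd (y u) c)"
    using ndiff_linear_compose[OF bounded_linear_snd k] by (simp add: phase_def)
  have mem: "snd c (fst (y u)) \<in> snd c ` (fst c \<inter> fst c')" if "u \<in> S" for u using y[OF that] by blast
  have sm: "smooth_on (snd c ` (fst c \<inter> fst c')) (transition c c')" by (rule transition_smooth[OF c])
  have 1: "ndiff k S (\<lambda>u. transition c c' (snd c (fst (y u))))"
    by (rule ndiff_compose[OF x smooth_on_imp_smooth_within[OF sm] mem])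
  have "ndiff k S (\<lambda>u. ?D (snd c (fst (y u))) b)" for b
    by (rule ndiff_compose[OF x smooth_on_imp_smooth_within[OF smooth_on_derivative(2)[OF sm]] mem])
  then have 2: "ndiff k S (\<lambda>u. \<Sum>b\<in>Basis. (snd (y u) c \<bullet> b) *\<^sub>R ?D (snd c (fst (y u))) b)"
    by (intro ndiff_sum ndiff_scaleR ndiff_inner_left X)
  have "(transition c c' (snd c (fst (y u))), \<Sum>b\<in>Basis. (snd (y u) c \<bullet> b) *\<^sub>R ?D (snd c (fst (y u))) b) = phase c' (y u)"
    if "u \<in> S" for u
  proof -
    have u: "fst (y u) \<in> fst c" "fst (y u) \<in> fst c'" "snd (y u) \<in> tangent_space A (fst (y u))"
      using y[OF that] by (auto simp: tangent_bundle_def)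
    have "linear (?D (snd c (fst (y u))))"
      using transition_derivative[OF c u(1,2)] by (rule has_derivative_linear)
    then have "snd (y u) c' = (\<Sum>b\<in>Basis. (snd (y u) c \<bullet> b) *\<^sub>R ?D (snd c (fst (y u))) b)"
      unfolding tangent_transition[OF u(3) c u(1,2)] by (rule linear_eq_sum_Basis)
    then show ?thesis by (simp only: phase_def transition_apply[OF c(1) u(1)])
  qed
  from ndiff_cong[OF this ndiff_Pair[OF 1 2]] show ?thesis .
qed

text \<open>Smoothness in the chart \<open>c1\<close> at hand gives continuity of the base point
  through the inverse of \<open>c1\<close>. This shrinks the neighbourhood into the domain of
  \<open>c\<close>; after the change of chart, continuity of the phase shrinks it into the preimage
  of \<open>N\<close>.\<close>

lemma locally_smooth_chart:
  assumes y: "\<And>u. u \<in> J \<Longrightarrow> y u \<in> TB" and t: "t \<in> J" and loc: "locally_smooth A J y t"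
    and c: "c \<in> A" "fst (y t) \<in> fst c" and N: "open N" "phase c (y t) \<in> N"
  obtains U where "open U" "t \<in> U" "\<forall>u\<in>J \<inter> U. fst (y u) \<in> fst c \<and> phase c (y u) \<in> N"
    "smooth_within (J \<inter> U) (\<lambda>u. phase c (y u))"
proof -
  obtain c1 U1 where c1: "c1 \<in> A" and U1: "open U1" "t \<in> U1" "\<forall>u\<in>J \<inter> U1. fst (y u) \<in> fst c1"
    "smooth_within (J \<inter> U1) (\<lambda>u. phase c1 (y u))"
    using loc unfolding locally_smooth_def by blast
  have "continuous_on (J \<inter> U1) (\<lambda>u. phase c1 (y u))"
    using U1(4)[rule_format, of "Suc 0"] by (rule ndiff_imp_continuous_on)
  then have "continuous_on (J \<inter> U1) (\<lambda>u. inv_into (fst c1) (snd c1) (fst (phase c1 (y u))))"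
    using U1(3) by (intro continuous_on_compose2[OF continuous_on_chart_inverse[OF c1]] continuous_on_fst)
      (auto simp: phase_def)
  moreover have "inv_into (fst c1) (snd c1) (fst (phase c1 (y u))) = fst (y u)" if "u \<in> J \<inter> U1" for u
    using U1(3) that by (simp add: phase_def chart_inverse[OF c1])
  ultimately have cont: "continuous_on (J \<inter> U1) (\<lambda>u. fst (y u))"
    by (rule continuous_on_eq)
  obtain U2 where U2: "open U2" "t \<in> U2" "\<forall>u\<in>J \<inter> U1. u \<in> U2 \<longrightarrow> fst (y u) \<in> fst c"
    using cont[unfolded continuous_on_topological, THEN bspec, of t] t U1(2) open_chart[OF c(1)] c(2) by blast
  have sm: "ndiff k (J \<inter> (U1 \<inter> U2)) (\<lambda>u. phase c (y u))" for k
  proof (rule ndiff_chart_change[OF c1 c(1)])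
    show "ndiff k (J \<inter> (U1 \<inter> U2)) (\<lambda>u. phase c1 (y u))"
      using U1(4) by (rule_tac ndiff_subset[of _ "J \<inter> U1"]) auto
  qed (use y U1(3) U2(3) in auto)
  have "continuous_on (J \<inter> (U1 \<inter> U2)) (\<lambda>u. phase c (y u))"
    using sm[of "Suc 0"] by (rule ndiff_imp_continuous_on)
  then obtain U3 where U3: "open U3" "t \<in> U3" "\<forall>u\<in>J \<inter> (U1 \<inter> U2). u \<in> U3 \<longrightarrow> phase c (y u) \<in> N"
    unfolding continuous_on_topological using t U1(2) U2(2) N by blast
  show thesis
  proof (rule that[of "U1 \<inter> U2 \<inter> U3"])
    show "smooth_within (J \<inter> (U1 \<inter> U2 \<inter> U3)) (\<lambda>u. phase c (y u))"
      using sm by (auto intro: ndiff_subset)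
  qed (use U1 U2 U3 in auto)
qed

lemma bundle_smooth_continuous:
  assumes "bundle_smooth A J y" shows "continuous_on J (\<lambda>u. fst (y u))"
  unfolding continuous_on_topological
proof (intro ballI allI impI)
  fix t B assume t: "t \<in> J" and B: "open B" "fst (y t) \<in> B"
  have y: "\<And>u. u \<in> J \<Longrightarrow> y u \<in> TB" "locally_smooth A J y t"
    using assms t by (auto simp: bundle_smooth_def)
  obtain c where c: "c \<in> A" "fst (y t) \<in> fst c" by (rule chart_cover)
  have "continuous_on (snd c ` fst c) (inv_into (fst c) (snd c))" by (rule continuous_on_chart_inverse[OF c(1)])
  then obtain N where N: "open N" "snd c (fst (y t)) \<in> N" "\<forall>x\<in>snd c ` fst c. x \<in> N \<longrightarrow> inv_into (fst c) (snd c) x \<in> B"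
    using continuous_on_topological[THEN iffD1, rule_format, OF _ imageI[OF c(2)] B(1)] B(2)
      chart_inverse[OF c] by metis
  have N': "open (N \<times> (UNIV :: 'e set))" "phase c (y t) \<in> N \<times> UNIV" using N by (auto simp: open_Times phase_def)
  obtain U where U: "open U" "t \<in> U" "\<forall>u\<in>J \<inter> U. fst (y u) \<in> fst c \<and> phase c (y u) \<in> N \<times> UNIV"
    "smooth_within (J \<inter> U) (\<lambda>u. phase c (y u))"
    by (rule locally_smooth_chart[OF y(1) t y(2) c N'])
  have "fst (y u) \<in> B" if "u \<in> J \<inter> U" for u
  proof -
    have u: "fst (y u) \<in> fst c" "snd c (fst (y u)) \<in> N" using bspec[OF U(3) that] by (simp_all add: phase_def)
    from N(3)[rule_format, OF imageI[OF u(1)] u(2)] show ?thesis unfolding chart_inverse[OF c(1) u(1)] .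
  qed
  with U(1,2) show "\<exists>A. open A \<and> t \<in> A \<and> (\<forall>u\<in>J. u \<in> A \<longrightarrow> fst (y u) \<in> B)" by blast
qed

lemma perfect_set_unit: "perfect_set {0..1}"
  unfolding perfect_set_def
proof
  fix t :: real assume "t \<in> {0..1}"
  then have "t islimpt {0..1}"
    by (intro connected_imp_perfect) (auto simp: connected_iff_interval intro: exI[of _ 0])
  then show "at t within {0..1} \<noteq> bot" by (simp add: trivial_limit_within)
qed

text \<open>\<open>TPM\<close> asks for smoothness on the whole preimage of every chart,
  \<open>bundle_smooth\<close> for smoothness near each point in some chart. The preimage is
  relatively open in \<open>{0..1}\<close>, so it has no isolated points and local derivatives
  glue.\<close>

lemma TPM_iff: "x \<in> TPM A \<longleftrightarrow> bundle_smooth A {0..1} x"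
proof
  assume x: "x \<in> TPM A"
  then have cont: "continuous_on {0..1} (\<lambda>t. fst (x t))"
    by (simp add: TPM_def PM_def o_def)
  show "bundle_smooth A {0..1} x"
    unfolding bundle_smooth_def
  proof (intro ballI conjI)
    fix t :: real assume t: "t \<in> {0..1}"
    show "x t \<in> TB" using x t by (simp add: TPM_def tangent_bundle_def)
    obtain c where c: "c \<in> A" "fst (x t) \<in> fst c" by (rule chart_cover)
    obtain U where U: "open U" "t \<in> U" "\<forall>u\<in>{0..1}. u \<in> U \<longrightarrow> fst (x u) \<in> fst c"
      using cont[unfolded continuous_on_topological, THEN bspec, OF t] open_chart[OF c(1)] c(2) by blast
    let ?S = "{t\<in>{0..1}. fst (x t) \<in> fst c}"
    have "smooth_curve_on ?S (\<lambda>t. snd c (fst (x t)))" "smooth_curve_on ?S (\<lambda>t. snd (x t) c)"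
      using x c(1) by (auto simp: TPM_def PM_def o_def)
    then have "ndiff k ?S (\<lambda>t. phase c (x t))" for k
      unfolding phase_def by (intro ndiff_Pair smooth_curve_on_imp_smooth_within)
    then have "ndiff k ({0..1} \<inter> U) (\<lambda>t. phase c (x t))" for k
      by (rule ndiff_subset) (use U(3) in auto)
    with c(1) U show "locally_smooth A {0..1} x t"
      unfolding locally_smooth_def by blast
  qed
next
  assume bs: "bundle_smooth A {0..1} x"
  then have x: "\<And>t. t \<in> {0..1} \<Longrightarrow> x t \<in> TB" "\<And>t. t \<in> {0..1} \<Longrightarrow> locally_smooth A {0..1} x t"
    by (auto simp: bundle_smooth_def)
  have cont: "continuous_on {0..1} (\<lambda>t. fst (x t))" by (rule bundle_smooth_continuous[OF bs])
  have "smooth_curve_on {t\<in>{0..1}. fst (x t) \<in> fst c} (\<lambda>t. snd c (fst (x t))) \<and>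
    smooth_curve_on {t\<in>{0..1}. fst (x t) \<in> fst c} (\<lambda>t. snd (x t) c)" if c: "c \<in> A" for c
  proof -
    let ?S = "{t\<in>{0..1}. fst (x t) \<in> fst c}"
    obtain V where V: "open V" "V \<inter> {0..1} = (\<lambda>t. fst (x t)) -` fst c \<inter> {0..1}"
      using cont open_chart[OF c] unfolding continuous_on_open_invariant by blast
    have S: "?S = {0..1} \<inter> V" using V(2) by blast
    have p: "perfect_set ?S" unfolding S by (rule perfect_set_Int_open[OF perfect_set_unit V(1)])
    have k: "ndiff k ?S (\<lambda>t. phase c (x t))" for k
    proof (rule ndiff_local[OF p])
      fix t assume "t \<in> ?S"
      then have t: "t \<in> {0..1}" "fst (x t) \<in> fst c" by auto
      obtain U where U: "open U" "t \<in> U" "\<forall>u\<in>{0..1} \<inter> U. fst (x u) \<in> fst c \<and> phase c (x u) \<in> UNIV"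
        "smooth_within ({0..1} \<inter> U) (\<lambda>t. phase c (x t))"
        by (rule locally_smooth_chart[OF x(1) t(1) x(2)[OF t(1)] c t(2) open_UNIV UNIV_I])
      have "ndiff k (?S \<inter> U) (\<lambda>t. phase c (x t))"
        by (rule ndiff_subset[OF spec[OF U(4)]]) auto
      with U(1,2) show "\<exists>U'. open U' \<and> t \<in> U' \<and> ndiff k (?S \<inter> U') (\<lambda>t. phase c (x t))" by blast
    qed
    show ?thesis
      unfolding smooth_curve_on_iff[OF p]
      using ndiff_linear_compose[OF bounded_linear_fst k] ndiff_linear_compose[OF bounded_linear_snd k]
      by (simp add: phase_def)
  qed
  with cont x(1) show "x \<in> TPM A"
    by (auto simp: TPM_def PM_def o_def tangent_bundle_def)
qed

end

section \<open>The flow as an action of the real line\<close>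

definition geodesic_flow ::
    "('a::topological_space, 'e::euclidean_space) chart set \<Rightarrow> ('a, 'e) metric \<Rightarrow> real \<Rightarrow>
     'a \<times> ('a, 'e) tvec \<Rightarrow> 'a \<times> ('a, 'e) tvec" where
  "geodesic_flow A g s v = (geodesic_from A g v s, velocity A (geodesic_from A g v) s)"

lemma path_geodesic_eq: "path_geodesic A g x s = (\<lambda>t. geodesic_flow A g s (x t))"
  by (simp add: path_geodesic_def geodesic_flow_def)

locale complete_riemannian = riemannian +
  assumes complete: "complete_metric A g"
begin

abbreviation "\<Phi> \<equiv> geodesic_flow A g"

lemma geodesic_from_eq:
  assumes "geodesic A g \<sigma>"
  shows "geodesic_from A g (lift \<sigma> 0) = \<sigma>"
  unfolding geodesic_from_def
  by (rule the_equality) (use assms geodesic_unique[OF assms] in auto)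

lemma geodesic_from:
  assumes "v \<in> TB"
  shows "geodesic A g (geodesic_from A g v)" "(geodesic_from A g v 0, velocity A (geodesic_from A g v) 0) = v"
proof -
  obtain \<sigma> where \<sigma>: "geodesic A g \<sigma>" "\<sigma> 0 = fst v" "velocity A \<sigma> 0 = snd v"
    using assms complete unfolding complete_metric_def tangent_bundle_def by blast
  have "v = lift \<sigma> 0" using \<sigma> by simp
  with geodesic_from_eq[OF \<sigma>(1)] \<sigma>(1)
  show "geodesic A g (geodesic_from A g v)" "(geodesic_from A g v 0, velocity A (geodesic_from A g v) 0) = v"
    by simp_all
qed

lemma flow_mem: "v \<in> TB \<Longrightarrow> \<Phi> s v \<in> TB"
  unfolding geodesic_flow_def by (rule velocity_mem[OF geodesic_from(1)])

lemma flow_zero: "v \<in> TB \<Longrightarrow> \<Phi> 0 v = v"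
  unfolding geodesic_flow_def by (rule geodesic_from(2))

text \<open>The shifted geodesic has initial vector \<open>\<Phi> s v\<close>, so uniqueness makes
  it the chosen one. The group law of the flow follows by evaluation.\<close>

lemma geodesic_from_flow:
  assumes "v \<in> TB"
  shows "geodesic_from A g (\<Phi> s v) = (\<lambda>r. geodesic_from A g v (r + s))"
  using geodesic_from_eq[OF geodesic_shift[OF geodesic_from(1)[OF assms], of s]]
  by (simp add: velocity_shift geodesic_flow_def)

lemma flow_flow: "v \<in> TB \<Longrightarrow> \<Phi> r (\<Phi> s v) = \<Phi> (r + s) v"
  unfolding geodesic_flow_def[of A g r] geodesic_from_flow
  by (simp add: velocity_shift geodesic_flow_def)

text \<open>With \<open>t\<close> fixed, only the geodesic through \<open>y t\<close> has to be
  followed, and the neighbourhood of \<open>t\<close> may shrink as the time moves. Near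
  \<open>s0\<close>, smoothness passes from time \<open>r\<close> to time \<open>r'\<close> by the
  short-time statement in a chart around \<open>\<sigma> s0\<close>.\<close>

lemma locally_smooth_flow:
  assumes y: "\<And>u. u \<in> J \<Longrightarrow> y u \<in> TB" and t: "t \<in> J" and loc: "locally_smooth A J y t"
  shows "locally_smooth A J (\<lambda>u. \<Phi> s (y u)) t"
proof (rule real_local_induction[where a=0 and P="\<lambda>s. locally_smooth A J (\<lambda>u. \<Phi> s (y u)) t"])
  show "locally_smooth A J (\<lambda>u. \<Phi> 0 (y u)) t"
    using flow_zero[OF y] by (intro locally_smooth_cong[OF open_UNIV _ _ _ loc]) auto
  fix s0
  define \<sigma> where "\<sigma> = geodesic_from A g (y t)"
  have \<sigma>: "geodesic A g \<sigma>" unfolding \<sigma>_def by (rule geodesic_from(1)[OF y[OF t]])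
  have flow_t: "\<Phi> s (y t) = lift \<sigma> s" for s by (simp add: geodesic_flow_def \<sigma>_def)
  obtain c where c: "c \<in> A" "\<sigma> s0 \<in> fst c" by (rule chart_cover)
  define z where "z = phase c (lift \<sigma> s0)"
  have "fst z \<in> snd c ` fst c" using c by (simp add: z_def phase_def)
  then obtain \<rho> \<eta> where e: "\<rho> > 0" "\<eta> > 0" and short: "short_geodesics c (ball z \<rho>) \<eta>"
    by (rule local_geodesics[OF c(1)])
  obtain d where d: "d > 0" "\<And>r. \<bar>r - s0\<bar> < d \<Longrightarrow> \<sigma> r \<in> fst c \<and> phase c (lift \<sigma> r) \<in> ball z \<rho>"
    using geodesic_near[OF \<sigma> c open_ball, of z \<rho>] e(1) by (auto simp: z_def)
  define \<delta> where "\<delta> = min d (\<eta> / 2)"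
  have step: "locally_smooth A J (\<lambda>u. \<Phi> r' (y u)) t"
    if r: "\<bar>r - s0\<bar> < \<delta>" "\<bar>r' - s0\<bar> < \<delta>" and loc: "locally_smooth A J (\<lambda>u. \<Phi> r (y u)) t" for r r'
  proof -
    have rd: "\<bar>r - s0\<bar> < d" and rr: "\<bar>r' - r\<bar> < \<eta>" using r unfolding \<delta>_def by linarith+
    have in_N: "fst (\<Phi> r (y t)) \<in> fst c" "phase c (\<Phi> r (y t)) \<in> ball z \<rho>"
      using d(2)[OF rd] by (simp_all add: flow_t)
    \<comment> \<open>Smoothness at time \<open>r\<close> is used here also for its continuity: it
      brings the vectors at nearby \<open>u\<close> into the ball in which short geodesics are
      controlled.\<close>
    obtain U where U: "open U" "t \<in> U"
      "\<forall>u\<in>J \<inter> U. fst (\<Phi> r (y u)) \<in> fst c \<and> phase c (\<Phi> r (y u)) \<in> ball z \<rho>"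
      "smooth_within (J \<inter> U) (\<lambda>u. phase c (\<Phi> r (y u)))"
      by (rule locally_smooth_chart[OF flow_mem[OF y] t loc c(1) in_N(1) open_ball in_N(2)])
    define \<tau> where "\<tau> u = geodesic_from A g (\<Phi> r (y u))" for u
    have \<tau>: "starts_in c (ball z \<rho>) (\<tau> u)" "lift (\<tau> u) 0 = \<Phi> r (y u)" if "u \<in> J \<inter> U" for u
    proof -
      have m: "\<Phi> r (y u) \<in> TB" using that by (intro flow_mem y) simp
      show eq: "lift (\<tau> u) 0 = \<Phi> r (y u)" unfolding \<tau>_def by (rule geodesic_from(2)[OF m])
      have "geodesic A g (\<tau> u)" unfolding \<tau>_def by (rule geodesic_from(1)[OF m])
      with U(3) that eq show "starts_in c (ball z \<rho>) (\<tau> u)"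
        unfolding starts_in_def by (metis fst_conv)
    qed
    have val: "lift (\<tau> u) (r' - r) = \<Phi> r' (y u)" if "u \<in> J \<inter> U" for u
      using flow_flow[OF y, of u "r' - r" r] that by (simp add: \<tau>_def geodesic_flow_def)
    have "smooth_within (J \<inter> U) (\<lambda>u. phase c (\<Phi> r' (y u)))"
    proof
      fix k
      have "ndiff k (J \<inter> U) (\<lambda>u. phase c (lift (\<tau> u) 0))"
        using spec[OF U(4), of k] by (rule ndiff_cong[rotated]) (simp add: \<tau>(2))
      moreover have "\<forall>u\<in>J \<inter> U. starts_in c (ball z \<rho>) (\<tau> u)" using \<tau>(1) by blast
      ultimately have "ndiff k (J \<inter> U) (\<lambda>u. phase c (lift (\<tau> u) (r' - r)))"
        using short rr unfolding short_geodesics_def by blast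
      then show "ndiff k (J \<inter> U) (\<lambda>u. phase c (\<Phi> r' (y u)))"
        by (rule ndiff_cong[rotated]) (simp add: val)
    qed
    moreover have "\<forall>u\<in>J \<inter> U. fst (\<Phi> r' (y u)) \<in> fst c"
    proof
      fix u assume u: "u \<in> J \<inter> U"
      have "\<tau> u (r' - r) \<in> fst c" using short \<tau>(1)[OF u] rr unfolding short_geodesics_def by blast
      with val[OF u] show "fst (\<Phi> r' (y u)) \<in> fst c" by (metis fst_conv)
    qed
    ultimately show ?thesis unfolding locally_smooth_def using c(1) U(1,2) by blast
  qed
  have "\<delta> > 0" using d(1) e(2) by (simp add: \<delta>_def)
  then show "\<exists>\<delta>>0. \<forall>r r'. \<bar>r - s0\<bar> < \<delta> \<longrightarrow> \<bar>r' - s0\<bar> < \<delta> \<longrightarrow> locally_smooth A J (\<lambda>u. \<Phi> r (y u)) t \<longrightarrow>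
      locally_smooth A J (\<lambda>u. \<Phi> r' (y u)) t"
    by (intro exI[of _ \<delta>] conjI allI impI) (assumption, rule step)
qed

lemma bundle_smooth_flow: "bundle_smooth A J y \<Longrightarrow> bundle_smooth A J (\<lambda>u. \<Phi> s (y u))"
  unfolding bundle_smooth_def using flow_mem locally_smooth_flow[of J y _ s] by blast

end

section \<open>Reparametrization\<close>

abbreviation reparam_infix (infix "\<simeq>" 50) where "x \<simeq> y \<equiv> reparam_equiv x y"

lemma reparam_mem:
  assumes "reparametrization \<phi>" "t \<in> {0..1}" shows "\<phi> t \<in> {0..1}"
proof -
  have "mono_on {0..1} \<phi>" using assms(1) by (simp add: reparametrization_def strict_mono_on_imp_mono_on)
  from mono_onD[OF this, of 0 t] mono_onD[OF this, of t 1] show ?thesis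
    using assms by (simp add: reparametrization_def)
qed

lemma reparamI:
  assumes "continuous_on {0..1} \<phi>" "\<And>s t. 0 \<le> s \<Longrightarrow> s < t \<Longrightarrow> t \<le> 1 \<Longrightarrow> \<phi> s < \<phi> t" "\<phi> 0 = 0" "\<phi> 1 = 1"
  shows "reparametrization \<phi>"
  using assms by (auto simp: reparametrization_def intro!: strict_mono_onI)

lemma reparam_less:
  "reparametrization \<phi> \<Longrightarrow> 0 \<le> s \<Longrightarrow> s < t \<Longrightarrow> t \<le> 1 \<Longrightarrow> \<phi> s < \<phi> t"
  by (rule strict_mono_onD[of "{0..1}" \<phi>]) (auto simp: reparametrization_def)

lemma continuous_on_reparam:
  assumes "reparametrization \<phi>" "continuous_on S f" "\<And>t. t \<in> S \<Longrightarrow> f t \<in> {0..1}"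
  shows "continuous_on S (\<lambda>t. \<phi> (f t))"
  by (rule continuous_on_compose2[OF _ assms(2), of "{0..1}" \<phi>])
    (use assms(1,3) in \<open>auto simp: reparametrization_def\<close>)

lemma reparam_equivI:
  "reparametrization \<phi> \<Longrightarrow> (\<And>t. 0 \<le> t \<Longrightarrow> t \<le> 1 \<Longrightarrow> y t = x (\<phi> t)) \<Longrightarrow> x \<simeq> y"
  unfolding reparam_equiv_def by auto

lemma reparam_cong: "(\<And>t. 0 \<le> t \<Longrightarrow> t \<le> 1 \<Longrightarrow> y t = x t) \<Longrightarrow> x \<simeq> y"
  by (rule reparam_equivI[of "\<lambda>t. t"]) (auto intro: reparamI)

lemma reparam_trans [trans]:
  assumes "x \<simeq> y" "y \<simeq> z" shows "x \<simeq> z"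
proof -
  obtain \<phi> where \<phi>: "reparametrization \<phi>" "\<forall>t\<in>{0..1}. y t = x (\<phi> t)"
    using assms(1) unfolding reparam_equiv_def by blast
  obtain \<psi> where \<psi>: "reparametrization \<psi>" "\<forall>t\<in>{0..1}. z t = y (\<psi> t)"
    using assms(2) unfolding reparam_equiv_def by blast
  note m = reparam_mem[OF \<psi>(1)]
  show ?thesis
  proof (rule reparam_equivI[of "\<lambda>t. \<phi> (\<psi> t)"])
    show "reparametrization (\<lambda>t. \<phi> (\<psi> t))"
    proof (rule reparamI)
      show "continuous_on {0..1} (\<lambda>t. \<phi> (\<psi> t))"
        using m \<psi>(1) by (intro continuous_on_reparam[OF \<phi>(1)]) (auto simp: reparametrization_def)
      show "\<phi> (\<psi> s) < \<phi> (\<psi> t)" if "0 \<le> s" "s < t" "t \<le> 1" for s t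
        using m[of s] m[of t] that
        by (intro reparam_less[OF \<phi>(1)] reparam_less[OF \<psi>(1)]) auto
    qed (use \<phi>(1) \<psi>(1) in \<open>auto simp: reparametrization_def\<close>)
    show "z t = x (\<phi> (\<psi> t))" if "0 \<le> t" "t \<le> 1" for t
      using \<phi>(2) \<psi>(2) m[of t] that by auto
  qed
qed

lemma reparam_sym:
  assumes "x \<simeq> y" shows "y \<simeq> x"
proof -
  obtain \<phi> where \<phi>: "reparametrization \<phi>" "\<forall>t\<in>{0..1}. y t = x (\<phi> t)"
    using assms unfolding reparam_equiv_def by blast
  have c: "continuous_on {0..1} \<phi>" and ends: "\<phi> 0 = 0" "\<phi> 1 = 1"
    using \<phi>(1) by (auto simp: reparametrization_def)
  have inj: "inj_on \<phi> {0..1}"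
    using \<phi>(1) by (auto simp: reparametrization_def intro: strict_mono_on_imp_inj_on)
  have im: "\<phi> ` {0..1} = {0..1}"
  proof
    show "\<phi> ` {0..1} \<subseteq> {0..1}" using reparam_mem[OF \<phi>(1)] by blast
    show "{0..1} \<subseteq> \<phi> ` {0..1}"
    proof
      fix s :: real assume "s \<in> {0..1}"
      then obtain t where "0 \<le> t" "t \<le> 1" "\<phi> t = s" using IVT'[of \<phi> 0 s 1] ends c by auto
      then show "s \<in> \<phi> ` {0..1}" by force
    qed
  qed
  define \<psi> where "\<psi> = inv_into {0..1} \<phi>"
  have \<psi>: "\<psi> s \<in> {0..1}" "\<phi> (\<psi> s) = s" if "s \<in> {0..1}" for s
    using inv_into_into[of s \<phi> "{0..1}"] f_inv_into_f[of s \<phi> "{0..1}"] im that by (simp_all add: \<psi>_def)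
  have "reparametrization \<psi>"
  proof (rule reparamI)
    show "continuous_on {0..1} \<psi>"
      using continuous_on_inv[OF c compact_Icc, of \<psi>] im inj by (simp add: \<psi>_def)
    show "\<psi> s < \<psi> t" if "0 \<le> s" "s < t" "t \<le> 1" for s t
    proof (rule ccontr)
      assume "\<not> \<psi> s < \<psi> t"
      then have "\<psi> t < \<psi> s \<or> \<psi> t = \<psi> s" by auto
      then have "\<phi> (\<psi> t) \<le> \<phi> (\<psi> s)"
        using reparam_less[OF \<phi>(1), of "\<psi> t" "\<psi> s"] \<psi>(1)[of s] \<psi>(1)[of t] that by force
      then show False using \<psi>(2)[of s] \<psi>(2)[of t] that by simp
    qed
    show "\<psi> 0 = 0" using inv_into_f_f[OF inj, of 0] ends by (simp add: \<psi>_def)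
    show "\<psi> 1 = 1" using inv_into_f_f[OF inj, of 1] ends by (simp add: \<psi>_def)
  qed
  then show ?thesis
    by (rule reparam_equivI) (use \<phi>(2) \<psi> in auto)
qed

lemma reparam_ends: "x \<simeq> y \<Longrightarrow> y 0 = x 0 \<and> y 1 = x 1"
  unfolding reparam_equiv_def reparametrization_def by auto

lemma reparam_join:
  assumes "x \<simeq> x'" "y \<simeq> y'" shows "reparam_equiv (x +++ y) (x' +++ y')"
proof -
  obtain \<phi> where \<phi>: "reparametrization \<phi>" "\<forall>t\<in>{0..1}. x' t = x (\<phi> t)"
    using assms(1) unfolding reparam_equiv_def by blast
  obtain \<psi> where \<psi>: "reparametrization \<psi>" "\<forall>t\<in>{0..1}. y' t = y (\<psi> t)"
    using assms(2) unfolding reparam_equiv_def by blast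
  have ends: "\<phi> 0 = 0" "\<phi> 1 = 1" "\<psi> 0 = 0" "\<psi> 1 = 1"
    using \<phi>(1) \<psi>(1) by (auto simp: reparametrization_def)
  define \<eta> where "\<eta> = (\<lambda>t. \<phi> t / 2) +++ (\<lambda>t. (\<psi> t + 1) / 2)"
  note \<eta>_def = \<eta>_def joinpaths_def
  have lo: "\<eta> t \<le> 1 / 2" if "0 \<le> t" "t \<le> 1 / 2" for t
    using reparam_mem[OF \<phi>(1), of "2 * t"] that by (simp add: \<eta>_def)
  have hi: "\<eta> t > 1 / 2" if "1 / 2 < t" "t \<le> 1" for t
    using reparam_less[OF \<psi>(1), of 0 "2 * t - 1"] that ends by (simp add: \<eta>_def)
  show ?thesis
  proof (rule reparam_equivI[of \<eta>])
    show "reparametrization \<eta>"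
    proof (rule reparamI)
      show "continuous_on {0..1} \<eta>"
        unfolding \<eta>_def(1) using \<phi>(1) \<psi>(1)
        by (intro continuous_on_joinpaths continuous_intros)
          (auto simp: reparametrization_def pathfinish_def pathstart_def)
      show "\<eta> s < \<eta> t" if "0 \<le> s" "s < t" "t \<le> 1" for s t
      proof -
        consider "t \<le> 1 / 2" | "s \<le> 1 / 2" "1 / 2 < t" | "1 / 2 < s" using that by linarith
        then show ?thesis
        proof cases
          case 1
          then show ?thesis
            using reparam_less[OF \<phi>(1), of "2 * s" "2 * t"] that by (simp add: \<eta>_def)
        next
          case 2
          then show ?thesis using lo[of s] hi[of t] that by simp
        next
          case 3
          then show ?thesis
            using reparam_less[OF \<psi>(1), of "2 * s - 1" "2 * t - 1"] that by (simp add: \<eta>_def)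
        qed
      qed
    qed (simp_all add: \<eta>_def ends)
    show "(x' +++ y') t = (x +++ y) (\<eta> t)" if "0 \<le> t" "t \<le> 1" for t
    proof (cases "t \<le> 1 / 2")
      case True
      then have "(x +++ y) (\<eta> t) = x (\<phi> (2 * t))" using lo[of t] that by (simp add: joinpaths_def) (simp add: \<eta>_def)
      then show ?thesis using \<phi>(2) True that by (simp add: joinpaths_def)
    next
      case False
      then have "2 * \<eta> t - 1 = \<psi> (2 * t - 1)" by (simp add: \<eta>_def field_simps)
      then have "(x +++ y) (\<eta> t) = y (\<psi> (2 * t - 1))" using hi[of t] False that by (simp add: joinpaths_def)
      then show ?thesis using \<psi>(2) False that by (simp add: joinpaths_def)
    qed
  qed
qed

lemma reparam_refl: "x \<simeq> x"
  by (rule reparam_cong) simp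

lemma reparam_assoc: "reparam_equiv ((x +++ y) +++ z) (x +++ (y +++ z))"
proof (rule reparam_equivI)
  \<comment> \<open>The quarters \<open>[0, 1/4]\<close> and \<open>[1/4, 1/2]\<close> and the half
    \<open>[1/2, 1]\<close> are reached with slopes \<open>1 / 2\<close>, \<open>1\<close> and
    \<open>2\<close>. As the slopes increase, the piecewise linear map is the maximum of its three
    lines.\<close>
  let ?\<phi> = "\<lambda>t :: real. max (t / 2) (max (t - 1 / 4) (2 * t - 1))"
  show "reparametrization ?\<phi>"
  proof (rule reparamI)
    show "continuous_on {0..1} ?\<phi>" by (intro continuous_intros) auto
  qed (auto simp: max_def)
  show "(x +++ (y +++ z)) t = ((x +++ y) +++ z) (?\<phi> t)" if "0 \<le> t" "t \<le> 1" for t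
  proof -
    consider "t \<le> 1 / 2" | "1 / 2 < t" "t \<le> 3 / 4" | "3 / 4 < t" by linarith
    then show ?thesis
    proof cases
      case 1
      then have "?\<phi> t = t / 2" by (simp add: max_def)
      with 1 show ?thesis by (simp add: joinpaths_def)
    next
      case 2
      then have "?\<phi> t = t - 1 / 4" by (simp add: max_def)
      with 2 show ?thesis by (simp add: joinpaths_def algebra_simps)
    next
      case 3
      then have "?\<phi> t = 2 * t - 1" by (simp add: max_def)
      with 3 show ?thesis by (simp add: joinpaths_def algebra_simps)
    qed
  qed
qed

text \<open>The two halves of \<open>constant_near_ends\<close> are separated because an initial or
  final piece of a path keeps only the condition at the end which it shares with the path.\<close>

definition const_start :: "(real \<Rightarrow> 'b) \<Rightarrow> bool" where
  "const_start x \<longleftrightarrow> (\<exists>\<delta>>0. \<forall>t\<in>{0..1}. t < \<delta> \<longrightarrow> x t = x 0)"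

definition const_finish :: "(real \<Rightarrow> 'b) \<Rightarrow> bool" where
  "const_finish x \<longleftrightarrow> (\<exists>\<delta>>0. \<forall>t\<in>{0..1}. 1 - \<delta> < t \<longrightarrow> x t = x 1)"

lemma constant_near_ends_iff:
  "constant_near_ends x \<longleftrightarrow> const_start x \<and> const_finish x"
proof
  assume "constant_near_ends x"
  then obtain \<delta> where \<delta>: "\<delta> > 0" "\<forall>t\<in>{0..1}. (t < \<delta> \<longrightarrow> x t = x 0) \<and> (1 - \<delta> < t \<longrightarrow> x t = x 1)"
    unfolding constant_near_ends_def by (elim exE conjE)
  show "const_start x \<and> const_finish x"
    unfolding const_start_def const_finish_def
    by (intro conjI exI[of _ \<delta>] ballI) (rule \<delta>(1) bspec[OF \<delta>(2), THEN conjunct1] bspec[OF \<delta>(2), THEN conjunct2], assumption?)+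
next
  assume *: "const_start x \<and> const_finish x"
  obtain \<delta> where \<delta>: "\<delta> > 0" "\<forall>t\<in>{0..1}. t < \<delta> \<longrightarrow> x t = x 0"
    using conjunct1[OF *] unfolding const_start_def by (elim exE conjE)
  obtain \<delta>' where \<delta>': "\<delta>' > 0" "\<forall>t\<in>{0..1}. 1 - \<delta>' < t \<longrightarrow> x t = x 1"
    using conjunct2[OF *] unfolding const_finish_def by (elim exE conjE)
  show "constant_near_ends x"
    unfolding constant_near_ends_def
  proof (intro exI[of _ "min \<delta> \<delta>'"] conjI ballI impI)
    show "min \<delta> \<delta>' > 0" using \<delta>(1) \<delta>'(1) by simp
    show "x t = x 0" if "t \<in> {0..1}" "t < min \<delta> \<delta>'" for t
      by (rule \<delta>(2)[rule_format]) (use that in auto)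
    show "x t = x 1" if "t \<in> {0..1}" "1 - min \<delta> \<delta>' < t" for t
      by (rule \<delta>'(2)[rule_format]) (use that in auto)
  qed
qed

text \<open>The constant half cannot be collapsed by a strictly increasing map. Instead the interval
  \<open>{0..d}\<close>, on which \<open>x\<close> is already constant, is stretched over the
  constant half and a bit beyond.\<close>

lemma reparam_unit_left:
  assumes "const_start x" shows "reparam_equiv x ((\<lambda>_. x 0) +++ x)"
proof -
  obtain \<delta> where \<delta>: "\<delta> > 0" "\<forall>t\<in>{0..1}. t < \<delta> \<longrightarrow> x t = x 0"
    using assms unfolding const_start_def by (elim exE conjE)
  define d where "d = min \<delta> 1 / 2"
  have d: "0 < d" "d < 1" "d < \<delta>" using \<delta>(1) by (auto simp: d_def)
  have const: "x t = x 0" if "0 \<le> t" "t \<le> d" for t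
    by (rule \<delta>(2)[rule_format]) (use that d in auto)
  \<comment> \<open>The slope for which the line \<open>k * t\<close> meets the line
    \<open>2 * t - 1\<close> of the second half exactly at height \<open>d\<close>, namely at
    \<open>t = (1 + d) / 2\<close>.\<close>
  define k where "k = 2 * d / (1 + d)"
  have k: "0 < k" "k < 1" "k * (1 + d) = 2 * d" "k < 2 * d" using d by (auto simp: k_def divide_simps)
  show ?thesis
  proof (rule reparam_equivI)
    let ?\<phi> = "\<lambda>t. max (k * t) (2 * t - 1)"
    show "reparametrization ?\<phi>"
    proof (rule reparamI)
      show "continuous_on {0..1} ?\<phi>" by (intro continuous_intros)
      show "?\<phi> s < ?\<phi> t" if "s < t" for s t
      proof -
        have mx: "max a b < max a' b'" if "a < a'" "b < b'" for a b a' b' :: real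
          using that by (auto simp: max_def)
        show ?thesis by (rule mx) (use k(1) that in simp_all)
      qed
    qed (use k in auto)
    show "((\<lambda>_. x 0) +++ x) t = x (?\<phi> t)" if t: "0 \<le> t" "t \<le> 1" for t
    proof (cases "?\<phi> t \<le> d")
      case True
      have "x (?\<phi> t) = x 0" by (rule const) (use True k t in \<open>auto simp: le_max_iff_disj\<close>)
      moreover have "x (2 * t - 1) = x 0" if "t > 1 / 2" by (rule const) (use True that in auto)
      ultimately show ?thesis unfolding joinpaths_def by simp
    next
      case False
      have "\<not> k * t > d \<or> t > (1 + d) / 2"
      proof (rule ccontr)
        assume "\<not> (\<not> k * t > d \<or> t > (1 + d) / 2)"
        then have "k * t > d" "k * t \<le> k * ((1 + d) / 2)" using k(1) by (auto intro: mult_left_mono)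
        with k(3) show False by simp
      qed
      with False have t2: "t > (1 + d) / 2" by auto
      have "(2 - k) * t \<ge> (2 - k) * ((1 + d) / 2)" using t2 k by (intro mult_left_mono) auto
      with k(3) have "k * t \<le> 2 * t - 1" by (simp add: algebra_simps)
      then show ?thesis using t2 d by (simp add: joinpaths_def max_def)
    qed
  qed
qed

lemma reversepath_join_const: "reversepath (x +++ y) t = (reversepath y +++ reversepath x) t" if "x 1 = y 0"
  using that by (auto simp: reversepath_def joinpaths_def algebra_simps intro: arg_cong)

lemma reparam_reversepath:
  assumes "x \<simeq> y" shows "reparam_equiv (reversepath x) (reversepath y)"
proof -
  obtain \<phi> where \<phi>: "reparametrization \<phi>" "\<forall>t\<in>{0..1}. y t = x (\<phi> t)"
    using assms unfolding reparam_equiv_def by blast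
  show ?thesis
  proof (rule reparam_equivI)
    show "reparametrization (\<lambda>t. 1 - \<phi> (1 - t))"
    proof (rule reparamI)
      show "continuous_on {0..1} (\<lambda>t. 1 - \<phi> (1 - t))"
        by (intro continuous_intros continuous_on_reparam[OF \<phi>(1)]) auto
      show "1 - \<phi> (1 - s) < 1 - \<phi> (1 - t)" if "0 \<le> s" "s < t" "t \<le> 1" for s t
        using reparam_less[OF \<phi>(1), of "1 - t" "1 - s"] that by simp
    qed (use \<phi>(1) in \<open>auto simp: reparametrization_def\<close>)
  qed (use \<phi>(2) in \<open>auto simp: reversepath_def\<close>)
qed

lemma reparam_unit_right:
  assumes "const_finish x" shows "reparam_equiv x (x +++ (\<lambda>_. x 1))"
proof -
  obtain \<delta> where \<delta>: "\<delta> > 0" "\<forall>t\<in>{0..1}. 1 - \<delta> < t \<longrightarrow> x t = x 1"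
    using assms unfolding const_finish_def by (elim exE conjE)
  have "reversepath x t = reversepath x 0" if "t \<in> {0..1}" "t < \<delta>" for t
    using \<delta>(2)[rule_format, of "1 - t"] that by (simp add: reversepath_def)
  with \<delta>(1) have "const_start (reversepath x)"
    unfolding const_start_def by (intro exI[of _ \<delta>] conjI ballI impI)
  from reparam_reversepath[OF reparam_unit_left[OF this]]
  have "reparam_equiv x (reversepath ((\<lambda>_. x 1) +++ reversepath x))"
    by (simp add: reversepath_def)
  moreover have "reversepath ((\<lambda>_. x 1) +++ reversepath x) = x +++ (\<lambda>_. x 1)"
  proof
    fix t
    have "reversepath ((\<lambda>_. x 1) +++ reversepath x) t = (reversepath (reversepath x) +++ reversepath (\<lambda>_. x 1)) t"
      by (rule reversepath_join_const) (simp add: reversepath_def)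
    then show "reversepath ((\<lambda>_. x 1) +++ reversepath x) t = (x +++ (\<lambda>_. x 1)) t"
      by (simp add: reversepath_def)
  qed
  ultimately show ?thesis by simp
qed

text \<open>Cutting at the image of \<open>1 / 2\<close> exhibits \<open>p\<close> and
  \<open>q\<close>, up to reparametrization, as affine pieces of \<open>x\<close>. Smoothness and
  constancy near an end can then be read off from \<open>x\<close>, even where \<open>p\<close> and
  \<open>q\<close> lack the latter.\<close>

lemma reparam_split:
  assumes "reparam_equiv x (p +++ q)" "p 1 = q 0"
  obtains a where "0 < a" "a < 1" "reparam_equiv (\<lambda>u. x (a * u)) p" "reparam_equiv (\<lambda>u. x (a + (1 - a) * u)) q"
proof -
  obtain \<phi> where \<phi>: "reparametrization \<phi>" "\<forall>t\<in>{0..1}. (p +++ q) t = x (\<phi> t)"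
    using assms unfolding reparam_equiv_def by blast
  have ends: "\<phi> 0 = 0" "\<phi> 1 = 1" and c: "continuous_on {0..1} \<phi>" using \<phi>(1) by (auto simp: reparametrization_def)
  define a where "a = \<phi> (1 / 2)"
  have a: "0 < a" "a < 1"
    using reparam_less[OF \<phi>(1), of 0 "1 / 2"] reparam_less[OF \<phi>(1), of "1 / 2" 1] ends
    by (auto simp: a_def)
  have "reparam_equiv (\<lambda>u. x (a * u)) p"
  proof (rule reparam_equivI)
    show "reparametrization (\<lambda>u. \<phi> (u / 2) / a)"
    proof (rule reparamI)
      show "continuous_on {0..1} (\<lambda>u. \<phi> (u / 2) / a)"
        using a by (intro continuous_intros continuous_on_reparam[OF \<phi>(1)]) auto
      show "\<phi> (s / 2) / a < \<phi> (t / 2) / a" if "0 \<le> s" "s < t" "t \<le> 1" for s t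
        using reparam_less[OF \<phi>(1), of "s / 2" "t / 2"] that a by (intro divide_strict_right_mono) auto
    qed (use ends a in \<open>simp_all add: a_def\<close>)
    show "p t = x (a * (\<phi> (t / 2) / a))" if "0 \<le> t" "t \<le> 1" for t
      using \<phi>(2)[rule_format, of "t / 2"] that a by (simp add: joinpaths_def)
  qed
  moreover have "reparam_equiv (\<lambda>u. x (a + (1 - a) * u)) q"
  proof (rule reparam_equivI)
    show "reparametrization (\<lambda>u. (\<phi> ((u + 1) / 2) - a) / (1 - a))"
    proof (rule reparamI)
      show "continuous_on {0..1} (\<lambda>u. (\<phi> ((u + 1) / 2) - a) / (1 - a))"
        using a by (intro continuous_intros continuous_on_reparam[OF \<phi>(1)]) auto
      show "(\<phi> ((s + 1) / 2) - a) / (1 - a) < (\<phi> ((t + 1) / 2) - a) / (1 - a)" if "0 \<le> s" "s < t" "t \<le> 1" for s t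
        using reparam_less[OF \<phi>(1), of "(s + 1) / 2" "(t + 1) / 2"] that a by (intro divide_strict_right_mono) auto
    qed (use ends a in \<open>simp_all add: a_def\<close>)
    show "q t = x (a + (1 - a) * ((\<phi> ((t + 1) / 2) - a) / (1 - a)))" if t: "0 \<le> t" "t \<le> 1" for t
    proof -
      \<comment> \<open>At \<open>t = 0\<close> the point \<open>1 / 2\<close> belongs to the first
        half of the join; there \<open>p 1 = q 0\<close> is used.\<close>
      have "q t = (p +++ q) ((t + 1) / 2)"
        using t assms(2) by (cases "t = 0") (auto simp: joinpaths_def field_simps)
      also have "\<dots> = x (\<phi> ((t + 1) / 2))" using \<phi>(2)[rule_format, of "(t + 1) / 2"] t by simp
      finally show ?thesis using a by simp
    qed
  qed
  ultimately show thesis using that a by blast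
qed

lemma elementary_bt_iff:
  "elementary_bt P x y \<longleftrightarrow> (\<exists>l\<^sub>1\<in>P. \<exists>l\<^sub>2\<in>P. \<exists>l\<^sub>3\<in>P. l\<^sub>3 1 = l\<^sub>2 0 \<and> l\<^sub>2 0 = l\<^sub>1 0 \<and>
     reparam_equiv x ((l\<^sub>3 +++ l\<^sub>2) +++ (reversepath l\<^sub>2 +++ l\<^sub>1)) \<and> reparam_equiv y (l\<^sub>3 +++ l\<^sub>1))"
  unfolding elementary_bt_def reparam_equiv_def by (simp only: eq_commute[of "_ (_::real)" "(_ +++ _) _"]) blast

section \<open>Back-track classes and the double category\<close>

lemma const_start_affine:
  assumes "const_start x" "0 < a" "a \<le> 1" shows "const_start (\<lambda>u. x (a * u))"
proof -
  obtain d where d: "d > 0" "\<forall>t\<in>{0..1}. t < d \<longrightarrow> x t = x 0"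
    using assms(1) unfolding const_start_def by (elim exE conjE)
  have "x (a * u) = x (a * 0)" if u: "u \<in> {0..1}" "u < d" for u
  proof -
    have "a * u \<le> 1 * u" using assms u by (intro mult_right_mono) auto
    then have "a * u \<in> {0..1}" "a * u < d" using assms u by auto
    from d(2)[rule_format, OF this] show ?thesis by simp
  qed
  with d(1) show ?thesis unfolding const_start_def by (intro exI[of _ d] conjI ballI impI)
qed

lemma const_finish_affine:
  assumes "const_finish x" "0 \<le> a" "a < 1" shows "const_finish (\<lambda>u. x (a + (1 - a) * u))"
proof -
  obtain d where d: "d > 0" "\<forall>t\<in>{0..1}. 1 - d < t \<longrightarrow> x t = x 1"
    using assms(1) unfolding const_finish_def by (elim exE conjE)
  have "x (a + (1 - a) * u) = x (a + (1 - a) * 1)" if u: "u \<in> {0..1}" "1 - d < u" for u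
  proof -
    have *: "1 - (a + (1 - a) * u) = (1 - a) * (1 - u)" by (simp add: algebra_simps)
    have "(1 - a) * (1 - u) \<le> 1 * (1 - u)" "0 \<le> (1 - a) * (1 - u)" "0 \<le> (1 - a) * u"
      using assms u mult_right_mono[of "1 - a" 1 "1 - u"] by auto
    then have "a + (1 - a) * u \<in> {0..1}" "1 - d < a + (1 - a) * u" using * assms u by auto
    from d(2)[rule_format, OF this] show ?thesis by simp
  qed
  with d(1) show ?thesis unfolding const_finish_def by (intro exI[of _ d] conjI ballI impI)
qed

lemma const_start_join:
  assumes "const_start x" shows "const_start (x +++ y)"
proof -
  obtain d where d: "d > 0" "\<forall>t\<in>{0..1}. t < d \<longrightarrow> x t = x 0"
    using assms(1) unfolding const_start_def by (elim exE conjE)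
  have "(x +++ y) t = (x +++ y) 0" if t: "t \<in> {0..1}" "t < min (1 / 2) (d / 2)" for t
    using d(2)[rule_format, of "2 * t"] t by (simp add: joinpaths_def)
  moreover have "min (1 / 2) (d / 2) > 0" using d(1) by simp
  ultimately show ?thesis
    unfolding const_start_def by (intro exI[of _ "min (1 / 2) (d / 2)"] conjI ballI impI)
qed

lemma const_finish_join:
  assumes "const_finish y" shows "const_finish (x +++ y)"
proof -
  obtain d where d: "d > 0" "\<forall>t\<in>{0..1}. 1 - d < t \<longrightarrow> y t = y 1"
    using assms(1) unfolding const_finish_def by (elim exE conjE)
  have "(x +++ y) t = (x +++ y) 1" if t: "t \<in> {0..1}" "1 - min (1 / 2) (d / 2) < t" for t
  proof -
    have "1 / 2 < t" "1 - d / 2 < t" using t(2) by linarith+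
    then show ?thesis using d(2)[rule_format, of "2 * t - 1"] t(1) by (simp add: joinpaths_def)
  qed
  moreover have "min (1 / 2) (d / 2) > 0" using d(1) by simp
  ultimately show ?thesis
    unfolding const_finish_def by (intro exI[of _ "min (1 / 2) (d / 2)"] conjI ballI impI)
qed

context riemannian
begin

lemma bundle_smooth_affine:
  assumes x: "bundle_smooth A J x" and \<psi>: "\<And>u. u \<in> J' \<Longrightarrow> a + b * u \<in> J"
  shows "bundle_smooth A J' (\<lambda>u. x (a + b * u))"
  unfolding bundle_smooth_def
proof (intro ballI conjI)
  fix t assume t: "t \<in> J'"
  show "x (a + b * t) \<in> TB" using x \<psi>[OF t] by (auto simp: bundle_smooth_def)
  obtain c U where c: "c \<in> A" and U: "open U" "a + b * t \<in> U" "\<forall>u\<in>J \<inter> U. fst (x u) \<in> fst c"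
    "smooth_within (J \<inter> U) (\<lambda>u. phase c (x u))"
    using x \<psi>[OF t] unfolding bundle_smooth_def locally_smooth_def by blast
  define U' where "U' = (\<lambda>u. a + b * u) -` U"
  have "open U'" unfolding U'_def by (rule open_vimage[OF U(1)]) (intro continuous_intros)
  moreover have "t \<in> U'" using U(2) by (simp add: U'_def)
  moreover have "\<forall>u\<in>J' \<inter> U'. fst (x (a + b * u)) \<in> fst c" using U(3) \<psi> by (simp add: U'_def)
  moreover have "ndiff k (J' \<inter> U') (\<lambda>u. phase c (x (a + b * u)))" for k
  proof (rule ndiff_compose[OF _ spec[OF U(4), of k]])
    show "ndiff k (J' \<inter> U') (\<lambda>u. a + b * u)"
      by (intro ndiff_add ndiff_const ndiff_linear bounded_linear_mult_right)
  qed (use \<psi> in \<open>simp add: U'_def\<close>)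
  ultimately show "locally_smooth A J' (\<lambda>u. x (a + b * u)) t"
    unfolding locally_smooth_def using c by blast
qed

lemma bundle_smooth_const: "v \<in> TB \<Longrightarrow> bundle_smooth A J (\<lambda>_. v)"
proof -
  assume v: "v \<in> TB"
  obtain c where "c \<in> A" "fst v \<in> fst c" by (rule chart_cover)
  then show ?thesis
    using v unfolding bundle_smooth_def locally_smooth_def
    by (intro ballI conjI bexI[of _ c] exI[of _ UNIV]) auto
qed

text \<open>Away from \<open>1 / 2\<close> the join is an affine reparametrization of a smooth
  curve. Around \<open>1 / 2\<close> it is constant, since \<open>x\<close> is constant near its end
  and \<open>y\<close> near its start with the same value, so no derivatives have to be
  matched.\<close>

lemma bundle_smooth_join:
  assumes x: "bundle_smooth A {0..1} x" and y: "bundle_smooth A {0..1} y"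
    and xf: "const_finish x" and ys: "const_start y" and xy: "x 1 = y 0"
  shows "bundle_smooth A {0..1} (x +++ y)"
  unfolding bundle_smooth_def
proof (intro ballI conjI)
  fix t :: real assume t: "t \<in> {0..1}"
  show "(x +++ y) t \<in> TB" using x y t by (auto simp: bundle_smooth_def joinpaths_def)
  consider "t < 1 / 2" | "t = 1 / 2" | "t > 1 / 2" by linarith
  then show "locally_smooth A {0..1} (x +++ y) t"
  proof cases
    case 1
    have "bundle_smooth A {0..1 / 2} (\<lambda>u. x (0 + 2 * u))" by (rule bundle_smooth_affine[OF x]) auto
    then have "locally_smooth A {0..1 / 2} (\<lambda>u. x (0 + 2 * u)) t" using t 1 by (simp add: bundle_smooth_def)
    then show ?thesis
      using 1 by (rule_tac locally_smooth_cong[of "{..<1 / 2}" _ _ "{0..1 / 2}"]) (auto simp: joinpaths_def)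
  next
    case 3
    have "bundle_smooth A {1 / 2..1} (\<lambda>u. y (- 1 + 2 * u))" by (rule bundle_smooth_affine[OF y]) auto
    then have "locally_smooth A {1 / 2..1} (\<lambda>u. y (- 1 + 2 * u)) t" using t 3 by (simp add: bundle_smooth_def)
    then show ?thesis
      using 3 by (rule_tac locally_smooth_cong[of "{1 / 2<..}" _ _ "{1 / 2..1}"]) (auto simp: joinpaths_def)
  next
    case 2
    obtain d where d: "d > 0" "\<forall>t\<in>{0..1}. 1 - d < t \<longrightarrow> x t = x 1"
      using xf unfolding const_finish_def by (elim exE conjE)
    obtain d' where d': "d' > 0" "\<forall>t\<in>{0..1}. t < d' \<longrightarrow> y t = y 0"
      using ys unfolding const_start_def by (elim exE conjE)
    have "y 0 \<in> TB" using y by (auto simp: bundle_smooth_def)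
    then have "locally_smooth A {0..1} (\<lambda>_. y 0) t"
      using bundle_smooth_const t unfolding bundle_smooth_def by blast
    then show ?thesis
    proof (rule locally_smooth_cong[of "{1 / 2 - d / 2<..<1 / 2 + d' / 2}", rotated -1])
      fix u assume u: "u \<in> {0..1} \<inter> {1 / 2 - d / 2<..<1 / 2 + d' / 2}"
      show "y 0 = (x +++ y) u"
        using d(2)[rule_format, of "2 * u"] d'(2)[rule_format, of "2 * u - 1"] u xy
        by (simp add: joinpaths_def field_simps)
    qed (use 2 d(1) d'(1) in auto)
  qed
qed

lemma TPM_const: "v \<in> TB \<Longrightarrow> (\<lambda>_. v) \<in> TPM A"
  by (simp add: TPM_iff bundle_smooth_const)

lemma TPM_affine: "x \<in> TPM A \<Longrightarrow> (\<And>u. u \<in> {0..1} \<Longrightarrow> a + b * u \<in> {0..1}) \<Longrightarrow> (\<lambda>u. x (a + b * u)) \<in> TPM A"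
  unfolding TPM_iff by (rule bundle_smooth_affine)

lemma TPM_join:
  "x \<in> TPM A \<Longrightarrow> y \<in> TPM A \<Longrightarrow> const_finish x \<Longrightarrow> const_start y \<Longrightarrow> x 1 = y 0 \<Longrightarrow> x +++ y \<in> TPM A"
  unfolding TPM_iff by (rule bundle_smooth_join)

lemma TPMc_iff: "x \<in> TPMc A \<longleftrightarrow> x \<in> TPM A \<and> const_start x \<and> const_finish x"
  by (simp add: TPMc_def constant_near_ends_iff)

lemma TPM_lower: "x \<in> TPM A \<Longrightarrow> 0 < a \<Longrightarrow> a < 1 \<Longrightarrow> (\<lambda>u. x (a * u)) \<in> TPM A"
  using TPM_affine[of x 0 a] by (simp add: mult_le_one)

lemma TPM_upper:
  assumes "x \<in> TPM A" "0 < a" "a < 1" shows "(\<lambda>u. x (a + (1 - a) * u)) \<in> TPM A"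
proof (rule TPM_affine[OF assms(1)])
  fix u :: real assume "u \<in> {0..1}"
  then have "0 \<le> (1 - a) * u" "(1 - a) * u \<le> 1 - a" using assms mult_left_mono[of u 1 "1 - a"] by auto
  then show "a + (1 - a) * u \<in> {0..1}" using assms unfolding atLeastAtMost_iff by linarith
qed

lemma TPMc_const: "v \<in> TB \<Longrightarrow> (\<lambda>_. v) \<in> TPMc A"
  by (auto simp: TPMc_iff TPM_const const_start_def const_finish_def intro: exI[of _ 1])

lemma TPMc_join: "x \<in> TPMc A \<Longrightarrow> y \<in> TPMc A \<Longrightarrow> x 1 = y 0 \<Longrightarrow> x +++ y \<in> TPMc A"
  unfolding TPMc_iff using TPM_join const_start_join const_finish_join by blast

lemma TPMc_mem: "x \<in> TPMc A \<Longrightarrow> t \<in> {0..1} \<Longrightarrow> x t \<in> TB"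
  by (simp add: TPMc_def TPM_iff bundle_smooth_def)

text \<open>The path \<open>l\<^sub>1\<close> of an elementary equivalence need not be constant near its end point. It is
  replaced by the last piece of \<open>x\<close>, of which it is a reparametrization, before \<open>y\<close> is attached.\<close>

lemma elementary_bt_join_right:
  assumes x: "x \<in> TPMc A" and e: "elementary_bt (TPM A) x x'" and y: "y \<in> TPMc A" "x 1 = y 0"
  shows "elementary_bt (TPM A) (x +++ y) (x' +++ y)"
proof -
  obtain l1 l2 l3 where l: "l1 \<in> TPM A" "l2 \<in> TPM A" "l3 \<in> TPM A" "l3 1 = l2 0" "l2 0 = l1 0"
    "reparam_equiv x ((l3 +++ l2) +++ (reversepath l2 +++ l1))" "reparam_equiv x' (l3 +++ l1)"
    using e unfolding elementary_bt_iff by blast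
  have "(l3 +++ l2) 1 = (reversepath l2 +++ l1) 0" by (simp add: joinpaths_def reversepath_def)
  with l(6) obtain a where a: "0 < a" "a < 1" "reparam_equiv (\<lambda>u. x (a + (1 - a) * u)) (reversepath l2 +++ l1)"
    by (rule reparam_split)
  have "reversepath l2 1 = l1 0" using l(5) by (simp add: reversepath_def)
  with a(3) obtain b where b: "0 < b" "b < 1" "reparam_equiv (\<lambda>u. x (a + (1 - a) * (b + (1 - b) * u))) l1"
    by (rule reparam_split)
  define m where "m = (\<lambda>u. x (a + (1 - a) * (b + (1 - b) * u)))"
  have m: "m \<in> TPM A" "const_finish m" "m \<simeq> l1" "l1 \<simeq> m"
    using x TPM_upper[OF TPM_upper[of x a] b(1,2)] a b reparam_sym[OF b(3)]
      const_finish_affine[OF const_finish_affine[of x a], of b]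
    by (auto simp: m_def TPMc_iff)
  have ends: "m 0 = l1 0" "m 1 = y 0" using reparam_ends[OF m(3)] y(2) by (simp_all add: m_def)
  have my: "m +++ y \<in> TPM A" using m y ends by (intro TPM_join) (auto simp: TPMc_iff)
  have "reparam_equiv (x +++ y) (((l3 +++ l2) +++ (reversepath l2 +++ m)) +++ y)"
    by (intro reparam_join reparam_refl reparam_trans[OF l(6)] m(4))
  also have "reparam_equiv \<dots> ((l3 +++ l2) +++ ((reversepath l2 +++ m) +++ y))" by (rule reparam_assoc)
  also have "reparam_equiv \<dots> ((l3 +++ l2) +++ (reversepath l2 +++ (m +++ y)))"
    by (intro reparam_join reparam_refl reparam_assoc)
  finally have 1: "reparam_equiv (x +++ y) ((l3 +++ l2) +++ (reversepath l2 +++ (m +++ y)))" .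
  have "reparam_equiv (x' +++ y) ((l3 +++ m) +++ y)"
    by (intro reparam_join reparam_refl reparam_trans[OF l(7)] m(4))
  also have "reparam_equiv \<dots> (l3 +++ (m +++ y))" by (rule reparam_assoc)
  finally have 2: "reparam_equiv (x' +++ y) (l3 +++ (m +++ y))" .
  have "l2 0 = (m +++ y) 0" using l(5) ends by (simp add: joinpaths_def)
  with 1 2 my l(2,3,4) show ?thesis unfolding elementary_bt_iff by blast
qed

text \<open>The mirror image: \<open>y\<close> is now attached in front of \<open>l3\<close>, so
  this piece is exchanged for the first piece of \<open>x\<close>, which is constant near
  \<open>0\<close>.\<close>

lemma elementary_bt_join_left:
  assumes x: "x \<in> TPMc A" and e: "elementary_bt (TPM A) x x'" and y: "y \<in> TPMc A" "y 1 = x 0"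
  shows "elementary_bt (TPM A) (y +++ x) (y +++ x')"
proof -
  obtain l1 l2 l3 where l: "l1 \<in> TPM A" "l2 \<in> TPM A" "l3 \<in> TPM A" "l3 1 = l2 0" "l2 0 = l1 0"
    "reparam_equiv x ((l3 +++ l2) +++ (reversepath l2 +++ l1))" "reparam_equiv x' (l3 +++ l1)"
    using e unfolding elementary_bt_iff by blast
  have "(l3 +++ l2) 1 = (reversepath l2 +++ l1) 0" by (simp add: joinpaths_def reversepath_def)
  with l(6) obtain a where a: "0 < a" "a < 1" "reparam_equiv (\<lambda>u. x (a * u)) (l3 +++ l2)"
    by (rule reparam_split)
  from a(3) l(4) obtain b where b: "0 < b" "b < 1" "reparam_equiv (\<lambda>u. x (a * (b * u))) l3"
    by (rule reparam_split)
  define m where "m = (\<lambda>u. x (a * (b * u)))"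
  have m: "m \<in> TPM A" "const_start m" "m \<simeq> l3" "l3 \<simeq> m"
    using x TPM_lower[OF TPM_lower[of x a] b(1,2)] a b reparam_sym[OF b(3)]
      const_start_affine[OF const_start_affine[of x a], of b]
    by (auto simp: m_def TPMc_iff)
  have ends: "m 1 = l3 1" "y 1 = m 0" using reparam_ends[OF m(3)] y(2) by (simp_all add: m_def)
  have ym: "y +++ m \<in> TPM A" using m y ends by (intro TPM_join) (auto simp: TPMc_iff)
  have "reparam_equiv (y +++ x) (y +++ ((m +++ l2) +++ (reversepath l2 +++ l1)))"
    by (intro reparam_join reparam_refl reparam_trans[OF l(6)] m(4))
  also have "reparam_equiv \<dots> ((y +++ (m +++ l2)) +++ (reversepath l2 +++ l1))"
    by (rule reparam_sym[OF reparam_assoc])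
  also have "reparam_equiv \<dots> (((y +++ m) +++ l2) +++ (reversepath l2 +++ l1))"
    by (intro reparam_join reparam_refl reparam_sym[OF reparam_assoc])
  finally have 1: "reparam_equiv (y +++ x) (((y +++ m) +++ l2) +++ (reversepath l2 +++ l1))" .
  have "reparam_equiv (y +++ x') (y +++ (m +++ l1))"
    by (intro reparam_join reparam_refl reparam_trans[OF l(7)] m(4))
  also have "reparam_equiv \<dots> ((y +++ m) +++ l1)" by (rule reparam_sym[OF reparam_assoc])
  finally have 2: "reparam_equiv (y +++ x') ((y +++ m) +++ l1)" .
  have "(y +++ m) 1 = l2 0" using l(4) ends by (simp add: joinpaths_def)
  with 1 2 ym l(1,2,5) show ?thesis unfolding elementary_bt_iff by blast
qed

end

section \<open>The equivalence relation and its classes\<close>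

lemma elementary_bt_ends:
  assumes "elementary_bt P x y" shows "y 0 = x 0 \<and> y 1 = x 1"
proof -
  obtain l1 l2 l3 where "reparam_equiv x ((l3 +++ l2) +++ (reversepath l2 +++ l1))" "reparam_equiv y (l3 +++ l1)"
    using assms unfolding elementary_bt_iff by blast
  from this[THEN reparam_ends] show ?thesis by (simp add: joinpaths_def)
qed

lemma bt_rel_iff_rtrancl:
  "(x, y) \<in> bt_rel P Pc \<longleftrightarrow> x \<in> Pc \<and> y \<in> Pc \<and>
     (\<lambda>x y. x \<in> Pc \<and> y \<in> Pc \<and> (x \<simeq> y \<or> elementary_bt P x y \<or> elementary_bt P y x))\<^sup>*\<^sup>* x y"
proof -
  have "{(x, y). x \<in> Pc \<and> y \<in> Pc \<and> (x \<simeq> y \<or> y \<simeq> x \<or> elementary_bt P x y \<or> elementary_bt P y x)}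
    = {(x, y). x \<in> Pc \<and> y \<in> Pc \<and> (x \<simeq> y \<or> elementary_bt P x y \<or> elementary_bt P y x)}"
    using reparam_sym by blast
  then show ?thesis unfolding bt_rel_def Enum.rtranclp_rtrancl_eq by simp
qed

text \<open>A transport principle for chains of moves. End points do not change along a chain, so
  \<open>mem\<close> and \<open>el\<close> need to hold only for paths with the end points of
  \<open>x\<close>; this allows \<open>f\<close> to be concatenation with a fixed path.\<close>

lemma bt_rel_map:
  assumes xy: "(x, y) \<in> bt_rel P Pc"
    and mem: "\<And>z. z \<in> Pc \<Longrightarrow> z 0 = x 0 \<Longrightarrow> z 1 = x 1 \<Longrightarrow> f z \<in> Pc"
    and re: "\<And>z w. z \<in> Pc \<Longrightarrow> w \<in> Pc \<Longrightarrow> z \<simeq> w \<Longrightarrow> reparam_equiv (f z) (f w)"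
    and el: "\<And>z w. z \<in> Pc \<Longrightarrow> w \<in> Pc \<Longrightarrow> z 0 = x 0 \<Longrightarrow> z 1 = x 1 \<Longrightarrow> elementary_bt P z w \<Longrightarrow>
       elementary_bt P (f z) (f w)"
  shows "(f x, f y) \<in> bt_rel P Pc \<and> y 0 = x 0 \<and> y 1 = x 1"
proof -
  define R where "R = (\<lambda>x y. x \<in> Pc \<and> y \<in> Pc \<and> (x \<simeq> y \<or> elementary_bt P x y \<or> elementary_bt P y x))"
  have x: "x \<in> Pc" and st: "R\<^sup>*\<^sup>* x y" using xy unfolding bt_rel_iff_rtrancl R_def[symmetric] by blast+
  from st have "R\<^sup>*\<^sup>* (f x) (f y) \<and> y \<in> Pc \<and> y 0 = x 0 \<and> y 1 = x 1"
  proof induction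
    case (step z w)
    have z: "z \<in> Pc" "w \<in> Pc" "z 0 = x 0" "z 1 = x 1" and zw: "z \<simeq> w \<or> elementary_bt P z w \<or> elementary_bt P w z"
      using step.hyps(2) step.IH unfolding R_def by blast+
    have w: "w 0 = x 0" "w 1 = x 1"
      using zw z(3,4) reparam_ends[of z w] elementary_bt_ends[of P z w] elementary_bt_ends[of P w z]
      by metis+
    have "R (f z) (f w)"
      unfolding R_def using zw mem[OF z(1,3,4)] mem[OF z(2) w] re[OF z(1,2)] el[OF z] el[OF z(2,1) w] by blast
    with conjunct1[OF step.IH] have "R\<^sup>*\<^sup>* (f x) (f w)" by (rule rtranclp.rtrancl_into_rtrancl[of R])
    then show ?case by (intro conjI z(2) w)
  qed (use x in simp)
  then have y: "R\<^sup>*\<^sup>* (f x) (f y)" "y \<in> Pc" "y 0 = x 0" "y 1 = x 1" by blast+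
  show ?thesis
    unfolding bt_rel_iff_rtrancl R_def[symmetric] by (intro conjI y mem[OF x refl refl] mem[OF y(2-4)])
qed

lemma bt_rel_ends: "(x, y) \<in> bt_rel P Pc \<Longrightarrow> y 0 = x 0 \<and> y 1 = x 1"
  using bt_rel_map[of x y P Pc "\<lambda>z. z"] by blast

lemma reparam_imp_bt_rel:
  "x \<simeq> y \<Longrightarrow> x \<in> Pc \<Longrightarrow> y \<in> Pc \<Longrightarrow> (x, y) \<in> bt_rel P Pc"
  unfolding bt_rel_iff_rtrancl by blast

context riemannian
begin

text \<open>One factor is varied at a time. In between, \<open>x'\<close> still ends where
  \<open>y\<close> starts, because equivalent paths share their end points.\<close>

lemma bt_rel_join:
  assumes x: "(x, x') \<in> bt_rel (TPM A) (TPMc A)" and y: "(y, y') \<in> bt_rel (TPM A) (TPMc A)" and xy: "x 1 = y 0"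
  shows "(x +++ y, x' +++ y') \<in> bt_rel (TPM A) (TPMc A)"
proof -
  have mem: "x \<in> TPMc A" "y \<in> TPMc A" "x' \<in> TPMc A" "y' \<in> TPMc A" using x y by (auto simp: bt_rel_iff_rtrancl)
  have "(x +++ y, x' +++ y) \<in> bt_rel (TPM A) (TPMc A)"
    by (rule conjunct1[OF bt_rel_map[OF x, of "\<lambda>z. z +++ y"]])
      (use mem xy in \<open>auto intro: TPMc_join reparam_join reparam_refl elementary_bt_join_right\<close>)
  moreover have "x' 1 = y 0" using bt_rel_ends[OF x] xy by simp
  then have "(x' +++ y, x' +++ y') \<in> bt_rel (TPM A) (TPMc A)"
    by (intro conjunct1[OF bt_rel_map[OF y, of "\<lambda>z. x' +++ z"]])
      (use mem in \<open>auto intro: TPMc_join reparam_join reparam_refl elementary_bt_join_left\<close>)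
  ultimately show ?thesis
    using equiv_bt_rel[of "TPMc A" "TPM A"] by (meson equivE transD)
qed

lemma TPMc_bt_cases:
  assumes "k \<in> TPMc_bt A" obtains x where "x \<in> TPMc A" "k = bt_class A x"
  using assms unfolding TPMc_bt_def bt_class_def by (rule quotientE)

lemma bt_class_mem: "x \<in> TPMc A \<Longrightarrow> bt_class A x \<in> TPMc_bt A"
  unfolding TPMc_bt_def bt_class_def by (rule quotientI)

lemma bt_class_eqI: "(x, y) \<in> bt_rel (TPM A) (TPMc A) \<Longrightarrow> bt_class A x = bt_class A y"
  unfolding bt_class_def by (rule equiv_class_eq[OF equiv_bt_rel])

lemma mem_bt_class: "z \<in> bt_class A x \<longleftrightarrow> (x, z) \<in> bt_rel (TPM A) (TPMc A)"
  by (simp add: bt_class_def)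

lemma bt_class_self: "x \<in> TPMc A \<Longrightarrow> x \<in> bt_class A x"
  unfolding bt_class_def by (rule equiv_class_self[OF equiv_bt_rel])

lemma class_start: "x \<in> TPMc A \<Longrightarrow> class_start (bt_class A x) = x 0"
  and class_finish: "x \<in> TPMc A \<Longrightarrow> class_finish (bt_class A x) = x 1"
proof -
  assume x: "x \<in> TPMc A"
  have e: "z 0 = x 0 \<and> z 1 = x 1" if "z \<in> bt_class A x" for z
    by (rule bt_rel_ends[OF that[unfolded mem_bt_class]])
  have "(\<lambda>z. z 0) ` bt_class A x = (\<lambda>_. x 0) ` bt_class A x"
    by (rule image_cong[OF refl conjunct1[OF e]])
  moreover have "(\<lambda>z. z 1) ` bt_class A x = (\<lambda>_. x 1) ` bt_class A x"
    by (rule image_cong[OF refl conjunct2[OF e]])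
  ultimately have "(\<lambda>z. z 0) ` bt_class A x = {x 0}" "(\<lambda>z. z 1) ` bt_class A x = {x 1}"
    by (simp_all only: image_constant[OF bt_class_self[OF x]])
  then show "class_start (bt_class A x) = x 0" "class_finish (bt_class A x) = x 1"
    by (simp_all add: class_start_def class_finish_def)
qed

text \<open>All pairs of representatives give the same class, so the union in the definition is a
  nonempty union of equal sets.\<close>

lemma class_comp:
  assumes "x \<in> TPMc A" "y \<in> TPMc A" "x 1 = y 0"
  shows "class_comp A (bt_class A y) (bt_class A x) = bt_class A (x +++ y)"
proof -
  have eq: "bt_class A (x' +++ y') = bt_class A (x +++ y)" if "x' \<in> bt_class A x" "y' \<in> bt_class A y" for x' y'
    using bt_class_eqI[OF bt_rel_join[OF that[unfolded mem_bt_class] assms(3)]] by (rule sym)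
  have "class_comp A (bt_class A y) (bt_class A x) = (\<Union>x'\<in>bt_class A x. \<Union>y'\<in>bt_class A y. bt_class A (x +++ y))"
    unfolding class_comp_def by (intro SUP_cong refl eq)
  also have "\<dots> = bt_class A (x +++ y)" using bt_class_self assms by blast
  finally show ?thesis .
qed

end

section \<open>The flow on classes\<close>

context complete_riemannian
begin

abbreviation "\<B> \<equiv> bt_rel (TPM A) (TPMc A)"
abbreviation "cls \<equiv> bt_class A"

lemma TPM_flow: "x \<in> TPM A \<Longrightarrow> (\<lambda>t. \<Phi> s (x t)) \<in> TPM A"
  unfolding TPM_iff by (rule bundle_smooth_flow)

lemma TPMc_flow:
  assumes "x \<in> TPMc A" shows "(\<lambda>t. \<Phi> s (x t)) \<in> TPMc A"
proof -
  obtain d where d: "d > 0" "\<forall>t\<in>{0..1}. (t < d \<longrightarrow> x t = x 0) \<and> (1 - d < t \<longrightarrow> x t = x 1)"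
    using assms unfolding TPMc_def constant_near_ends_def by blast
  have "constant_near_ends (\<lambda>t. \<Phi> s (x t))"
    unfolding constant_near_ends_def
  proof (intro exI[of _ d] conjI ballI impI)
    show "d > 0" by (rule d(1))
    show "\<Phi> s (x t) = \<Phi> s (x 0)" if "t \<in> {0..1}" "t < d" for t
      using bspec[OF d(2) that(1), THEN conjunct1, THEN mp, OF that(2)] by (rule arg_cong)
    show "\<Phi> s (x t) = \<Phi> s (x 1)" if "t \<in> {0..1}" "1 - d < t" for t
      using bspec[OF d(2) that(1), THEN conjunct2, THEN mp, OF that(2)] by (rule arg_cong)
  qed
  with assms show ?thesis by (simp add: TPMc_def TPM_flow)
qed

lemma comp_join: "(\<lambda>t. h ((p +++ q) t)) = (\<lambda>t. h (p t)) +++ (\<lambda>t. h (q t))"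
  and comp_reversepath: "(\<lambda>t. h (reversepath p t)) = reversepath (\<lambda>t. h (p t))"
  by (auto simp: joinpaths_def reversepath_def)

text \<open>The pieces of an elementary move are only known to lie in \<open>TPM A\<close>, so the
  flow must preserve smoothness of all smooth paths, not just of those constant near their
  ends.\<close>

lemma bt_rel_flow:
  assumes "(x, y) \<in> \<B>"
  shows "(\<lambda>t. \<Phi> s (x t), \<lambda>t. \<Phi> s (y t)) \<in> \<B>"
proof (rule conjunct1[OF bt_rel_map[OF assms, of "\<lambda>z t. \<Phi> s (z t)"]])
  have re: "reparam_equiv (\<lambda>t. \<Phi> s (z t)) (\<lambda>t. \<Phi> s (w t))" if "z \<simeq> w" for z w
    using that unfolding reparam_equiv_def by (elim exE conjE) (metis)
  then show "reparam_equiv (\<lambda>t. \<Phi> s (z t)) (\<lambda>t. \<Phi> s (w t))" if "z \<simeq> w" for z w using that .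
  show "elementary_bt (TPM A) (\<lambda>t. \<Phi> s (z t)) (\<lambda>t. \<Phi> s (w t))" if e: "elementary_bt (TPM A) z w" for z w
  proof -
    obtain l1 l2 l3 where l: "l1 \<in> TPM A" "l2 \<in> TPM A" "l3 \<in> TPM A" "l3 1 = l2 0" "l2 0 = l1 0"
      "reparam_equiv z ((l3 +++ l2) +++ (reversepath l2 +++ l1))" "reparam_equiv w (l3 +++ l1)"
      using e unfolding elementary_bt_iff by blast
    show ?thesis
      unfolding elementary_bt_iff
    proof (intro bexI conjI)
      show "reparam_equiv (\<lambda>t. \<Phi> s (w t)) ((\<lambda>t. \<Phi> s (l3 t)) +++ (\<lambda>t. \<Phi> s (l1 t)))"
        using re[OF l(7)] unfolding comp_join .
      show "reparam_equiv (\<lambda>t. \<Phi> s (z t)) (((\<lambda>t. \<Phi> s (l3 t)) +++ (\<lambda>t. \<Phi> s (l2 t))) +++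
          (reversepath (\<lambda>t. \<Phi> s (l2 t)) +++ (\<lambda>t. \<Phi> s (l1 t))))"
        using re[OF l(6)] unfolding comp_join comp_reversepath .
    qed (use l TPM_flow in auto)
  qed
qed (rule TPMc_flow)

lemma class_geodesic:
  assumes "x \<in> TPMc A"
  shows "class_geodesic A g (cls x) s = cls (\<lambda>t. \<Phi> s (x t))"
proof -
  have eq: "cls (path_geodesic A g x' s) = cls (\<lambda>t. \<Phi> s (x t))" if "x' \<in> cls x" for x'
    using bt_class_eqI[OF bt_rel_flow[OF that[unfolded mem_bt_class], of s]] by (simp add: path_geodesic_eq)
  have "class_geodesic A g (cls x) s = (\<Union>x'\<in>cls x. cls (\<lambda>t. \<Phi> s (x t)))"
    unfolding class_geodesic_def by (intro SUP_cong refl eq)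
  also have "\<dots> = cls (\<lambda>t. \<Phi> s (x t))" using bt_class_self[OF assms] by blast
  finally show ?thesis .
qed

abbreviation "\<K> \<equiv> TPMc_bt A"
abbreviation "geo \<equiv> class_geodesic A g"
abbreviation "cc \<equiv> class_comp A"
abbreviation "seg \<equiv> segment A g"
abbreviation "hdef \<equiv> hdefined A g"
abbreviation "hc \<equiv> hcomp A g"
abbreviation "\<C> \<equiv> Cgeod A"
abbreviation "\<D> \<equiv> Cgeod2 A g"

lemma class_start_mem: "k \<in> \<K> \<Longrightarrow> class_start k \<in> TB"
  and class_finish_mem: "k \<in> \<K> \<Longrightarrow> class_finish k \<in> TB"
  by (auto elim!: TPMc_bt_cases simp: class_start class_finish TPMc_mem)

text \<open>The last conclusion is what makes source and target multiplicative: evolving a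
  concatenation is concatenating the evolved paths, whose end points still match because the flow
  acts pointwise.\<close>

lemma class_comp_mem:
  assumes "k1 \<in> \<K>" "k2 \<in> \<K>" "class_start k2 = class_finish k1"
  shows "cc k2 k1 \<in> \<K>" "class_start (cc k2 k1) = class_start k1"
    "class_finish (cc k2 k1) = class_finish k2"
    "geo (cc k2 k1) s = cc (geo k2 s) (geo k1 s)"
proof -
  obtain x1 where x1: "x1 \<in> TPMc A" "k1 = cls x1" using assms(1) by (rule TPMc_bt_cases)
  obtain x2 where x2: "x2 \<in> TPMc A" "k2 = cls x2" using assms(2) by (rule TPMc_bt_cases)
  have e: "x1 1 = x2 0" using assms(3) x1 x2 by (simp add: class_start class_finish)
  have j: "x1 +++ x2 \<in> TPMc A" by (rule TPMc_join[OF x1(1) x2(1) e])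
  have c: "cc k2 k1 = cls (x1 +++ x2)" unfolding x1(2) x2(2) by (rule class_comp[OF x1(1) x2(1) e])
  show "cc k2 k1 \<in> \<K>" unfolding c by (rule bt_class_mem[OF j])
  show "class_start (cc k2 k1) = class_start k1" "class_finish (cc k2 k1) = class_finish k2"
    unfolding c using j x1 x2 by (simp_all add: class_start class_finish joinpaths_def)
  have "cc (cls (\<lambda>t. \<Phi> s (x2 t))) (cls (\<lambda>t. \<Phi> s (x1 t))) =
      cls ((\<lambda>t. \<Phi> s (x1 t)) +++ (\<lambda>t. \<Phi> s (x2 t)))"
    by (rule class_comp[OF TPMc_flow[OF x1(1)] TPMc_flow[OF x2(1)]]) (simp add: e)
  then show "geo (cc k2 k1) s = cc (geo k2 s) (geo k1 s)"
    unfolding c class_geodesic[OF j] comp_join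
    unfolding x1(2) x2(2) class_geodesic[OF x1(1)] class_geodesic[OF x2(1)] by (rule sym)
qed

lemma class_comp_assoc:
  assumes "k1 \<in> \<K>" "k2 \<in> \<K>" "k3 \<in> \<K>" "class_start k2 = class_finish k1" "class_start k3 = class_finish k2"
  shows "cc k3 (cc k2 k1) = cc (cc k3 k2) k1"
proof -
  obtain x1 where x1: "x1 \<in> TPMc A" "k1 = cls x1" using assms(1) by (rule TPMc_bt_cases)
  obtain x2 where x2: "x2 \<in> TPMc A" "k2 = cls x2" using assms(2) by (rule TPMc_bt_cases)
  obtain x3 where x3: "x3 \<in> TPMc A" "k3 = cls x3" using assms(3) by (rule TPMc_bt_cases)
  have e: "x1 1 = x2 0" "x2 1 = x3 0" using assms(4,5) x1 x2 x3 by (simp_all add: class_start class_finish)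
  have j: "x1 +++ x2 \<in> TPMc A" "x2 +++ x3 \<in> TPMc A" using TPMc_join x1 x2 x3 e by blast+
  have f: "(x1 +++ x2) 1 = x3 0" "x1 1 = (x2 +++ x3) 0" using e by (simp_all add: joinpaths_def)
  have "cls ((x1 +++ x2) +++ x3) = cls (x1 +++ (x2 +++ x3))"
    by (intro bt_class_eqI reparam_imp_bt_rel reparam_assoc TPMc_join x1 x2 x3 e f)
  then show ?thesis
    unfolding x1(2) x2(2) x3(2) class_comp[OF x1(1) x2(1) e(1)] class_comp[OF x2(1) x3(1) e(2)]
      class_comp[OF j(1) x3(1) f(1)] class_comp[OF x1(1) j(2) f(2)] .
qed

lemma class_const:
  assumes "v \<in> TB"
  shows "cls (\<lambda>_. v) \<in> \<K>" "class_start (cls (\<lambda>_. v)) = v" "class_finish (cls (\<lambda>_. v)) = v"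
  using TPMc_const[OF assms] by (simp_all add: bt_class_mem class_start class_finish)

lemma class_comp_unit:
  assumes "k \<in> \<K>"
  shows "cc k (cls (\<lambda>_. class_start k)) = k" "cc (cls (\<lambda>_. class_finish k)) k = k"
proof -
  obtain x where x: "x \<in> TPMc A" "k = cls x" using assms by (rule TPMc_bt_cases)
  have c: "(\<lambda>_. x 0) \<in> TPMc A" "(\<lambda>_. x 1) \<in> TPMc A" using TPMc_mem[OF x(1)] by (simp_all add: TPMc_const)
  have s: "reparam_equiv x ((\<lambda>_. x 0) +++ x)" "reparam_equiv x (x +++ (\<lambda>_. x 1))"
    using x(1) by (auto simp: TPMc_iff intro: reparam_unit_left reparam_unit_right)
  have b: "cls x = cls ((\<lambda>_. x 0) +++ x)" "cls x = cls (x +++ (\<lambda>_. x 1))"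
    by (intro bt_class_eqI reparam_imp_bt_rel s TPMc_join x c refl)+
  show "cc k (cls (\<lambda>_. class_start k)) = k"
    unfolding x(2) class_start[OF x(1)] class_comp[OF c(1) x(1) refl] by (rule b(1)[symmetric])
  show "cc (cls (\<lambda>_. class_finish k)) k = k"
    unfolding x(2) class_finish[OF x(1)] class_comp[OF x(1) c(2) refl] by (rule b(2)[symmetric])
qed

lemma geo:
  assumes "k \<in> \<K>"
  shows "geo k s \<in> \<K>" "geo k 0 = k" "geo (geo k s) r = geo k (r + s)"
    "class_start (geo k s) = \<Phi> s (class_start k)" "class_finish (geo k s) = \<Phi> s (class_finish k)"
proof -
  obtain x where x: "x \<in> TPMc A" "k = cls x" using assms by (rule TPMc_bt_cases)
  note xs = TPMc_flow[OF x(1), of s]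
  \<comment> \<open>Outside \<open>{0..1}\<close> a representative is arbitrary and may leave
    \<open>TB\<close>, where the flow laws are available. Hence the laws hold on
    \<open>{0..1}\<close> only, and the classes are identified by the trivial
    reparametrization.\<close>
  have cong: "cls z = cls w" if "z \<in> TPMc A" "w \<in> TPMc A" "\<And>t. t \<in> {0..1} \<Longrightarrow> w t = z t" for z w
    using that by (intro bt_class_eqI reparam_imp_bt_rel reparam_cong) auto
  show "geo k s \<in> \<K>" unfolding x(2) class_geodesic[OF x(1)] by (rule bt_class_mem[OF xs])
  show "geo k 0 = k" unfolding x(2) class_geodesic[OF x(1)]
    by (rule cong[OF TPMc_flow[OF x(1)] x(1)]) (simp add: flow_zero[OF TPMc_mem[OF x(1)]])
  show "geo (geo k s) r = geo k (r + s)"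
    unfolding x(2) class_geodesic[OF x(1)] class_geodesic[OF xs]
    by (rule cong[OF TPMc_flow[OF xs] TPMc_flow[OF x(1)]]) (simp add: flow_flow[OF TPMc_mem[OF x(1)]])
  show "class_start (geo k s) = \<Phi> s (class_start k)" "class_finish (geo k s) = \<Phi> s (class_finish k)"
    unfolding x(2) class_geodesic[OF x(1)] using class_start[OF x(1)] class_start[OF xs] class_finish[OF x(1)] class_finish[OF xs]
    by simp_all
qed

lemma geo_inj: assumes "k \<in> \<K>" "k' \<in> \<K>" "geo k s = geo k' s" shows "k = k'"
proof -
  have inv: "geo (geo k s) (- s) = k" if "k \<in> \<K>" for k
    unfolding geo(3)[OF that] by (simp add: geo(2)[OF that])
  show ?thesis using inv[OF assms(1)] inv[OF assms(2)] unfolding assms(3) by (rule trans[OF sym])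
qed

text \<open>The value at the left end, which lies in the interval by \<open>a \<le> b\<close>,
  determines \<open>k\<close> through the inverse flow.\<close>

lemma initial_segment:
  assumes "k \<in> \<K>" "a \<le> b" shows "initial A g (seg a b k) = k"
  unfolding initial_def
proof (rule the_equality)
  show "k \<in> \<K> \<and> seg a b k = seg (fst (seg a b k)) (fst (snd (seg a b k))) k"
    using assms by (simp add: segment_def)
  fix k' assume k': "k' \<in> \<K> \<and> seg a b k = seg (fst (seg a b k)) (fst (snd (seg a b k))) k'"
  then have "restrict (geo k) {a..b} a = restrict (geo k') {a..b} a" by (simp add: segment_def)
  then have "geo k a = geo k' a" using assms(2) by simp
  with assms(1) k' show "k' = k" using geo_inj by metis
qed

section \<open>Segments in terms of their initial conditions\<close>

lemma Arr_cases:
  assumes "F \<in> Arr \<D>"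
  obtains a b k where "k \<in> \<K>" "a \<le> b" "F = seg a b k"
  using assms by (auto simp: Cgeod2_def)

lemma Arr_segment: "k \<in> \<K> \<Longrightarrow> a \<le> b \<Longrightarrow> seg a b k \<in> Arr \<D>"
  by (auto simp: Cgeod2_def)

lemma Src_segment: "a \<le> b \<Longrightarrow> Src \<D> (seg a b k) = (geo k a, a)"
  and Tgt_segment: "a \<le> b \<Longrightarrow> Tgt \<D> (seg a b k) = (geo k b, b)"
  by (simp_all add: Cgeod2_def segment_def)

text \<open>Initial conditions refer to the parameter \<open>0\<close>, so the degenerate segment at
  \<open>a\<close> with value \<open>k\<close> has to be generated by \<open>k\<close> flowed back
  by \<open>a\<close>.\<close>

lemma Idn_segment:
  assumes "k \<in> \<K>" shows "Idn \<D> (k, a) = seg a a (geo k (- a))"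
  using geo(2)[OF assms] geo(3)[OF assms, of a "- a"]
  by (auto simp: Cgeod2_def segment_def fun_eq_iff restrict_def geo(3)[OF assms])

text \<open>The definition reads only the right end of the second segment and everything else from
  the first, so \<open>k'\<close> disappears; for composable segments the two initial conditions
  agree anyway.\<close>

lemma Cmp_segment:
  "k \<in> \<K> \<Longrightarrow> a \<le> b \<Longrightarrow> Cmp \<D> (seg b' c k') (seg a b k) = seg a c k"
  using initial_segment[of k a b] by (simp add: Cgeod2_def) (simp add: segment_def)

text \<open>Source and target record position and velocity at \<open>b\<close>; by injectivity of
  the flow they force both segments to belong to the same path space geodesic.\<close>

lemma composable_segments:
  assumes "composable \<D> G F"
  obtains a b c k where "k \<in> \<K>" "a \<le> b" "b \<le> c" "G = seg b c k" "F = seg a b k"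
proof -
  have GF: "G \<in> Arr \<D>" "F \<in> Arr \<D>" "Src \<D> G = Tgt \<D> F"
    using assms by (auto simp: composable_def)
  obtain b' c k' where G: "k' \<in> \<K>" "b' \<le> c" "G = seg b' c k'" using GF(1) by (rule Arr_cases)
  obtain a b k where F: "k \<in> \<K>" "a \<le> b" "F = seg a b k" using GF(2) by (rule Arr_cases)
  have "(geo k' b', b') = (geo k b, b)"
    using GF(3) unfolding G(3) F(3) Src_segment[OF G(2)] Tgt_segment[OF F(2)] .
  then have b: "b' = b" and "geo k' b' = geo k b" by blast+
  from this(2) have "geo k' b = geo k b" unfolding b .
  with geo_inj[OF G(1) F(1)] have "k' = k" by simp
  with G F b show thesis using that by blast
qed

lemma composable_segmentsI:
  "k \<in> \<K> \<Longrightarrow> a \<le> b \<Longrightarrow> b \<le> c \<Longrightarrow> composable \<D> (seg b c k) (seg a b k)"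
  by (simp add: composable_def Arr_segment Src_segment Tgt_segment)

section \<open>The axioms of the two categories and of the double category\<close>

lemma category_Cgeod: "category \<C>"
proof -
  have ends: "k2 \<in> \<K>" "k1 \<in> \<K>" "class_start k2 = class_finish k1" "a2 = a1"
    if "composable \<C> (k2, a2) (k1, a1)" for k1 k2 a1 a2
    using that by (auto simp: composable_def Cgeod_def prod_eq_iff)
  show ?thesis
    unfolding category_def
  proof (intro conjI ballI allI impI)
    fix F assume "F \<in> Arr \<C>"
    then obtain k a where F: "F = (k, a)" "k \<in> \<K>" by (auto simp: Cgeod_def)
    show "Src \<C> F \<in> Obj \<C>" "Tgt \<C> F \<in> Obj \<C>"
      using class_start_mem[OF F(2)] class_finish_mem[OF F(2)] F(1) by (simp_all add: Cgeod_def tangent_bundle_def)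
    show "Cmp \<C> F (Idn \<C> (Src \<C> F)) = F" "Cmp \<C> (Idn \<C> (Tgt \<C> F)) F = F"
      using class_comp_unit[OF F(2)] F(1) by (simp_all add: Cgeod_def)
  next
    fix X assume "X \<in> Obj \<C>"
    then obtain v a where X: "X = (fst v, snd v, a)" "v \<in> TB"
      by (auto simp: Cgeod_def tangent_bundle_def)
    show "Idn \<C> X \<in> Arr \<C>" "Src \<C> (Idn \<C> X) = X" "Tgt \<C> (Idn \<C> X) = X"
      using class_const[OF X(2)] X(1) by (simp_all add: Cgeod_def)
  next
    fix G F assume GF: "composable \<C> G F"
    obtain k1 a1 k2 a2 where e: "G = (k2, a2)" "F = (k1, a1)" by (metis surj_pair)
    note c = ends[OF GF[unfolded e]]
    show "Cmp \<C> G F \<in> Arr \<C>" "Src \<C> (Cmp \<C> G F) = Src \<C> F"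
      "Tgt \<C> (Cmp \<C> G F) = Tgt \<C> G"
      using class_comp_mem[OF c(2,1,3)] c(4) e by (simp_all add: Cgeod_def)
  next
    fix H G F assume HG: "composable \<C> H G" and GF: "composable \<C> G F"
    obtain k1 a1 k2 a2 k3 a3 where e: "H = (k3, a3)" "G = (k2, a2)" "F = (k1, a1)" by (metis surj_pair)
    note c = ends[OF GF[unfolded e]] and c' = ends[OF HG[unfolded e]]
    show "Cmp \<C> H (Cmp \<C> G F) = Cmp \<C> (Cmp \<C> H G) F"
      using class_comp_assoc[OF c(2,1) c'(1) c(3) c'(3)] e by (simp add: Cgeod_def)
  qed
qed

lemma category_Cgeod2: "category \<D>"
  unfolding category_def
proof (intro conjI ballI allI impI)
  fix F assume "F \<in> Arr \<D>"
  then obtain a b k where F: "k \<in> \<K>" "a \<le> b" "F = seg a b k" by (rule Arr_cases)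
  \<comment> \<open>Flowing to \<open>r\<close> and back by \<open>r\<close> cancels, so the
    identity at a point of the geodesic is a degenerate segment of the same geodesic.\<close>
  have id: "Idn \<D> (geo k r, r) = seg r r k" for r
    using Idn_segment[OF geo(1)[OF F(1)]] geo(2,3)[OF F(1)] by simp
  show "Src \<D> F \<in> Obj \<D>" "Tgt \<D> F \<in> Obj \<D>"
    unfolding F(3) Src_segment[OF F(2)] Tgt_segment[OF F(2)] using geo(1)[OF F(1)] by (simp_all add: Cgeod2_def)
  show "Cmp \<D> F (Idn \<D> (Src \<D> F)) = F"
    "Cmp \<D> (Idn \<D> (Tgt \<D> F)) F = F"
    unfolding F(3) Src_segment[OF F(2)] Tgt_segment[OF F(2)] id using F by (simp_all add: Cmp_segment)
next
  fix X assume "X \<in> Obj \<D>"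
  then obtain k a where X: "X = (k, a)" "k \<in> \<K>" by (auto simp: Cgeod2_def)
  have "geo (geo k (- a)) a = k" using geo(2,3)[OF X(2)] by simp
  then show "Idn \<D> X \<in> Arr \<D>" "Src \<D> (Idn \<D> X) = X"
    "Tgt \<D> (Idn \<D> X) = X"
    unfolding X(1) Idn_segment[OF X(2)] by (simp_all add: Arr_segment Src_segment Tgt_segment geo(1)[OF X(2)])
next
  fix G F assume "composable \<D> G F"
  then obtain a b c k where "k \<in> \<K>" "a \<le> b" "b \<le> c" "G = seg b c k" "F = seg a b k"
    by (rule composable_segments)
  then show "Cmp \<D> G F \<in> Arr \<D>" "Src \<D> (Cmp \<D> G F) = Src \<D> F"
    "Tgt \<D> (Cmp \<D> G F) = Tgt \<D> G"
    by (simp_all add: Cmp_segment Arr_segment Src_segment Tgt_segment)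
next
  fix H G F assume HG: "composable \<D> H G" and GF: "composable \<D> G F"
  obtain a b c k where 1: "k \<in> \<K>" "a \<le> b" "b \<le> c" "G = seg b c k" "F = seg a b k"
    using GF by (rule composable_segments)
  \<comment> \<open>By \<open>Cmp_segment\<close>, composition with \<open>H\<close> on the left
    depends on its right end alone, so no information on \<open>H'\<close> is kept.\<close>
  obtain H' where 2: "H = seg (fst H) (fst (snd H)) H'"
    using HG unfolding composable_def by (auto elim!: Arr_cases simp: segment_def)
  show "Cmp \<D> H (Cmp \<D> G F) = Cmp \<D> (Cmp \<D> H G) F"
    using 1 by (subst (1 2) 2) (simp add: Cmp_segment)
qed

lemma hdefined_segments:
  "k \<in> \<K> \<Longrightarrow> k' \<in> \<K> \<Longrightarrow> a \<le> b \<Longrightarrow> a' \<le> b' \<Longrightarrow>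
   hdef (seg a' b' k') (seg a b k) \<longleftrightarrow> a' = a \<and> b' = b \<and> class_finish k = class_start k'"
  by (auto simp: hdefined_def Arr_segment initial_segment) (simp_all add: segment_def)

lemma hcomp_segments:
  "k \<in> \<K> \<Longrightarrow> k' \<in> \<K> \<Longrightarrow> a \<le> b \<Longrightarrow> a' \<le> b' \<Longrightarrow>
   hc (seg a' b' k') (seg a b k) = seg a b (cc k' k)"
  by (simp add: hcomp_def initial_segment) (simp add: segment_def)

lemma double_category_Cgeod2: "double_category (Cgeod A) (Cgeod2 A g) (hdefined A g) (hcomp A g)"
  unfolding double_category_def
proof (intro conjI allI impI category_Cgeod category_Cgeod2)
  show "Obj \<D> = Arr \<C>" by (simp add: Cgeod_def Cgeod2_def)
next
  fix G F assume h: "hdef G F"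
  then have GF: "G \<in> Arr \<D>" "F \<in> Arr \<D>" by (auto simp: hdefined_def)
  obtain a' b' k' where G: "k' \<in> \<K>" "a' \<le> b'" "G = seg a' b' k'" using GF(1) by (rule Arr_cases)
  obtain a b k where F: "k \<in> \<K>" "a \<le> b" "F = seg a b k" using GF(2) by (rule Arr_cases)
  have eq: "a' = a" "b' = b" "class_start k' = class_finish k"
    using h unfolding G(3) F(3) hdefined_segments[OF F(1) G(1) F(2) G(2)] by simp_all
  note c = class_comp_mem[OF F(1) G(1) eq(3)]
  have hcGF: "hc G F = seg a b (cc k' k)"
    unfolding G(3) F(3) by (rule hcomp_segments[OF F(1) G(1) F(2) G(2)])
  \<comment> \<open>Horizontal composability is required at parameter \<open>0\<close>, possibly
    outside the interval. The flow carries the common end point, with its vector, to every other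
    parameter \<open>r\<close>.\<close>
  have sc: "composable \<C> (geo k' r, r) (geo k r, r)" for r
    using geo[OF F(1)] geo[OF G(1)] eq(3) by (simp add: composable_def Cgeod_def)
  have cm: "Cmp \<C> (geo k' r, r) (geo k r, r) = (geo (cc k' k) r, r)" for r
    using c(4) by (simp add: Cgeod_def)
  have src: "Src \<D> G = (geo k' a, a)" "Src \<D> F = (geo k a, a)"
    "Tgt \<D> G = (geo k' b, b)" "Tgt \<D> F = (geo k b, b)"
    using G F eq by (simp_all add: Src_segment Tgt_segment)
  show "G \<in> Arr \<D>" "F \<in> Arr \<D>" by fact+
  show "hc G F \<in> Arr \<D>" unfolding hcGF by (rule Arr_segment[OF c(1) F(2)])
  show "composable \<C> (Src \<D> G) (Src \<D> F)" unfolding src by (rule sc)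
  show "composable \<C> (Tgt \<D> G) (Tgt \<D> F)" unfolding src by (rule sc)
  show "Src \<D> (hc G F) = Cmp \<C> (Src \<D> G) (Src \<D> F)"
    unfolding src cm hcGF by (rule Src_segment[OF F(2)])
  show "Tgt \<D> (hc G F) = Cmp \<C> (Tgt \<D> G) (Tgt \<D> F)"
    unfolding src cm hcGF by (rule Tgt_segment[OF F(2)])
next
  fix G' G F' F
  assume "composable \<D> G' G \<and> composable \<D> F' F \<and> hdef G' F' \<and> hdef G F \<and>
     (hdef (Cmp \<D> G' G) (Cmp \<D> F' F) \<or>
      composable \<D> (hc G' F') (hc G F))"
  then have *: "composable \<D> G' G" "composable \<D> F' F" "hdef G F" "hdef G' F'" by auto
  obtain a b c k where F: "k \<in> \<K>" "a \<le> b" "b \<le> c" "F' = seg b c k" "F = seg a b k"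
    using *(2) by (rule composable_segments)
  obtain a' b' c' k' where G: "k' \<in> \<K>" "a' \<le> b'" "b' \<le> c'" "G' = seg b' c' k'" "G = seg a' b' k'"
    using *(1) by (rule composable_segments)
  have ac: "a \<le> c" "a' \<le> c'" using F(2,3) G(2,3) by linarith+
  have eq: "a' = a" "b' = b" "class_start k' = class_finish k" and "c' = c"
    using *(3,4) unfolding F(4,5) G(4,5) hdefined_segments[OF F(1) G(1) F(2) G(2)]
      hdefined_segments[OF F(1) G(1) F(3) G(3)] by simp_all
  note kk = class_comp_mem(1)[OF F(1) G(1) eq(3)]
  \<comment> \<open>Vertical composition keeps the initial conditions and horizontal composition
    keeps the interval, so both sides of the exchange law become the segment of
    \<open>cc k' k\<close> over \<open>{a..c}\<close>.\<close>
  have v: "Cmp \<D> G' G = seg a' c' k'" "Cmp \<D> F' F = seg a c k"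
    using F G by (simp_all add: Cmp_segment)
  have h: "hc G' F' = seg b c (cc k' k)" "hc G F = seg a b (cc k' k)"
    unfolding F(4,5) G(4,5) hcomp_segments[OF F(1) G(1) F(2) G(2)] hcomp_segments[OF F(1) G(1) F(3) G(3)] by simp_all
  show "hdef (Cmp \<D> G' G) (Cmp \<D> F' F)"
    unfolding v hdefined_segments[OF F(1) G(1) ac] using eq \<open>c' = c\<close> by simp
  show "composable \<D> (hc G' F') (hc G F)"
    unfolding h by (rule composable_segmentsI[OF kk F(2,3)])
  show "hc (Cmp \<D> G' G) (Cmp \<D> F' F) = Cmp \<D> (hc G' F') (hc G F)"
    unfolding v h hcomp_segments[OF F(1) G(1) ac] Cmp_segment[OF kk F(2)] ..
qed

end


theorem theorem4p2:
  fixes A :: "('a::{t2_space, second_countable_topology}, 'e::euclidean_space) chart set"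
    and g :: "('a, 'e) metric"
  assumes "smooth_atlas A" and "riemannian_metric A g" and "complete_metric A g"
  shows "double_category (Cgeod A) (Cgeod2 A g) (hdefined A g) (hcomp A g)"
proof -
  interpret complete_riemannian A g by unfold_locales (use assms in auto)
  show ?thesis by (rule double_category_Cgeod2)
qed

end
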